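(* Let $K$ be a field, $S=K[x_1,\dots,x_n]$, and let $I\subset S$ be a polymatroidal ideal. Then for all integers $i,j\ge0$ and all $k\ge1$, $$\beta_j(\mathrm{HS}_i(I^k))\le\beta_j(\mathrm{HS}_i(I^{k+1})).$$ In particular, for every $i\ge 0$ the function $k\mapsto\mathrm{depth}\,S/\mathrm{HS}_i(I^k)$ is non-increasing, that is, $\mathrm{depth}\,S/\mathrm{HS}_i(I^k)\ge\mathrm{depth}\,S/\mathrm{HS}_i(I^{k+1})$ for all $k\ge1$.
   Context: $S$ carries its standard $\mathbb{Z}^n$-grading. For a monomial ideal $J$, $\mathcal{G}(J)$ denotes its minimal set of monomial generators, and $\deg_{x_i}(u)$ is the exponent of $x_i$ in the monomial $u$. For $i\ge0$, $\mathrm{HS}_i(J)=(\mathbf{x}^{\mathbf a}:\ \mathrm{Tor}_i^S(K,J)_{\mathbf a}\neq0)$, where $\mathbf{x}^{\mathbf a}=x_1^{a_1}\cdots x_n^{a_n}$ (the zero ideal if $\mathrm{Tor}_i^S(K,J)=0$). The $j$th (total) Betti number of a graded ideal $L$ is $\beta_j(L)=\dim_K\mathrm{Tor}_j^S(K,L)$. A nonzero monomial ideal $I$ is polymatroidal if all elements of $\mathcal{G}(I)$ have the same degree and: for all $u,v\in\mathcal{G}(I)$ and all $i$ with $\deg_{x_i}(u)>\deg_{x_i}(v)$, there is $j$ with $\deg_{x_j}(u)<\deg_{x_j}(v)$ such that $x_j(u/x_i)\in\mathcal{G}(I)$. *)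

theory Defs
  imports "HOL-Library.Poly_Mapping" "HOL-Library.Extended_Nat" "HOL-Library.Countable"
begin

section \<open>The polynomial ring and its ideals\<close>

text \<open>The variables are indexed by a finite type \<open>'n\<close>, so the number of variables is
  \<open>n = CARD('n)\<close>. A monomial is represented by its exponent vector.\<close>

type_synonym 'n mon = "'n \<Rightarrow>\<^sub>0 nat"
type_synonym ('n, 'k) mpoly = "'n mon \<Rightarrow>\<^sub>0 'k"

definition monom :: "'n mon \<Rightarrow> ('n, 'k::comm_ring_1) mpoly" where
  "monom a = Poly_Mapping.single a 1"

definition const :: "'k \<Rightarrow> ('n, 'k::comm_ring_1) mpoly" where
  "const c = Poly_Mapping.single 0 c"

definition ideal_gen :: "'a::comm_ring_1 set \<Rightarrow> 'a set" where
  "ideal_gen = module.span (*)"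

definition ideal_prod :: "'a::comm_ring_1 set \<Rightarrow> 'a set \<Rightarrow> 'a set" where
  "ideal_prod I J = ideal_gen {f * g | f g. f \<in> I \<and> g \<in> J}"

primrec ideal_power :: "'a::comm_ring_1 set \<Rightarrow> nat \<Rightarrow> 'a set" where
  "ideal_power I 0 = UNIV"
| "ideal_power I (Suc k) = ideal_prod I (ideal_power I k)"

definition monomial_ideal :: "('n, 'k::comm_ring_1) mpoly set \<Rightarrow> bool" where
  "monomial_ideal J \<longleftrightarrow> (\<exists>A. J = ideal_gen (monom ` A))"

text \<open>\<open>\<G>(J)\<close>: the monomials in \<open>J\<close> that are minimal with respect to divisibility. The lemmas
  \<open>ideal_gen_min_gens\<close> and \<open>min_gens_least\<close> below show that for a monomial ideal this is the
  least set of monomials generating it.\<close>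

definition min_gens :: "('n, 'k::comm_ring_1) mpoly set \<Rightarrow> 'n mon set" where
  "min_gens J = {u. monom u \<in> J \<and> (\<forall>v. monom v \<in> J \<and> (\<exists>w. u = v + w) \<longrightarrow> v = u)}"

definition polymatroidal :: "('n::finite, 'k::field) mpoly set \<Rightarrow> bool" where
  "polymatroidal I \<longleftrightarrow>
     monomial_ideal I \<and> I \<noteq> {0} \<and>
     (\<forall>u\<in>min_gens I. \<forall>v\<in>min_gens I. (\<Sum>i\<in>UNIV. Poly_Mapping.lookup u i) = (\<Sum>i\<in>UNIV. Poly_Mapping.lookup v i)) \<and>
     (\<forall>u\<in>min_gens I. \<forall>v\<in>min_gens I. \<forall>i. Poly_Mapping.lookup u i > Poly_Mapping.lookup v i \<longrightarrow>
        (\<exists>j. Poly_Mapping.lookup u j < Poly_Mapping.lookup v j \<and>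
             Poly_Mapping.single j 1 + (u - Poly_Mapping.single i 1) \<in> min_gens I))"


section \<open>Multigraded free resolutions of the residue field\<close>

text \<open>A complex \<open>\<dots> \<rightarrow> F\<^sub>1 \<rightarrow> F\<^sub>0 \<rightarrow> K\<close>, where \<open>F\<^sub>i\<close> is the free \<open>S\<close>-module with basis
  \<open>e\<^sub>b\<close> (\<open>b \<in> gens i\<close>), \<open>e\<^sub>b\<close> having multidegree \<open>gdeg i b\<close>. The map \<open>bd i\<close> goes from
  \<open>F\<^sub>i\<^sub>+\<^sub>1\<close> to \<open>F\<^sub>i\<close>; it is a total function on coefficient vectors, of which only the
  restriction to \<open>F\<^sub>i\<^sub>+\<^sub>1\<close> matters. Since \<open>K\<close> lives in degree \<open>0\<close>, it is enough to
  allow basis degrees with nonnegative entries.\<close>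

type_synonym ('n, 'k) fvec = "nat \<Rightarrow>\<^sub>0 ('n, 'k) mpoly"

record (overloaded) ('n, 'k) free_complex =
  gens :: "nat \<Rightarrow> nat set"
  gdeg :: "nat \<Rightarrow> nat \<Rightarrow> 'n mon"
  bd :: "nat \<Rightarrow> ('n, 'k) fvec \<Rightarrow> ('n, 'k) fvec"
  aug :: "('n, 'k) fvec \<Rightarrow> 'k"

definition smult :: "'a::comm_ring_1 \<Rightarrow> (nat \<Rightarrow>\<^sub>0 'a) \<Rightarrow> (nat \<Rightarrow>\<^sub>0 'a)" where
  "smult s = Poly_Mapping.map ((*) s)"

definition free_mod :: "('n, 'k::field) free_complex \<Rightarrow> nat \<Rightarrow> ('n, 'k) fvec set" where
  "free_mod P i = {f. Poly_Mapping.keys f \<subseteq> gens P i}"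

definition homog :: "('n, 'k::field) free_complex \<Rightarrow> nat \<Rightarrow> 'n mon \<Rightarrow> ('n, 'k) fvec set" where
  "homog P i a = {f. \<forall>b\<in>Poly_Mapping.keys f.
     \<forall>t\<in>Poly_Mapping.keys (Poly_Mapping.lookup f b). t + gdeg P i b = a}"

text \<open>\<open>K = S/(x\<^sub>1,\<dots>,x\<^sub>n)\<close> is concentrated in multidegree \<open>0\<close>, and \<open>S\<close> acts on it through
  the constant coefficient.\<close>

definition is_resolution_of_field :: "('n::finite, 'k::field) free_complex \<Rightarrow> bool" where
  "is_resolution_of_field P \<longleftrightarrow>
     (\<forall>i. module_hom smult smult (bd P i)) \<and>
     (\<forall>i. bd P i ` free_mod P (Suc i) \<subseteq> free_mod P i) \<and>
     (\<forall>i a. bd P i ` (free_mod P (Suc i) \<inter> homog P (Suc i) a) \<subseteq> homog P i a) \<and>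
     module_hom smult (\<lambda>s c. Poly_Mapping.lookup s 0 * c) (aug P) \<and>
     (\<forall>a. a \<noteq> 0 \<longrightarrow> (\<forall>f \<in> free_mod P 0 \<inter> homog P 0 a. aug P f = 0)) \<and>
     aug P ` free_mod P 0 = UNIV \<and>
     bd P 0 ` free_mod P (Suc 0) = {f \<in> free_mod P 0. aug P f = 0} \<and>
     (\<forall>i. bd P (Suc i) ` free_mod P (Suc (Suc i)) = {f \<in> free_mod P (Suc i). bd P i f = 0})"

text \<open>Tor is the homology of the tensor product with a free resolution of \<open>K\<close>, which is fixed
  once and for all; existence is \<open>resolution_exists\<close> below.\<close>

definition res_field :: "('n::finite, 'k::field) free_complex" where
  "res_field = (SOME P. is_resolution_of_field P)"


section \<open>Tor, Betti numbers and homological shift ideals\<close>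

text \<open>Since \<open>F\<^sub>i\<close> is free, \<open>F\<^sub>i \<otimes> J\<close> is identified with the vectors in \<open>F\<^sub>i\<close> all of whose
  coefficients lie in \<open>J\<close>; \<open>Tor\<^sub>i(K,J)\<close> is \<open>tor_cycles i J\<close> modulo \<open>tor_boundaries i J\<close>.\<close>

definition tor_chains :: "nat \<Rightarrow> ('n::finite, 'k::field) mpoly set \<Rightarrow> ('n, 'k) fvec set" where
  "tor_chains i J = {f \<in> free_mod res_field i. \<forall>b\<in>Poly_Mapping.keys f. Poly_Mapping.lookup f b \<in> J}"

definition tor_cycles :: "nat \<Rightarrow> ('n::finite, 'k::field) mpoly set \<Rightarrow> ('n, 'k) fvec set" where
  "tor_cycles i J = {f \<in> tor_chains i J. case i of 0 \<Rightarrow> True | Suc m \<Rightarrow> bd res_field m f = 0}"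

definition tor_boundaries :: "nat \<Rightarrow> ('n::finite, 'k::field) mpoly set \<Rightarrow> ('n, 'k) fvec set" where
  "tor_boundaries i J = bd res_field i ` tor_chains (Suc i) J"

text \<open>\<open>Tor\<^sub>i(K,J)\<^sub>a \<noteq> 0\<close> for \<open>J\<close> a monomial ideal. Everything lives in multidegrees with
  nonnegative entries, so \<open>a\<close> need not range over all of \<open>\<int>\<^sup>n\<close>.\<close>

definition tor_nonzero_at :: "nat \<Rightarrow> ('n::finite, 'k::field) mpoly set \<Rightarrow> 'n mon \<Rightarrow> bool" where
  "tor_nonzero_at i J a \<longleftrightarrow>
     \<not> tor_cycles i J \<inter> homog res_field i a
         \<subseteq> bd res_field i ` (tor_chains (Suc i) J \<inter> homog res_field (Suc i) a)"

definition HS :: "nat \<Rightarrow> ('n::finite, 'k::field) mpoly set \<Rightarrow> ('n, 'k) mpoly set" where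
  "HS i J = ideal_gen {monom a | a. tor_nonzero_at i J a}"

text \<open>The dimension of \<open>Z/B\<close> for subspaces \<open>B \<subseteq> Z\<close>: the largest size of a subset of \<open>Z\<close>
  that is linearly independent modulo \<open>B\<close>.\<close>

definition quotient_dim :: "('k::field \<Rightarrow> 'v::ab_group_add \<Rightarrow> 'v) \<Rightarrow> 'v set \<Rightarrow> 'v set \<Rightarrow> enat" where
  "quotient_dim scale Z B =
     (SUP C \<in> {C. finite C \<and> C \<subseteq> Z \<and>
                  (\<forall>c. (\<Sum>x\<in>C. scale (c x) x) \<in> B \<longrightarrow> (\<forall>x\<in>C. c x = 0))}. enat (card C))"

definition betti :: "nat \<Rightarrow> ('n::finite, 'k::field) mpoly set \<Rightarrow> enat" where
  "betti j L = quotient_dim (\<lambda>c. smult (const c)) (tor_cycles j L) (tor_boundaries j L)"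


section \<open>Depth\<close>

definition max_ideal :: "('n, 'k::field) mpoly set" where
  "max_ideal = ideal_gen {monom (Poly_Mapping.single i 1) | i. True}"

text \<open>\<open>fs\<close> is a regular sequence on \<open>S/L\<close>.\<close>

definition regular_on_quotient :: "'a::comm_ring_1 set \<Rightarrow> 'a list \<Rightarrow> bool" where
  "regular_on_quotient L fs \<longleftrightarrow>
     (\<forall>i<length fs. \<forall>g. fs ! i * g \<in> ideal_gen (L \<union> set (take i fs)) \<longrightarrow>
                        g \<in> ideal_gen (L \<union> set (take i fs))) \<and>
     ideal_gen (L \<union> set fs) \<noteq> UNIV"

text \<open>\<open>depth S/L\<close> with respect to the graded maximal ideal; the zero module has depth \<open>\<infinity>\<close>.\<close>

definition depth_quotient :: "('n, 'k::field) mpoly set \<Rightarrow> enat" where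
  "depth_quotient L =
     (if L = UNIV then \<infinity>
      else (SUP fs \<in> {fs. set fs \<subseteq> max_ideal \<and> regular_on_quotient L fs}. enat (length fs)))"


section \<open>Minimal generators\<close>

lemma module_mult: "module ((*) :: 'a::comm_ring_1 \<Rightarrow> 'a \<Rightarrow> 'a)"
  by standard (simp_all add: algebra_simps)

lemma monom_in_ideal_gen:
  assumes "(monom u :: ('n, 'k::comm_ring_1) mpoly) \<in> ideal_gen (monom ` A)"
  shows "\<exists>v\<in>A. \<exists>w. u = v + w"
proof -
  have "\<forall>t\<in>Poly_Mapping.keys f. \<exists>v\<in>A. \<exists>w. t = v + w"
    if "f \<in> ideal_gen (monom ` A)" for f :: "('n, 'k) mpoly"
    using that unfolding ideal_gen_def
  proof (induction rule: module.span_induct_alt[OF module_mult, consumes 1, case_names base step])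
    case base
    then show ?case by simp
  next
    case (step c x y)
    from step.hyps obtain v where v: "v \<in> A" "x = monom v" by auto
    show ?case
    proof
      fix t assume "t \<in> Poly_Mapping.keys (c * x + y)"
      then have "t \<in> Poly_Mapping.keys (c * x) \<or> t \<in> Poly_Mapping.keys y" using keys_add by fast
      then show "\<exists>v\<in>A. \<exists>w. t = v + w"
      proof
        assume "t \<in> Poly_Mapping.keys (c * x)"
        then have "t \<in> {a + b | a b. a \<in> Poly_Mapping.keys c \<and> b \<in> Poly_Mapping.keys x}" using keys_mult by fast
        moreover have "Poly_Mapping.keys x \<subseteq> {v}" by (simp add: v monom_def)
        ultimately have "\<exists>w. t = v + w" by (auto simp: add.commute)
        with v show ?thesis by blast
      qed (use step.IH in blast)
    qed
  qed
  from this[OF assms] show ?thesis by (simp add: monom_def)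
qed

lemma monom_add: "monom (u + v) = (monom u * monom v :: ('n, 'k::comm_ring_1) mpoly)"
  by (simp add: monom_def mult_single)

lemma min_gens_least:
  assumes "(J :: ('n, 'k::comm_ring_1) mpoly set) = ideal_gen (monom ` A)"
  shows "min_gens J \<subseteq> A"
proof
  fix u assume u: "u \<in> min_gens J"
  then have "(monom u :: ('n, 'k) mpoly) \<in> ideal_gen (monom ` A)"
    by (simp only: min_gens_def mem_Collect_eq assms[symmetric])
  then obtain v w where vw: "v \<in> A" "u = v + w" using monom_in_ideal_gen by blast
  have "(monom v :: ('n, 'k) mpoly) \<in> ideal_gen (monom ` A)"
    unfolding ideal_gen_def by (rule module.span_base[OF module_mult], rule imageI, rule vw(1))
  then have "(monom v :: ('n, 'k) mpoly) \<in> J" by (simp only: assms)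
  moreover have "\<exists>w. u = v + w" using vw(2) by (rule exI)
  ultimately have "v = u" using u by (simp only: min_gens_def mem_Collect_eq)
  then show "u \<in> A" using vw(1) by simp
qed

lemma ideal_gen_min_gens:
  assumes "monomial_ideal (J :: ('n::finite, 'k::comm_ring_1) mpoly set)"
  shows "ideal_gen (monom ` min_gens J) = J"
proof -
  obtain A where A: "J = ideal_gen (monom ` A)" using assms by (auto simp: monomial_ideal_def)
  have *: "(monom u :: ('n, 'k) mpoly) \<in> ideal_gen (monom ` min_gens J)"
    if "(monom u :: ('n, 'k) mpoly) \<in> J" for u
    using that
  proof (induction "\<Sum>i\<in>UNIV. Poly_Mapping.lookup u i" arbitrary: u rule: less_induct)
    case less
    show ?case
    proof (cases "u \<in> min_gens J")
      case True
      then show ?thesis unfolding ideal_gen_def by (intro module.span_base[OF module_mult]) blast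
    next
      case False
      then obtain v w where vw: "(monom v :: ('n, 'k) mpoly) \<in> J" "u = v + w" "v \<noteq> u"
        using less.prems unfolding min_gens_def by blast
      then have "w \<noteq> 0" by auto
      have "\<exists>i. Poly_Mapping.lookup w i \<noteq> 0"
      proof (rule ccontr)
        assume "\<not> ?thesis"
        then have "w = 0" by (intro poly_mapping_eqI) simp
        with \<open>w \<noteq> 0\<close> show False ..
      qed
      then obtain i where "Poly_Mapping.lookup w i \<noteq> 0" ..
      then have "(\<Sum>i\<in>UNIV. Poly_Mapping.lookup v i) < (\<Sum>i\<in>UNIV. Poly_Mapping.lookup u i)"
        by (intro sum_strict_mono_ex1) (auto simp: vw(2) lookup_add)
      from less.hyps[OF this vw(1)]
      have "monom w * (monom v :: ('n, 'k) mpoly) \<in> ideal_gen (monom ` min_gens J)"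
        unfolding ideal_gen_def by (rule module.span_scale[OF module_mult])
      then show ?thesis by (simp add: vw(2) monom_add mult.commute)
    qed
  qed
  show ?thesis
  proof
    have "monom ` min_gens J \<subseteq> J" by (auto simp: min_gens_def)
    moreover have "module.subspace (*) J" using A module.subspace_span[OF module_mult] by (simp add: ideal_gen_def)
    ultimately show "ideal_gen (monom ` min_gens J) \<subseteq> J"
      unfolding ideal_gen_def by (rule module.span_minimal[OF module_mult])
  next
    have "monom ` A \<subseteq> J"
      by (subst A, unfold ideal_gen_def) (rule module.span_superset[OF module_mult])
    then have "(monom ` A :: ('n, 'k) mpoly set) \<subseteq> ideal_gen (monom ` min_gens J)"
      by (auto intro!: *)
    then have "(ideal_gen (monom ` A) :: ('n, 'k) mpoly set) \<subseteq> ideal_gen (monom ` min_gens J)"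
      unfolding ideal_gen_def
      by (rule module.span_minimal[OF module_mult]) (rule module.subspace_span[OF module_mult])
    then show "J \<subseteq> ideal_gen (monom ` min_gens J)"
      by (simp only: A[symmetric])
  qed
qed

section \<open>Existence of a resolution\<close>

text \<open>The resolution is built together with a \<open>K\<close>-linear contracting homotopy \<open>h\<close>: the basis
  of \<open>F\<^sub>i\<^sub>+\<^sub>1\<close> is indexed by the \<open>K\<close>-basis \<open>t e\<^sub>b\<close> of \<open>F\<^sub>i\<close>, \<open>h\<close> sends \<open>t e\<^sub>b\<close> to the
  corresponding basis vector, and \<open>d (h x) = x - h (d x)\<close> defines the differential.\<close>

lemma lookup_smult [simp]: "Poly_Mapping.lookup (smult s f) b = s * Poly_Mapping.lookup f b"
  by (simp add: smult_def Poly_Mapping.map.rep_eq when_def)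

lemma smult_simps:
  "smult s (f + g) = smult s f + smult s g" "smult (s + t) f = smult s f + smult t f"
  "smult s (smult t f) = smult (s * t) f" "smult 1 f = f" "smult s 0 = 0" "smult 0 f = 0"
  "smult s (f - g) = smult s f - smult s g" "smult s (- f) = - smult s f"
  by (rule poly_mapping_eqI; simp add: lookup_add lookup_minus algebra_simps)+

lemma smult_single: "smult s (Poly_Mapping.single b p) = Poly_Mapping.single b (s * p)"
  by (rule poly_mapping_eqI) (simp add: lookup_single when_def)

lemma module_smult: "module (smult :: 'a::comm_ring_1 \<Rightarrow> _)"
  by standard (simp_all add: smult_simps)

lemma lookup_mult_zero:
  fixes p q :: "('n, 'k::comm_ring_1) mpoly"
  shows "Poly_Mapping.lookup (p * q) 0 = Poly_Mapping.lookup p 0 * Poly_Mapping.lookup q 0"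
proof -
  have z: "(0::'n mon) = a + b \<longleftrightarrow> a = 0 \<and> b = 0" for a b
    by (auto simp: poly_mapping_eq_iff lookup_add fun_eq_iff)
  have inner: "Sum_any (\<lambda>b. Poly_Mapping.lookup q b when 0 = a + b) =
      (Poly_Mapping.lookup q 0 when a = 0)" for a
    by (cases "a = 0") (simp_all add: z)
  have "Poly_Mapping.lookup (p * q) 0 =
      Sum_any (\<lambda>a. Poly_Mapping.lookup p a * (Poly_Mapping.lookup q 0 when a = 0))"
    unfolding lookup_mult inner ..
  also have "\<dots> = Poly_Mapping.lookup p 0 * Poly_Mapping.lookup q 0"
    by (simp add: mult_when)
  finally show ?thesis .
qed

lemma additive_sum_keys:
  fixes \<phi> :: "'b \<Rightarrow> 'a::ab_group_add \<Rightarrow> 'c::ab_group_add"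
  assumes "\<And>b x y. \<phi> b (x + y) = \<phi> b x + \<phi> b y"
  shows "(\<Sum>b\<in>Poly_Mapping.keys (f + g). \<phi> b (Poly_Mapping.lookup (f + g) b)) =
         (\<Sum>b\<in>Poly_Mapping.keys f. \<phi> b (Poly_Mapping.lookup f b)) +
         (\<Sum>b\<in>Poly_Mapping.keys g. \<phi> b (Poly_Mapping.lookup g b))"
proof -
  have z: "\<phi> b 0 = 0" for b using assms[of b 0 0] by simp
  let ?U = "Poly_Mapping.keys f \<union> Poly_Mapping.keys g"
  have ext: "(\<Sum>b\<in>Poly_Mapping.keys h. \<phi> b (Poly_Mapping.lookup h b)) =
      (\<Sum>b\<in>?U. \<phi> b (Poly_Mapping.lookup h b))" if "Poly_Mapping.keys h \<subseteq> ?U" for h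
    by (rule sum.mono_neutral_left) (use that in \<open>auto simp: z in_keys_iff\<close>)
  show ?thesis
    using ext[of f] ext[of g] ext[of "f + g"] keys_add[of f g]
    by (simp add: lookup_add assms sum.distrib)
qed

definition lin_ext :: "(nat \<Rightarrow> ('n, 'k::field) fvec) \<Rightarrow> ('n, 'k) fvec \<Rightarrow> ('n, 'k) fvec" where
  "lin_ext D f = (\<Sum>b\<in>Poly_Mapping.keys f. smult (Poly_Mapping.lookup f b) (D b))"

lemma lin_ext_add: "lin_ext D (f + g) = lin_ext D f + lin_ext D g"
  unfolding lin_ext_def by (rule additive_sum_keys) (rule smult_simps)

lemma lin_ext_single: "lin_ext D (Poly_Mapping.single b p) = smult p (D b)"
  by (simp add: lin_ext_def smult_simps)

definition mon_code :: "'n::finite mon \<Rightarrow> nat \<Rightarrow> nat" where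
  "mon_code t b = to_nat (Poly_Mapping.lookup t, b)"

definition mon_decode :: "nat \<Rightarrow> 'n::finite mon \<times> nat" where
  "mon_decode c = (SOME x. mon_code (fst x) (snd x) = c)"

lemma mon_code_inject: "mon_code t b = mon_code t' b' \<longleftrightarrow> t = t' \<and> b = b'"
proof
  assume "mon_code t b = mon_code t' b'"
  then have "(Poly_Mapping.lookup t, b) = (Poly_Mapping.lookup t', b')"
    unfolding mon_code_def by (rule injD[OF inj_to_nat])
  then show "t = t' \<and> b = b'" unfolding poly_mapping_eq_iff by (rule Pair_inject) (rule conjI)
qed simp

lemma mon_decode_code [simp]: "mon_decode (mon_code t b) = (t, b)"
  unfolding mon_decode_def mon_code_inject by (rule some_equality) (simp_all add: prod_eq_iff)

definition coeff_ext :: "nat \<Rightarrow> ('n::finite, 'k::field) mpoly \<Rightarrow> ('n, 'k) fvec" where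
  "coeff_ext b p = (\<Sum>t\<in>Poly_Mapping.keys p.
     Poly_Mapping.single (mon_code t b) (const (Poly_Mapping.lookup p t)))"

definition htpy :: "('n::finite, 'k::field) fvec \<Rightarrow> ('n, 'k) fvec" where
  "htpy f = (\<Sum>b\<in>Poly_Mapping.keys f. coeff_ext b (Poly_Mapping.lookup f b))"

lemma coeff_ext_add: "coeff_ext b (p + q) = coeff_ext b p + coeff_ext b q"
  unfolding coeff_ext_def by (rule additive_sum_keys) (simp add: const_def single_add)

lemma htpy_add: "htpy (f + g) = htpy f + htpy g"
  unfolding htpy_def by (rule additive_sum_keys) (rule coeff_ext_add)

lemma htpy_zero [simp]: "htpy 0 = 0"
  by (simp add: htpy_def)

definition trm :: "nat \<Rightarrow> 'n mon \<Rightarrow> 'k \<Rightarrow> ('n, 'k::field) fvec" where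
  "trm b t c = Poly_Mapping.single b (Poly_Mapping.single t c)"

lemma htpy_trm: "htpy (trm b t c) = Poly_Mapping.single (mon_code t b) (const c)"
proof (cases "c = 0")
  case False
  have "Poly_Mapping.single t c \<noteq> 0"
  proof
    assume "Poly_Mapping.single t c = 0"
    then have "Poly_Mapping.lookup (Poly_Mapping.single t c) t = 0" by simp
    with False show False by simp
  qed
  with False show ?thesis by (simp add: htpy_def trm_def coeff_ext_def)
qed (simp add: trm_def const_def)

lemma const_mult: "const c * const d = const (c * d)"
  by (simp add: const_def mult_single)

lemma smult_const_trm: "smult (const c) (trm b t d) = trm b t (c * d)"
  by (simp add: trm_def smult_single const_def mult_single)

lemma mpoly_expand:
  fixes p :: "'b \<Rightarrow>\<^sub>0 'a::comm_monoid_add"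
  shows "p = (\<Sum>t\<in>Poly_Mapping.keys p. Poly_Mapping.single t (Poly_Mapping.lookup p t))"
proof (rule poly_mapping_eqI)
  fix k
  have "Poly_Mapping.lookup
        (\<Sum>t\<in>Poly_Mapping.keys p. Poly_Mapping.single t (Poly_Mapping.lookup p t)) k =
      (\<Sum>t\<in>Poly_Mapping.keys p. if t = k then Poly_Mapping.lookup p t else 0)"
    by (simp only: lookup_sum lookup_single when_def)
  also have "\<dots> = Poly_Mapping.lookup p k"
    by (simp only: sum.delta finite_keys in_keys_iff split: if_split) simp
  finally show "Poly_Mapping.lookup p k = Poly_Mapping.lookup
        (\<Sum>t\<in>Poly_Mapping.keys p. Poly_Mapping.single t (Poly_Mapping.lookup p t)) k"
    by (rule sym)
qed

lemma fvec_expand: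
  fixes f :: "('n, 'k::field) fvec"
  shows "f = (\<Sum>b\<in>Poly_Mapping.keys f. \<Sum>t\<in>Poly_Mapping.keys (Poly_Mapping.lookup f b).
          trm b t (Poly_Mapping.lookup (Poly_Mapping.lookup f b) t))"
proof -
  have s: "Poly_Mapping.single b (sum g A) = (\<Sum>t\<in>A. Poly_Mapping.single b (g t))"
    for b :: nat and g :: "'n mon \<Rightarrow> ('n, 'k) mpoly" and A
    by (induction A rule: infinite_finite_induct) (simp_all add: single_add)
  have "f = (\<Sum>b\<in>Poly_Mapping.keys f. Poly_Mapping.single b (Poly_Mapping.lookup f b))"
    by (rule mpoly_expand)
  also have "\<dots> = (\<Sum>b\<in>Poly_Mapping.keys f. \<Sum>t\<in>Poly_Mapping.keys (Poly_Mapping.lookup f b).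
          trm b t (Poly_Mapping.lookup (Poly_Mapping.lookup f b) t))"
  proof (rule sum.cong)
    fix b assume "b \<in> Poly_Mapping.keys f"
    show "Poly_Mapping.single b (Poly_Mapping.lookup f b) =
        (\<Sum>t\<in>Poly_Mapping.keys (Poly_Mapping.lookup f b).
          trm b t (Poly_Mapping.lookup (Poly_Mapping.lookup f b) t))"
      unfolding trm_def s[symmetric]
      by (rule arg_cong[OF mpoly_expand[of "Poly_Mapping.lookup f b"]])
  qed simp
  finally show ?thesis .
qed

lemma sum_closed:
  assumes "Q 0" "\<And>x y. Q x \<Longrightarrow> Q y \<Longrightarrow> Q (x + y)" "\<And>a. a \<in> A \<Longrightarrow> Q (g a)"
  shows "Q (sum g A)"
  using assms(3) by (induction A rule: infinite_finite_induct) (auto intro: assms(1,2))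

lemma fvec_induct:
  fixes f :: "('n, 'k::field) fvec"
  assumes "Q 0" "\<And>x y. Q x \<Longrightarrow> Q y \<Longrightarrow> Q (x + y)"
    and "\<And>b t c. b \<in> Poly_Mapping.keys f \<Longrightarrow> t \<in> Poly_Mapping.keys (Poly_Mapping.lookup f b)
      \<Longrightarrow> Q (trm b t c)"
  shows "Q f"
proof -
  have "Q (\<Sum>b\<in>Poly_Mapping.keys f. \<Sum>t\<in>Poly_Mapping.keys (Poly_Mapping.lookup f b).
          trm b t (Poly_Mapping.lookup (Poly_Mapping.lookup f b) t))"
  proof (rule sum_closed[where Q = Q])
    show "Q 0" by (rule assms(1))
    show "Q (x + y)" if "Q x" "Q y" for x y using that by (rule assms(2))
    fix b assume b: "b \<in> Poly_Mapping.keys f"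
    show "Q (\<Sum>t\<in>Poly_Mapping.keys (Poly_Mapping.lookup f b).
          trm b t (Poly_Mapping.lookup (Poly_Mapping.lookup f b) t))"
    proof (rule sum_closed[where Q = Q])
      show "Q 0" by (rule assms(1))
      show "Q (x + y)" if "Q x" "Q y" for x y using that by (rule assms(2))
    qed (rule assms(3)[OF b])
  qed
  then show ?thesis by (simp only: fvec_expand[symmetric])
qed

lemma htpy_smult: "htpy (smult (const c) f) = smult (const c) (htpy f)"
  by (induction f rule: fvec_induct)
     (simp_all add: smult_simps htpy_add smult_const_trm htpy_trm smult_single const_mult)

primrec res_gens :: "'n::finite itself \<Rightarrow> nat \<Rightarrow> nat set" where
  "res_gens T 0 = {0}"
| "res_gens T (Suc i) = (\<lambda>(t :: 'n mon, b). mon_code t b) ` (UNIV \<times> res_gens T i)"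

primrec res_deg :: "nat \<Rightarrow> nat \<Rightarrow> 'n::finite mon" where
  "res_deg 0 c = 0"
| "res_deg (Suc i) c = (case mon_decode c of (t, b) \<Rightarrow> t + res_deg i b)"

definition res_aug :: "('n, 'k::field) fvec \<Rightarrow> 'k" where
  "res_aug f = Poly_Mapping.lookup (Poly_Mapping.lookup f 0) 0"

primrec res_bd_basis :: "nat \<Rightarrow> nat \<Rightarrow> ('n::finite, 'k::field) fvec" where
  "res_bd_basis 0 c = (case mon_decode c of (t, b) \<Rightarrow> trm b t 1 - trm 0 0 (res_aug (trm b t 1)))"
| "res_bd_basis (Suc i) c = (case mon_decode c of (t, b) \<Rightarrow>
     trm b t 1 - htpy (lin_ext (res_bd_basis i) (trm b t 1)))"

definition res_bd :: "nat \<Rightarrow> ('n::finite, 'k::field) fvec \<Rightarrow> ('n, 'k) fvec" where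
  "res_bd i = lin_ext (res_bd_basis i)"

definition contracted_res :: "('n::finite, 'k::field) free_complex" where
  "contracted_res = \<lparr>gens = res_gens TYPE('n), gdeg = res_deg, bd = res_bd, aug = res_aug\<rparr>"

lemma contracted_res_simps [simp]:
  "gens (contracted_res :: ('n::finite, 'k::field) free_complex) = res_gens TYPE('n)"
  "gdeg (contracted_res :: ('n::finite, 'k::field) free_complex) = res_deg"
  "bd (contracted_res :: ('n::finite, 'k::field) free_complex) = res_bd"
  "aug (contracted_res :: ('n::finite, 'k::field) free_complex) = res_aug"
  by (simp_all add: contracted_res_def)

lemma res_bd_add: "res_bd i (f + g) = res_bd i f + res_bd i g"
  by (simp add: res_bd_def lin_ext_add)

lemma res_bd_zero [simp]: "res_bd i 0 = 0"
  using res_bd_add[of i 0 0] by simp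

lemma res_bd_diff: "res_bd i (f - g) = res_bd i f - res_bd i g"
  using res_bd_add[of i "f - g" g] by (simp add: algebra_simps)

lemma htpy_diff: "htpy (f - g) = htpy f - htpy g"
  using htpy_add[of "f - g" g] by (simp add: algebra_simps)

lemma res_bd_smult: "res_bd i (smult s f) = smult s (res_bd i f)"
proof (induction f rule: fvec_induct)
  case (3 b t c)
  then show ?case
    by (simp add: res_bd_def trm_def smult_single lin_ext_single smult_simps)
qed (simp_all add: smult_simps res_bd_add)

lemma res_bd_trm: "res_bd i (trm b t c) = smult (Poly_Mapping.single t c) (res_bd_basis i b)"
  by (simp add: res_bd_def trm_def lin_ext_single)

lemma res_bd_basis_Suc:
  "res_bd_basis (Suc i) (mon_code t b) = trm b t 1 - htpy (res_bd i (trm b t 1))"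
  by (simp add: res_bd_def)

lemma res_aug_add: "res_aug (f + g) = res_aug f + res_aug g"
  by (simp add: res_aug_def lookup_add)

lemma trm_scale: "trm b t c = smult (const c) (trm b t 1)"
  by (simp add: smult_const_trm)

lemma trm_split: "trm b t c = smult (Poly_Mapping.single t c) (Poly_Mapping.single b 1)"
  by (simp add: trm_def smult_single)

lemma trm_add: "trm b t (c + d) = trm b t c + trm b t d"
  by (simp add: trm_def single_add)

lemma res_htpy0: "res_bd 0 (htpy f) = f - trm 0 0 (res_aug f)"
proof (induction f rule: fvec_induct)
  case 1
  show ?case by (simp add: res_aug_def trm_def)
next
  case (2 x y)
  then show ?case by (simp add: htpy_add res_bd_add res_aug_add trm_add)
next
  case (3 b t c)
  have "res_aug (trm b t c) = c * res_aug (trm b t 1)"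
    by (simp add: res_aug_def trm_def lookup_single when_def)
  then show ?case
    by (simp add: htpy_trm res_bd_def lin_ext_single smult_simps smult_const_trm)
qed

lemma res_htpy_Suc: "res_bd (Suc i) (htpy f) = f - htpy (res_bd i f)"
proof (induction f rule: fvec_induct)
  case (2 x y)
  then show ?case by (simp add: htpy_add res_bd_add)
next
  case (3 b t c)
  have "res_bd (Suc i) (htpy (trm b t c)) = smult (const c) (res_bd_basis (Suc i) (mon_code t b))"
    by (simp only: htpy_trm res_bd_def lin_ext_single)
  also have "\<dots> = trm b t c - htpy (res_bd i (trm b t c))"
    unfolding res_bd_basis_Suc smult_simps(7) htpy_smult[symmetric] res_bd_smult[symmetric]
    by (simp add: smult_const_trm)
  finally show ?case .
qed simp

lemma free_mod_add: "f \<in> free_mod P i \<Longrightarrow> g \<in> free_mod P i \<Longrightarrow> f + g \<in> free_mod P i"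
  using keys_add[of f g] by (auto simp: free_mod_def)

lemma lookup_expand_mem: "f \<in> homog P i a \<longleftrightarrow>
  (\<forall>b t. Poly_Mapping.lookup (Poly_Mapping.lookup f b) t \<noteq> 0 \<longrightarrow> t + gdeg P i b = a)"
proof
  assume f: "f \<in> homog P i a"
  show "\<forall>b t. Poly_Mapping.lookup (Poly_Mapping.lookup f b) t \<noteq> 0 \<longrightarrow> t + gdeg P i b = a"
  proof (intro allI impI)
    fix b t assume nz: "Poly_Mapping.lookup (Poly_Mapping.lookup f b) t \<noteq> 0"
    then have "b \<in> Poly_Mapping.keys f" by (auto simp: in_keys_iff)
    with nz f show "t + gdeg P i b = a" by (simp add: homog_def in_keys_iff)
  qed
qed (simp add: homog_def in_keys_iff)

lemma free_mod_iff: "f \<in> free_mod P i \<longleftrightarrow>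
  (\<forall>b. Poly_Mapping.lookup f b \<noteq> 0 \<longrightarrow> b \<in> gens P i)"
  by (auto simp: free_mod_def in_keys_iff)

lemma homog_add: "f \<in> homog P i a \<Longrightarrow> g \<in> homog P i a \<Longrightarrow> f + g \<in> homog P i a"
  unfolding lookup_expand_mem lookup_add
proof (intro allI impI)
  fix b t
  assume f: "\<forall>b t. Poly_Mapping.lookup (Poly_Mapping.lookup f b) t \<noteq> 0 \<longrightarrow> t + gdeg P i b = a"
    and g: "\<forall>b t. Poly_Mapping.lookup (Poly_Mapping.lookup g b) t \<noteq> 0 \<longrightarrow> t + gdeg P i b = a"
    and "Poly_Mapping.lookup (Poly_Mapping.lookup f b) t + Poly_Mapping.lookup (Poly_Mapping.lookup g b) t \<noteq> 0"
  then have "Poly_Mapping.lookup (Poly_Mapping.lookup f b) t \<noteq> 0 \<or>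
      Poly_Mapping.lookup (Poly_Mapping.lookup g b) t \<noteq> 0" by auto
  with f g show "t + gdeg P i b = a" by blast
qed

definition strand :: "('n::finite, 'k::field) free_complex \<Rightarrow> nat \<Rightarrow> 'n mon \<Rightarrow> ('n, 'k) fvec set" where
  "strand P i a = free_mod P i \<inter> homog P i a"

lemma strand_add: "f \<in> strand P i a \<Longrightarrow> g \<in> strand P i a \<Longrightarrow> f + g \<in> strand P i a"
  by (simp add: strand_def free_mod_add homog_add)

lemma strand_zero [simp]: "0 \<in> strand P i a"
  by (simp add: strand_def free_mod_iff lookup_expand_mem)

lemma strand_uminus: "f \<in> strand P i a \<Longrightarrow> - f \<in> strand P i a"
  by (simp add: strand_def free_mod_iff lookup_expand_mem)

lemma strand_diff: "f \<in> strand P i a \<Longrightarrow> g \<in> strand P i a \<Longrightarrow> f - g \<in> strand P i a"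
  using strand_add[of f P i a "- g"] strand_uminus[of g P i a] by simp

lemma strand_trm: "b \<in> gens P i \<Longrightarrow> trm b t c \<in> strand P i (t + gdeg P i b)"
  by (auto simp: strand_def free_mod_iff lookup_expand_mem trm_def lookup_single when_def
      split: if_splits)

lemma strand_smult:
  assumes "f \<in> strand P i a"
  shows "smult (Poly_Mapping.single t c) f \<in> strand P i (t + a)"
proof (cases "f = 0")
  case False
  have "smult (Poly_Mapping.single t c) f \<in> free_mod P i"
    unfolding free_mod_iff
  proof (intro allI impI)
    fix b assume "Poly_Mapping.lookup (smult (Poly_Mapping.single t c) f) b \<noteq> 0"
    then have "Poly_Mapping.lookup f b \<noteq> 0" by auto
    with assms show "b \<in> gens P i" by (simp add: strand_def free_mod_iff)
  qed
  moreover have "smult (Poly_Mapping.single t c) f \<in> homog P i (t + a)"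
    unfolding lookup_expand_mem
  proof (intro allI impI)
    fix b s assume "Poly_Mapping.lookup (Poly_Mapping.lookup (smult (Poly_Mapping.single t c) f) b) s \<noteq> 0"
    then have "s \<in> Poly_Mapping.keys (Poly_Mapping.single t c * Poly_Mapping.lookup f b)"
      by (simp add: in_keys_iff)
    then have "s \<in> {x + y | x y. x \<in> Poly_Mapping.keys (Poly_Mapping.single t c) \<and>
        y \<in> Poly_Mapping.keys (Poly_Mapping.lookup f b)}" using keys_mult by fast
    then obtain y where y: "s = t + y" "y \<in> Poly_Mapping.keys (Poly_Mapping.lookup f b)"
      by (auto split: if_splits)
    then show "s + gdeg P i b = t + a"
      using assms by (auto simp: strand_def lookup_expand_mem in_keys_iff add.assoc)
  qed
  ultimately show ?thesis by (simp add: strand_def)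
qed (simp add: smult_simps)

text \<open>A \<open>K\<close>-subspace containing the terms of degree \<open>a\<close> contains \<open>strand P i a\<close>.\<close>

lemma strand_induct [consumes 1, case_names zero add trm]:
  assumes "f \<in> strand P i a" "Q 0" "\<And>x y. Q x \<Longrightarrow> Q y \<Longrightarrow> Q (x + y)"
    and "\<And>b t c. b \<in> gens P i \<Longrightarrow> t + gdeg P i b = a \<Longrightarrow> Q (trm b t c)"
  shows "Q f"
proof (rule fvec_induct[of Q])
  fix b t c
  assume "b \<in> Poly_Mapping.keys f" "t \<in> Poly_Mapping.keys (Poly_Mapping.lookup f b)"
  with assms(1) show "Q (trm b t c)"
    by (intro assms(4)) (auto simp: strand_def free_mod_def homog_def)
qed (use assms in auto)

lemma free_mod_induct [consumes 1, case_names zero add trm]: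
  assumes "f \<in> free_mod P i" "Q 0" "\<And>x y. Q x \<Longrightarrow> Q y \<Longrightarrow> Q (x + y)"
    and "\<And>b t c. b \<in> gens P i \<Longrightarrow> Q (trm b t c)"
  shows "Q f"
proof (rule fvec_induct[of Q])
  fix b t c
  assume "b \<in> Poly_Mapping.keys f"
  with assms(1) show "Q (trm b t c)" by (intro assms(4)) (auto simp: free_mod_def)
qed (use assms in auto)

lemma res_gens_SucE:
  fixes T :: "'n::finite itself"
  assumes "b \<in> res_gens T (Suc i)"
  obtains s :: "'n mon" and d where "b = mon_code s d" "d \<in> res_gens T i"
  using assms by auto

lemma htpy_strand:
  fixes f :: "('n::finite, 'k::field) fvec"
  assumes "f \<in> strand contracted_res i a"
  shows "htpy f \<in> strand contracted_res (Suc i) a"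
  using assms
proof (induction rule: strand_induct)
  case (trm b t c)
  then have "mon_code t b \<in> gens (contracted_res :: ('n, 'k) free_complex) (Suc i)"
    by force
  from strand_trm[OF this, of 0 c]
  have "trm (mon_code t b) 0 c \<in> strand contracted_res (Suc i) a" using trm by simp
  then show ?case unfolding htpy_trm const_def trm_def[of "mon_code t b"] .
qed (auto simp: htpy_add strand_add)

lemma res_bd_strand:
  fixes f :: "('n::finite, 'k::field) fvec"
  assumes "f \<in> strand contracted_res (Suc i) a"
  shows "res_bd i f \<in> strand contracted_res i a"
  using assms
proof (induction i arbitrary: f a)
  case 0
  from 0 show ?case
  proof (induction rule: strand_induct)
    case (trm b t c)
    then obtain s :: "'n mon" where s: "b = mon_code s 0" by (auto elim: res_gens_SucE)
    have a: "a = t + s" using trm by (simp add: s)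
    have "trm 0 s (1::'k) - trm 0 0 (res_aug (trm 0 s 1)) \<in> strand contracted_res 0 s"
    proof (cases "s = 0")
      case True
      then show ?thesis by (simp add: res_aug_def trm_def)
    next
      case False
      have "trm 0 s (1::'k) \<in> strand contracted_res 0 s"
        using strand_trm[of 0 contracted_res 0 s 1] by simp
      with False show ?thesis by (simp add: res_aug_def trm_def lookup_single)
    qed
    then show ?case by (simp add: res_bd_trm s a strand_smult)
  qed (auto simp: res_bd_add strand_add)
next
  case (Suc i)
  note IH = Suc.IH
  from Suc.prems show ?case
  proof (induction rule: strand_induct)
    case (trm b t c)
    then obtain s :: "'n mon" and d where s: "b = mon_code s d" "d \<in> gens (contracted_res :: ('n, 'k) free_complex) (Suc i)"
      by (auto simp del: res_gens.simps elim: res_gens_SucE)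
    let ?e = "s + res_deg (Suc i) d"
    have a: "a = t + ?e" using trm by (simp add: s)
    have "trm d s (1::'k) \<in> strand contracted_res (Suc i) ?e"
      using strand_trm[OF s(2), of s "1::'k"] by (simp del: res_deg.simps)
    then have "res_bd_basis (Suc i) b \<in> strand (contracted_res :: ('n, 'k) free_complex) (Suc i) ?e"
      unfolding s res_bd_basis_Suc by (intro strand_diff htpy_strand IH)
    then show ?case unfolding res_bd_trm a by (rule strand_smult)
  qed (auto simp: res_bd_add strand_add)
qed

lemma strand_free_mod: "f \<in> strand P i a \<Longrightarrow> f \<in> free_mod P i"
  by (simp add: strand_def)

lemma res_bd_free_mod:
  fixes f :: "('n::finite, 'k::field) fvec"
  assumes "f \<in> free_mod contracted_res (Suc i)"
  shows "res_bd i f \<in> free_mod contracted_res i"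
  using assms
proof (induction rule: free_mod_induct)
  case (trm b t c)
  note * = res_bd_strand[OF strand_trm[OF trm, of t c]]
  show ?case by (rule strand_free_mod[OF *])
next
  case zero
  show ?case by (simp add: free_mod_def)
next
  case (add x y)
  from free_mod_add[OF add] show ?case by (simp only: res_bd_add)
qed

lemma htpy_free_mod:
  fixes f :: "('n::finite, 'k::field) fvec"
  assumes "f \<in> free_mod contracted_res i"
  shows "htpy f \<in> free_mod contracted_res (Suc i)"
  using assms
proof (induction rule: free_mod_induct)
  case (trm b t c)
  note * = htpy_strand[OF strand_trm[OF trm, of t c]]
  show ?case by (rule strand_free_mod[OF *])
next
  case zero
  show ?case by (simp add: free_mod_def)
next
  case (add x y)
  from free_mod_add[OF add] show ?case by (simp only: htpy_add)
qed

lemma res_aug_bd: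
  fixes f :: "('n::finite, 'k::field) fvec"
  assumes "f \<in> free_mod contracted_res (Suc 0)"
  shows "res_aug (res_bd 0 f) = 0"
  using assms
proof (induction rule: free_mod_induct)
  case (trm b t c)
  then have "b \<in> res_gens TYPE('n) (Suc 0)" by (simp only: contracted_res_simps)
  then obtain s :: "'n mon" and d where s': "b = mon_code s d" "d \<in> res_gens TYPE('n) 0"
    by (rule res_gens_SucE)
  then have s: "b = mon_code s 0" by simp
  have "Poly_Mapping.lookup (Poly_Mapping.lookup (res_bd_basis 0 b :: ('n, 'k) fvec) 0) 0 = 0"
    by (simp add: s res_aug_def trm_def lookup_minus)
  moreover have "Poly_Mapping.lookup (p * q) 0 = Poly_Mapping.lookup p 0 * Poly_Mapping.lookup q 0"
    for p q :: "('n, 'k) mpoly" by (rule lookup_mult_zero)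
  ultimately show ?case by (simp add: res_bd_trm res_aug_def)
qed (simp_all add: res_bd_add res_aug_add, simp add: res_aug_def)

lemma res_bd_bd:
  fixes f :: "('n::finite, 'k::field) fvec"
  assumes "f \<in> free_mod contracted_res (Suc (Suc i))"
  shows "res_bd i (res_bd (Suc i) f) = 0"
  using assms
proof (induction i arbitrary: f)
  case 0
  from 0 show ?case
  proof (induction rule: free_mod_induct)
    case (trm b t c)
    then have "b \<in> res_gens TYPE('n) (Suc (Suc 0))" by (simp only: contracted_res_simps)
    then obtain s :: "'n mon" and d where s: "b = mon_code s d" "d \<in> res_gens TYPE('n) (Suc 0)"
      by (rule res_gens_SucE)
    from s(2) have d: "d \<in> gens (contracted_res :: ('n, 'k) free_complex) (Suc 0)"
      by (simp only: contracted_res_simps)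
    have "trm d s (1::'k) \<in> free_mod contracted_res (Suc 0)"
      by (rule strand_free_mod[OF strand_trm[OF d]])
    from res_aug_bd[OF this] show ?case
      unfolding res_bd_trm res_bd_smult s res_bd_basis_Suc res_bd_diff res_htpy0
      by (simp add: trm_def smult_simps)
  qed (simp_all add: res_bd_add)
next
  case (Suc i)
  note IH = Suc.IH
  from Suc.prems show ?case
  proof (induction rule: free_mod_induct)
    case (trm b t c)
    then have "b \<in> res_gens TYPE('n) (Suc (Suc (Suc i)))" by (simp only: contracted_res_simps)
    then obtain s :: "'n mon" and d where s: "b = mon_code s d" "d \<in> res_gens TYPE('n) (Suc (Suc i))"
      by (rule res_gens_SucE)
    from s(2) have d: "d \<in> gens (contracted_res :: ('n, 'k) free_complex) (Suc (Suc i))"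
      by (simp only: contracted_res_simps)
    have "trm d s (1::'k) \<in> free_mod contracted_res (Suc (Suc i))"
      by (rule strand_free_mod[OF strand_trm[OF d]])
    from IH[OF this] show ?case
      unfolding res_bd_trm[of "Suc (Suc i)"] res_bd_smult s res_bd_basis_Suc res_bd_diff res_htpy_Suc
      by (simp add: smult_simps)
  qed (simp_all add: res_bd_add)
qed

lemma resolution_exists: "\<exists>P :: ('n::finite, 'k::field) free_complex. is_resolution_of_field P"
proof
  let ?P = "contracted_res :: ('n, 'k) free_complex"
  show "is_resolution_of_field ?P"
    unfolding is_resolution_of_field_def
  proof (intro conjI allI impI ballI)
    fix i
    show "module_hom smult smult (bd ?P i)"
      by (intro module_hom.intro module_smult module_hom_axioms.intro)
         (simp_all add: res_bd_add res_bd_smult)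
    show "bd ?P i ` free_mod ?P (Suc i) \<subseteq> free_mod ?P i"
      using res_bd_free_mod by auto
    show "bd ?P i ` (free_mod ?P (Suc i) \<inter> homog ?P (Suc i) a) \<subseteq> homog ?P i a" for a
      using res_bd_strand by (auto simp: strand_def)
  next
    have "module (\<lambda>(s :: ('n, 'k) mpoly) c. Poly_Mapping.lookup s 0 * c)"
      by standard (simp_all add: algebra_simps lookup_add lookup_mult_zero)
    then show "module_hom smult (\<lambda>s c. Poly_Mapping.lookup s 0 * c) (aug ?P)"
      by (intro module_hom.intro module_smult module_hom_axioms.intro)
         (simp_all add: res_aug_def lookup_add lookup_mult_zero)
  next
    fix a :: "'n mon" and f assume "a \<noteq> 0" "f \<in> free_mod ?P 0 \<inter> homog ?P 0 a"
    then show "aug ?P f = 0" by (force simp: lookup_expand_mem res_aug_def)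
  next
    have "c \<in> aug ?P ` free_mod ?P 0" for c
    proof
      show "c = aug ?P (trm 0 0 c)" by (simp add: res_aug_def trm_def)
      show "trm 0 0 c \<in> free_mod ?P 0" using strand_trm[of 0 ?P 0] by (simp add: strand_def)
    qed
    then show "aug ?P ` free_mod ?P 0 = UNIV" by blast
  next
    have "f \<in> bd ?P 0 ` free_mod ?P (Suc 0)" if "f \<in> free_mod ?P 0" "aug ?P f = 0" for f
    proof
      show "f = bd ?P 0 (htpy f)" using that by (simp add: res_htpy0 trm_def)
    qed (use that htpy_free_mod in blast)
    then show "bd ?P 0 ` free_mod ?P (Suc 0) = {f \<in> free_mod ?P 0. aug ?P f = 0}"
      using res_bd_free_mod res_aug_bd by auto
  next
    fix i
    have "f \<in> bd ?P (Suc i) ` free_mod ?P (Suc (Suc i))"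
      if "f \<in> free_mod ?P (Suc i)" "bd ?P i f = 0" for f
    proof
      show "f = bd ?P (Suc i) (htpy f)" using that by (simp add: res_htpy_Suc)
    qed (use that htpy_free_mod in blast)
    then show "bd ?P (Suc i) ` free_mod ?P (Suc (Suc i)) = {f \<in> free_mod ?P (Suc i). bd ?P i f = 0}"
      using res_bd_free_mod res_bd_bd by auto
  qed
qed

lemma is_resolution_res_field:
  "is_resolution_of_field (res_field :: ('n::finite, 'k::field) free_complex)"
  unfolding res_field_def by (rule someI_ex) (rule resolution_exists)

end

theory Submission
  imports Defs "HOL-Library.Infinite_Set"
begin

text \<open>Let \<open>B\<close> be the set of exponents of the generators of \<open>I\<^sup>k\<close>, an M-convex set with rank
  function \<open>\<rho>\<close> and degree \<open>d\<close>. By linear quotients with respect to the lexicographic order,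
  \<open>HS\<^sub>i\<close> is generated by the monomials \<open>x\<^sup>u x\<^sub>F\<close> with \<open>u \<in> B\<close>, \<open>|F| = i\<close> and \<open>F\<close> contained in
  the set \<open>set(u)\<close> of variables generating the colon ideal at \<open>u\<close>. Their exponents are the integer
  points \<open>a\<close> with \<open>a(V) = d + i\<close> and \<open>a(S) \<le> \<rho>(S) + min i (|S| - 1)\<close> for \<open>S \<noteq> {}\<close>. The
  right-hand side is submodular on intersecting pairs, so these points form an M-convex set again and
  \<open>HS\<^sub>i\<close> has a linear resolution.

  Multiplication by a generator \<open>w\<close> of \<open>I\<close> maps the generators of \<open>HS\<^sub>i(I\<^sup>k)\<close> to generators of
  \<open>HS\<^sub>i(I\<^sup>k\<^sup>+\<^sup>1)\<close>. It is injective on Tor: in the lowest degree, where the Tor of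
  \<open>HS\<^sub>i(I\<^sup>k)\<close> is concentrated, the Koszul complex with coefficients in
  \<open>HS\<^sub>i(I\<^sup>k\<^sup>+\<^sup>1)\<close> has no boundaries. For the depth, the highest nonvanishing Koszul homology of \<open>S/L\<close> is compared with the length of regular
  sequences.\<close>

text \<open>\<open>betti\<close> and \<open>HS\<close> refer to \<open>res_field\<close>, an
  arbitrary resolution about which only exactness is known. Degree counts are therefore made in the
  Koszul complex, whose basis elements of homological degree \<open>j\<close> have total degree
  \<open>j\<close>; graded chain maps and homotopies carry the results back, and being
  \<open>S\<close>-linear they respect coefficients in an ideal. The condition that \<open>F\<close>
  lies in \<open>set(u)\<close> depends on the order of the variables and shows no exchange
  property. The inequalities do not mention the order, and M-convexity is derived from them. The
  \<open>- 1\<close> in the bound reflects that the last variable of \<open>S\<close> can only gain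
  a unit from outside \<open>S\<close>. By Auslander-Buchsbaum the depth statement would follow from
  the Betti numbers. Here depth is a supremum over regular sequences, so regular elements have to be
  produced: the top Koszul homology is the socle, and where it vanishes, prime avoidance over the
  maximal annihilators gives a nonzerodivisor. Their finiteness rests on the ascending chain
  condition, obtained from Dickson's lemma through leading monomials.\<close>

abbreviation "lookup \<equiv> Poly_Mapping.lookup"
abbreviation "single \<equiv> Poly_Mapping.single"
abbreviation "keys \<equiv> Poly_Mapping.keys"

section \<open>M-convex sets\<close>

definition move :: "'n \<Rightarrow> 'n \<Rightarrow> ('n \<Rightarrow> int) \<Rightarrow> 'n \<Rightarrow> int" where
  "move i j b = (\<lambda>k. b k + of_bool (k = j) - of_bool (k = i))"

text \<open>The exchange of \<open>polymatroidal\<close>, on integer vectors: later the indicator of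
  a set is subtracted from an exponent vector, and this must not be truncated.\<close>

definition mconvex :: "('n \<Rightarrow> int) set \<Rightarrow> bool" where
  "mconvex B \<longleftrightarrow> (\<forall>u\<in>B. \<forall>v\<in>B. \<forall>i. v i < u i \<longrightarrow> (\<exists>j. u j < v j \<and> move i j u \<in> B))"

lemma mconvexD:
  assumes "mconvex B" "u \<in> B" "v \<in> B" "v i < u i"
  obtains j where "u j < v j" "move i j u \<in> B"
  using assms unfolding mconvex_def by blast

lemma sum_of_bool_eq [simp]:
  "finite S \<Longrightarrow> (\<Sum>k\<in>S. of_bool (k = j) :: int) = of_bool (j \<in> S)"
  "finite S \<Longrightarrow> (\<Sum>k\<in>S. of_bool (j = k) :: int) = of_bool (j \<in> S)"
  by (simp_all add: of_bool_def)

lemma sum_of_bool_mem: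
  "finite S \<Longrightarrow> (\<Sum>k\<in>S. of_bool (k \<in> F) :: int) = int (card (F \<inter> S))"
  by (simp add: of_bool_def sum.If_cases Int_commute)

lemma sum_move:
  "finite S \<Longrightarrow> sum (move i j b) S = sum b S + of_bool (j \<in> S) - of_bool (i \<in> S)"
  by (simp add: move_def sum.distrib sum_subtractf)

lemma move_self [simp]: "move i i b = b"
  by (simp add: move_def)

definition l1dist :: "('n::finite \<Rightarrow> int) \<Rightarrow> ('n \<Rightarrow> int) \<Rightarrow> nat" where
  "l1dist b c = (\<Sum>k\<in>UNIV. nat \<bar>b k - c k\<bar>)"

text \<open>By integrality neither changed coordinate overshoots its target. This makes the distance
  to \<open>c\<close> an induction measure for exchange arguments.\<close>

lemma l1dist_move:
  assumes "c i < b i" "b j < c j"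
  shows "l1dist (move i j b) c < l1dist b c"
  unfolding l1dist_def
proof (rule sum_strict_mono_ex1)
  show "\<forall>k\<in>UNIV. nat \<bar>move i j b k - c k\<bar> \<le> nat \<bar>b k - c k\<bar>"
    using assms by (auto simp: move_def)
  show "\<exists>k\<in>UNIV. nat \<bar>move i j b k - c k\<bar> < nat \<bar>b k - c k\<bar>"
    using assms by (intro bexI[of _ i]) (auto simp: move_def)
qed simp

locale mconvex_set =
  fixes B :: "('n::finite \<Rightarrow> int) set" and d :: int
  assumes mconvex: "mconvex B" and finite_B: "finite B" and nonempty: "B \<noteq> {}"
    and deg: "b \<in> B \<Longrightarrow> sum b UNIV = d"
begin

text \<open>Exchange \<open>move k s b\<close> against \<open>move i k b\<close> at
  \<open>i\<close>: the only coordinate that can receive the unit is \<open>k\<close>, and the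
  result is \<open>move i s b\<close>.\<close>

lemma move_trans:
  assumes "move i k b \<in> B" "move k s b \<in> B" "b \<in> B"
  shows "move i s b \<in> B"
proof (cases "i = k \<or> k = s \<or> i = s")
  case False
  then have "move i k b i < move k s b i" by (simp add: move_def)
  then obtain j where j: "move k s b j < move i k b j" "move i j (move k s b) \<in> B"
    using mconvexD[OF mconvex assms(2,1)] by metis
  then have "j = k" using False by (auto simp: move_def of_bool_def split: if_splits)
  moreover have "move i k (move k s b) = move i s b" by (auto simp: move_def fun_eq_iff)
  ultimately show ?thesis using j by simp
qed (use assms in auto)

text \<open>A local maximum of \<open>b \<mapsto> b(S)\<close> is a global one.\<close>

lemma exists_move_into:
  assumes "b \<in> B" "c \<in> B" "sum b S < sum c S"
  shows "\<exists>k s. k \<notin> S \<and> s \<in> S \<and> move k s b \<in> B"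
  using assms
proof (induction "l1dist b c" arbitrary: b rule: less_induct)
  case less
  have "sum c (- S) < sum b (- S)"
  proof -
    have "sum x UNIV = sum x S + sum x (- S)" for x :: "'n \<Rightarrow> int"
      by (simp add: sum.union_disjoint[symmetric])
    then show ?thesis using deg[OF less.prems(1)] deg[OF less.prems(2)] less.prems(3)
      by (smt (verit))
  qed
  then obtain i where i: "i \<notin> S" "c i < b i"
    by (metis ComplD linorder_not_le sum_mono)
  then obtain j where j: "b j < c j" "move i j b \<in> B"
    using mconvexD[OF mconvex less.prems(1,2)] by metis
  show ?case
  proof (cases "j \<in> S")
    case False
    let ?b = "move i j b"
    have "sum ?b S = sum b S" using i False by (simp add: sum_move)
    then obtain k s where ks: "k \<notin> S" "s \<in> S" "move k s ?b \<in> B"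
      using less.hyps[OF l1dist_move[OF i(2) j(1)] j(2) less.prems(2)] less.prems(3) by auto
    let ?d = "move k s ?b"
    show ?thesis
    proof (cases "k = j")
      case True
      then have "?d = move i s b" by (auto simp: move_def)
      then show ?thesis using ks i by metis
    next
      case kj: False
      have ij: "i \<noteq> j" using i j by auto
      \<comment> \<open>\<open>?d\<close> differs from \<open>b\<close> by two moves, and
        \<open>j\<close> received a unit in the first. Exchanging back towards \<open>b\<close> at
        \<open>j\<close> cancels one of the two removals and leaves a single move into
        \<open>S\<close>.\<close>
      have "b j < ?d j" using kj ij ks by (auto simp: move_def)
      then obtain t where t: "?d t < b t" "move j t ?d \<in> B"
        using mconvexD[OF mconvex ks(3) less.prems(1)] by metis
      then have "t = i \<or> t = k" unfolding move_def of_bool_def by (auto split: if_splits)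
      then have "move j t ?d = move k s b \<or> move j t ?d = move i s b"
        by (auto simp: move_def)
      then show ?thesis using t ks i by metis
    qed
  qed (use i j in auto)
qed

text \<open>Let \<open>A\<close> be the set of coordinates that can give a unit to \<open>i\<close>.
  By \<open>move_trans\<close> no unit can be moved into \<open>A\<close> from outside, so
  \<open>u\<close> maximises the sum over \<open>A\<close>. Since \<open>v\<close> is larger at
  \<open>i\<close>, it must be smaller somewhere else in \<open>A\<close>.\<close>

lemma exchange_dual:
  assumes "u \<in> B" "v \<in> B" "u i < v i"
  obtains j where "v j < u j" "move j i u \<in> B"
proof -
  define A where "A = {k. move k i u \<in> B}"
  have "i \<in> A" using assms by (simp add: A_def)
  have "move k s u \<notin> B" if "k \<notin> A" "s \<in> A" for k s
    using that move_trans[of k s u i] assms by (auto simp: A_def)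
  then have "sum v A \<le> sum u A"
    using exists_move_into[OF assms(1,2), of A] by fastforce
  moreover have "sum u A < sum v A" if "\<forall>j\<in>A. u j \<le> v j"
    by (rule sum_strict_mono_ex1) (use that \<open>i \<in> A\<close> assms in auto)
  ultimately obtain j where "j \<in> A" "v j < u j" by (meson linorder_not_le)
  then show ?thesis using that by (auto simp: A_def)
qed

section \<open>The rank function of an M-convex set\<close>

definition rk :: "'n set \<Rightarrow> int" where
  "rk S = Max ((\<lambda>b. sum b S) ` B)"

lemma rk_ge: "b \<in> B \<Longrightarrow> sum b S \<le> rk S"
  unfolding rk_def using finite_B by simp

lemma rk_attained: "\<exists>b\<in>B. sum b S = rk S"
proof -
  have "rk S \<in> (\<lambda>b. sum b S) ` B"
    unfolding rk_def using finite_B nonempty by (intro Max_in) auto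
  then show ?thesis by auto
qed

lemma rk_eq_if_no_move_into:
  assumes "b \<in> B" "\<And>k s. k \<notin> S \<Longrightarrow> s \<in> S \<Longrightarrow> move k s b \<notin> B"
  shows "sum b S = rk S"
proof (rule ccontr)
  assume "sum b S \<noteq> rk S"
  then have "sum b S < rk S" using rk_ge[OF assms(1), of S] by simp
  moreover obtain c where "c \<in> B" "sum c S = rk S" using rk_attained by blast
  ultimately show False using exists_move_into[OF assms(1), of c S] assms(2) by auto
qed

text \<open>Among the maximisers on \<open>T\<close>, take one that is maximal on \<open>S\<close>.
  A move into \<open>S\<close> also ends in \<open>T\<close>, so it stays among the maximisers on
  \<open>T\<close> and cannot exist. With the pair intersection and union this yields
  submodularity.\<close>

lemma rk_attained_nested:
  assumes "S \<subseteq> T"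
  obtains b where "b \<in> B" "sum b S = rk S" "sum b T = rk T"
proof -
  define C where "C = {b \<in> B. sum b T = rk T}"
  have "finite C" "C \<noteq> {}" using finite_B rk_attained[of T] by (auto simp: C_def)
  then have "Max ((\<lambda>b. sum b S) ` C) \<in> (\<lambda>b. sum b S) ` C" by (intro Max_in) auto
  then obtain b where b: "b \<in> C" "Max ((\<lambda>b. sum b S) ` C) = sum b S" by auto
  have b_max: "sum c S \<le> sum b S" if "c \<in> C" for c
    unfolding b(2)[symmetric] using \<open>finite C\<close> that by simp
  have "move k s b \<notin> B" if "k \<notin> S" "s \<in> S" for k s
  proof
    assume m: "move k s b \<in> B"
    have "s \<in> T" using that assms by auto
    then have "sum (move k s b) T \<ge> rk T" using b(1) by (simp add: sum_move C_def)
    then have "move k s b \<in> C" using m rk_ge[OF m, of T] by (simp add: C_def)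
    from b_max[OF this] that show False by (simp add: sum_move)
  qed
  with b(1) have "sum b S = rk S" by (intro rk_eq_if_no_move_into) (auto simp: C_def)
  with b(1) that show ?thesis by (auto simp: C_def)
qed

lemma rk_submodular: "rk (S \<inter> T) + rk (S \<union> T) \<le> rk S + rk T"
proof -
  obtain b where b: "b \<in> B" "sum b (S \<inter> T) = rk (S \<inter> T)" "sum b (S \<union> T) = rk (S \<union> T)"
    by (rule rk_attained_nested[of "S \<inter> T" "S \<union> T"]) auto
  have "sum b (S \<union> T) + sum b (S \<inter> T) = sum b S + sum b T"
    by (rule sum.union_inter) auto
  then show ?thesis using b rk_ge[OF b(1), of S] rk_ge[OF b(1), of T] by linarith
qed

text \<open>Integer points of a base polytope inside a box. For a point of \<open>B\<close> with
  least total violation and a violated coordinate \<open>i\<close>, the set of coordinates joined to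
  \<open>i\<close> by a move is closed under \<open>move_trans\<close>; hence it or its complement
  is tight, and one of the two rank conditions fails.\<close>

lemma meets_box:
  assumes "\<And>k. l k \<le> u k" and "\<And>S. sum l S \<le> rk S" and "\<And>S. d - rk S \<le> sum u (- S)"
  shows "\<exists>b\<in>B. \<forall>k. l k \<le> b k \<and> b k \<le> u k"
proof -
  define viol where "viol b = (\<Sum>k\<in>UNIV. nat (l k - b k) + nat (b k - u k))" for b :: "'n \<Rightarrow> int"
  obtain b where b: "b \<in> B" "\<And>c. c \<in> B \<Longrightarrow> viol b \<le> viol c"
    using nonempty arg_min_nat_lemma[of "\<lambda>b. b \<in> B" _ viol] by blast
  have split: "sum x UNIV = sum x S + sum x (- S)" for x :: "'n \<Rightarrow> int" and S
    by (simp add: sum.union_disjoint[symmetric])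
  have "b i \<le> u i" for i
  proof (rule ccontr)
    assume i: "\<not> b i \<le> u i"
    define D where "D = {k. move i k b \<in> B}"
    \<comment> \<open>Otherwise moving a unit from \<open>i\<close> to \<open>k\<close> reduces the
      violation: \<open>k\<close> stays within its upper bound, and \<open>i\<close>, lying above
      \<open>u i\<close>, does not drop below \<open>l i\<close>.\<close>
    have D: "u k \<le> b k" if "k \<in> D" for k
    proof (rule ccontr)
      assume k: "\<not> u k \<le> b k"
      have "viol (move i k b) < viol b" unfolding viol_def
      proof (rule sum_strict_mono_ex1)
        show "\<forall>r\<in>UNIV. nat (l r - move i k b r) + nat (move i k b r - u r)
            \<le> nat (l r - b r) + nat (b r - u r)"
          using i k assms(1)[of i] by (auto simp: move_def)
        show "\<exists>r\<in>UNIV. nat (l r - move i k b r) + nat (move i k b r - u r)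
            < nat (l r - b r) + nat (b r - u r)"
          using i k assms(1)[of i] by (intro bexI[of _ i]) (auto simp: move_def)
      qed simp
      then show False using b(2)[of "move i k b"] that by (simp add: D_def)
    qed
    have "i \<in> D" using b by (simp add: D_def)
    have "sum b (- D) = rk (- D)"
      by (rule rk_eq_if_no_move_into[OF b(1)])
         (use move_trans[of i _ b] b(1) in \<open>auto simp: D_def\<close>)
    moreover have "sum u D < sum b D"
      by (rule sum_strict_mono_ex1) (use D i \<open>i \<in> D\<close> in \<open>auto intro!: bexI[of _ i]\<close>)
    ultimately show False using assms(3)[of "- D"] deg[OF b(1)] split[of b D] by simp
  qed
  moreover have "l i \<le> b i" for i
  proof (rule ccontr)
    assume i: "\<not> l i \<le> b i"
    define D where "D = {k. move k i b \<in> B}"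
    have D: "b k \<le> l k" if "k \<in> D" for k
    proof (rule ccontr)
      assume k: "\<not> b k \<le> l k"
      have "viol (move k i b) < viol b" unfolding viol_def
      proof (rule sum_strict_mono_ex1)
        show "\<forall>r\<in>UNIV. nat (l r - move k i b r) + nat (move k i b r - u r)
            \<le> nat (l r - b r) + nat (b r - u r)"
          using i k assms(1)[of i] by (auto simp: move_def)
        show "\<exists>r\<in>UNIV. nat (l r - move k i b r) + nat (move k i b r - u r)
            < nat (l r - b r) + nat (b r - u r)"
          using i k assms(1)[of i] by (intro bexI[of _ i]) (auto simp: move_def)
      qed simp
      then show False using b(2)[of "move k i b"] that by (simp add: D_def)
    qed
    have "i \<in> D" using b by (simp add: D_def)
    have "sum b D = rk D"
      by (rule rk_eq_if_no_move_into[OF b(1)])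
         (use move_trans[of _ _ b i] b(1) in \<open>auto simp: D_def\<close>)
    moreover have "sum b D < sum l D"
      by (rule sum_strict_mono_ex1) (use D i \<open>i \<in> D\<close> in \<open>auto intro!: bexI[of _ i]\<close>)
    ultimately show False using assms(2)[of D] by simp
  qed
  ultimately show ?thesis using b(1) by auto
qed

end

text \<open>A move from \<open>i\<close> to \<open>j\<close> is blocked only by a tight set
  containing \<open>j\<close> but not \<open>i\<close>. If all coordinates where \<open>b\<close> is
  larger were blocked, they would lie in the union \<open>U\<close> of these tight sets. There
  \<open>b\<close> has no larger sum than \<open>a\<close>, and outside \<open>U\<close>, where
  \<open>i\<close> lies, it has a strictly smaller one, although the totals agree.\<close>

lemma mconvex_intersecting_submodular:
  fixes g :: "'n::finite set \<Rightarrow> int"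
  assumes g: "\<And>S T. S \<inter> T \<noteq> {} \<Longrightarrow> g (S \<inter> T) + g (S \<union> T) \<le> g S + g T"
  shows "mconvex {a. sum a UNIV = D \<and> (\<forall>S. S \<noteq> {} \<longrightarrow> sum a S \<le> g S)}" (is "mconvex ?P")
  unfolding mconvex_def
proof (intro ballI allI impI)
  fix a b :: "'n \<Rightarrow> int" and i
  assume a: "a \<in> ?P" and b: "b \<in> ?P" and i: "b i < a i"
  define \<T> where "\<T> = {S. S \<noteq> {} \<and> i \<notin> S \<and> sum a S = g S}"
  have union: "S \<union> T \<in> \<T>" if "S \<in> \<T>" "T \<in> \<T>" "S \<inter> T \<noteq> {}" for S T
  proof -
    have "sum a (S \<union> T) + sum a (S \<inter> T) = sum a S + sum a T"
      by (rule sum.union_inter) auto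
    moreover have "sum a (S \<union> T) \<le> g (S \<union> T)" "sum a (S \<inter> T) \<le> g (S \<inter> T)"
      using a that by auto
    ultimately have "sum a (S \<union> T) = g (S \<union> T)"
      using g[OF that(3)] that by (simp add: \<T>_def)
    moreover have "S \<union> T \<noteq> {}" "i \<notin> S \<union> T" using that(1,2) unfolding \<T>_def by simp_all
    ultimately show ?thesis unfolding \<T>_def by simp
  qed
  \<comment> \<open>Disjoint tight sets need not have a tight union. So \<open>U\<close> is treated
    as the disjoint union of the maximal tight sets, and \<open>a\<close> and \<open>b\<close> are
    compared on each of them.\<close>
  define \<M> where "\<M> = {S \<in> \<T>. \<forall>T\<in>\<T>. S \<subseteq> T \<longrightarrow> T = S}"
  have disj: "S \<inter> T = {}" if "S \<in> \<M>" "T \<in> \<M>" "S \<noteq> T" for S T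
  proof (rule ccontr)
    assume "S \<inter> T \<noteq> {}"
    then have "S \<union> T \<in> \<T>" using that union by (simp add: \<M>_def)
    then have "S \<union> T = S" "S \<union> T = T" using that by (auto simp: \<M>_def)
    with that(3) show False by simp
  qed
  have cover: "\<exists>M\<in>\<M>. S \<subseteq> M" if S: "S \<in> \<T>" for S
  proof -
    obtain M where "M \<in> \<T>" "S \<subseteq> M" "\<And>T. T \<in> \<T> \<Longrightarrow> M \<subseteq> T \<Longrightarrow> M = T"
      using finite_has_maximal2[of \<T> S] S by auto
    then show ?thesis unfolding \<M>_def by blast
  qed
  define U where "U = \<Union>\<M>"
  have "sum x U = (\<Sum>M\<in>\<M>. sum x M)" for x :: "'n \<Rightarrow> int"
    unfolding U_def using sum.Union_disjoint[of \<M> x] disj by simp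
  moreover have "sum b M \<le> sum a M" if "M \<in> \<M>" for M
    using b that by (auto simp: \<M>_def \<T>_def)
  ultimately have U: "sum b U \<le> sum a U" by (simp add: sum_mono)
  show "\<exists>j. a j < b j \<and> move i j a \<in> ?P"
  proof (rule ccontr)
    assume no: "\<not> ?thesis"
    have "j \<in> U" if j: "a j < b j" for j
    proof -
      have "i \<noteq> j" using i j by auto
      have "sum (move i j a) UNIV = D" using a by (simp add: sum_move)
      moreover have "move i j a \<notin> ?P" using no j by blast
      ultimately obtain S where S: "S \<noteq> {}" "g S < sum (move i j a) S"
        unfolding mem_Collect_eq by (meson linorder_not_le)
      moreover have "sum a S \<le> g S" using a S by auto
      ultimately have "sum a S = g S \<and> j \<in> S \<and> i \<notin> S"
        by (cases "j \<in> S"; cases "i \<in> S") (simp_all add: sum_move)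
      then have "S \<in> \<T>" using S by (simp add: \<T>_def)
      with cover \<open>sum a S = g S \<and> j \<in> S \<and> i \<notin> S\<close> show ?thesis unfolding U_def by blast
    qed
    then have le: "\<forall>j\<in>-U. b j \<le> a j" using linorder_not_le by blast
    have "i \<notin> U" by (auto simp: U_def \<M>_def \<T>_def)
    with le i have "sum b (- U) < sum a (- U)"
      by (intro sum_strict_mono_ex1) (auto intro!: bexI[of _ i])
    moreover have "sum x UNIV = sum x U + sum x (- U)" for x :: "'n \<Rightarrow> int"
      by (simp add: sum.union_disjoint[symmetric])
    moreover have "sum a UNIV = sum b UNIV" using a b by simp
    ultimately show False using U by simp
  qed
qed

text \<open>If \<open>B\<close> is the set of exponents of the generators of a polymatroidal ideal, then \<open>F\<close> is
  a set of variables among those generating the colon ideal of the linear quotients at \<open>a - F\<close>.\<close>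

definition shifts :: "('n::finite \<Rightarrow> int) set \<Rightarrow> nat \<Rightarrow> ('n \<Rightarrow> int) set" where
  "shifts B i = {a. \<exists>F. card F = i \<and> (\<lambda>p. a p - of_bool (p \<in> F)) \<in> B \<and>
     (\<forall>f\<in>F. \<exists>q. to_nat f < to_nat q \<and> move q f (\<lambda>p. a p - of_bool (p \<in> F)) \<in> B)}"

context mconvex_set begin

lemma rk_empty [simp]: "rk {} = 0"
  using rk_attained[of "{}"] by simp

text \<open>If \<open>S\<close> is not contained in \<open>F\<close>, then \<open>F\<close> meets it
  in at most \<open>card S - 1\<close> elements. If it is, the element of \<open>S\<close> with the
  largest index can gain a unit from a later \<open>q\<close>, which lies outside \<open>S\<close>;
  so \<open>a - F\<close> is still one below the rank on \<open>S\<close>.\<close>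

lemma shifts_le:
  assumes "a \<in> shifts B i" "S \<noteq> {}"
  shows "sum a S \<le> rk S + min (int i) (int (card S) - 1)"
proof -
  from assms(1) obtain F where F: "card F = i" "(\<lambda>p. a p - of_bool (p \<in> F)) \<in> B"
    "\<And>f. f \<in> F \<Longrightarrow> \<exists>q. to_nat f < to_nat q \<and> move q f (\<lambda>p. a p - of_bool (p \<in> F)) \<in> B"
    by (auto simp: shifts_def)
  define u where "u = (\<lambda>p. a p - of_bool (p \<in> F))"
  have u: "sum a S = sum u S + int (card (F \<inter> S))"
    by (simp add: u_def sum_subtractf sum_of_bool_mem Int_commute)
  have "card (F \<inter> S) \<le> i" using F(1) by (metis card_mono finite inf.cobounded1)
  show ?thesis
  proof (cases "S \<subseteq> F")
    case False
    then have "F \<inter> S \<subset> S" by auto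
    then have "card (F \<inter> S) < card S" by (intro psubset_card_mono) auto
    then show ?thesis using u rk_ge[OF F(2), of S] \<open>card (F \<inter> S) \<le> i\<close>
      by (simp add: u_def)
  next
    case True
    obtain m where m: "m \<in> S" "\<And>s. s \<in> S \<Longrightarrow> to_nat s \<le> to_nat m"
    proof -
      have "Max (to_nat ` S) \<in> to_nat ` S" using assms(2) by (intro Max_in) auto
      then obtain m where "m \<in> S" "Max (to_nat ` S) = to_nat m" by auto
      then show ?thesis using that[of m] by (metis Max_ge finite finite_imageI imageI)
    qed
    obtain q where q: "to_nat m < to_nat q" "move q m u \<in> B"
      using F(3)[of m] m True by (auto simp: u_def)
    have "q \<notin> S" using m(2)[of q] q(1) by linarith
    then have "sum u S + 1 \<le> rk S" using rk_ge[OF q(2), of S] m by (simp add: sum_move)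
    moreover have "F \<inter> S = S" using True by auto
    ultimately show ?thesis using u \<open>card (F \<inter> S) \<le> i\<close> by simp
  qed
qed

lemma sum_shifts:
  assumes "a \<in> shifts B i"
  shows "sum a UNIV = d + int i"
proof -
  from assms obtain F where F: "card F = i" "(\<lambda>p. a p - of_bool (p \<in> F)) \<in> B"
    by (auto simp: shifts_def)
  then show ?thesis using deg[OF F(2)] by (simp add: sum_subtractf sum_of_bool_mem)
qed

text \<open>Conversely, the inequalities yield for every \<open>f\<close> a decomposition of
  \<open>a\<close> into a point of \<open>B\<close> and a set avoiding \<open>f\<close>. Exchanging
  against these decompositions improves any \<open>F\<close> until every element satisfies the order
  condition in \<open>shifts\<close>.\<close>

lemma shifts_eq:
  "shifts B i = {a. sum a UNIV = d + int i \<and>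
     (\<forall>S. S \<noteq> {} \<longrightarrow> sum a S \<le> rk S + min (int i) (int (card S) - 1))}"
proof (intro equalityI subsetI)
  fix a assume "a \<in> {a. sum a UNIV = d + int i \<and>
     (\<forall>S. S \<noteq> {} \<longrightarrow> sum a S \<le> rk S + min (int i) (int (card S) - 1))}"
  then have a: "sum a UNIV = d + int i"
    "\<And>S. S \<noteq> {} \<Longrightarrow> sum a S \<le> rk S + min (int i) (int (card S) - 1)" by auto
  define \<F> where "\<F> = {F. card F = i \<and> (\<lambda>p. a p - of_bool (p \<in> F)) \<in> B}"
  \<comment> \<open>The box fixes coordinate \<open>f\<close> and lets every other one drop by at
    most one. For \<open>S\<close> containing \<open>f\<close> its lower bound is
    \<open>a(S) - (card S - 1)\<close>, which the \<open>- 1\<close> in the inequality keeps below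
    the rank.\<close>
  have avoid: "\<exists>F\<in>\<F>. f \<notin> F" for f
  proof -
    have "\<exists>b\<in>B. \<forall>k. a k - of_bool (k \<in> - {f}) \<le> b k \<and> b k \<le> a k"
    proof (rule meets_box)
      fix S :: "'n set"
      have S: "sum a S \<le> rk S + min (int i) (int (card S) - 1)" if "S \<noteq> {}"
        using a(2) that by blast
      have "sum a S - int (card (- {f} \<inter> S)) \<le> rk S"
      proof (cases "f \<in> S")
        case True
        then have "- {f} \<inter> S = S - {f}" by auto
        with True have "int (card (- {f} \<inter> S)) = int (card S) - 1"
          using card_Suc_Diff1[of S f] by simp
        with S True show ?thesis by force
      next
        case False
        then have "- {f} \<inter> S = S" by auto
        with S show ?thesis by force
      qed
      then show "(\<Sum>k\<in>S. a k - of_bool (k \<in> - {f})) \<le> rk S"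
        unfolding sum_subtractf sum_of_bool_mem[OF finite] .
      have "sum a UNIV = sum a S + sum a (- S)"
        by (simp add: sum.union_disjoint[symmetric])
      moreover have "sum a S \<le> rk S + int i"
        using S by (cases "S = {}") (simp_all add: min_def split: if_splits)
      ultimately show "d - rk S \<le> sum a (- S)" using a(1) by linarith
    qed simp
    then obtain b where b: "b \<in> B" "\<And>k. a k - of_bool (k \<in> - {f}) \<le> b k" "\<And>k. b k \<le> a k"
      by blast
    define F where "F = {k. b k < a k}"
    have bF: "b = (\<lambda>p. a p - of_bool (p \<in> F))"
    proof
      fix k
      show "b k = a k - of_bool (k \<in> F)"
        using b(2)[of k] b(3)[of k] by (cases "b k < a k"; cases "k = f") (simp_all add: F_def)
    qed
    have "sum b UNIV = sum a UNIV - int (card F)"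
      by (subst bF) (simp add: sum_subtractf sum_of_bool_mem)
    then have "card F = i" using a(1) deg[OF b(1)] by simp
    moreover have "f \<notin> F" using b(2)[of f] by (simp add: F_def)
    ultimately show ?thesis using b(1) bF by (auto simp: \<F>_def)
  qed
  then obtain F0 where "F0 \<in> \<F>" by blast
  \<comment> \<open>With the least sum of indices: when an exchange replaces \<open>f\<close> by
    \<open>q\<close> and gives another candidate, minimality forces \<open>q\<close> to come later
    than \<open>f\<close>.\<close>
  then obtain F where F: "F \<in> \<F>"
    "\<And>F'. F' \<in> \<F> \<Longrightarrow> sum to_nat F \<le> (sum to_nat F' :: nat)"
    using arg_min_nat_lemma[of "\<lambda>F. F \<in> \<F>" F0 "sum to_nat"] by blast
  have "\<exists>q. to_nat f < to_nat q \<and> move q f (\<lambda>p. a p - of_bool (p \<in> F)) \<in> B" if f: "f \<in> F" for f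
  proof -
    obtain F' where F': "F' \<in> \<F>" "f \<notin> F'" using avoid by blast
    have "(\<lambda>p. a p - of_bool (p \<in> F)) f < (\<lambda>p. a p - of_bool (p \<in> F')) f"
      using f F' by simp
    then obtain q where q: "a q - of_bool (q \<in> F') < a q - of_bool (q \<in> F)"
      "move q f (\<lambda>p. a p - of_bool (p \<in> F)) \<in> B"
      by (rule exchange_dual[rotated 2]) (use F F' in \<open>auto simp: \<F>_def\<close>)
    then have "q \<notin> F" by (auto simp: of_bool_def split: if_splits)
    let ?F = "insert q (F - {f})"
    have "move q f (\<lambda>p. a p - of_bool (p \<in> F)) = (\<lambda>p. a p - of_bool (p \<in> ?F))"
      using f \<open>q \<notin> F\<close> by (auto simp: move_def of_bool_def fun_eq_iff)
    moreover have "card ?F = card F" using f \<open>q \<notin> F\<close>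
      by (simp add: card.insert_remove) (metis Suc_pred card_gt_0_iff empty_iff finite)
    ultimately have "?F \<in> \<F>" using q F(1) by (simp add: \<F>_def)
    then have "sum to_nat F \<le> sum to_nat ?F" by (rule F(2))
    moreover have "sum to_nat F = to_nat f + sum to_nat (F - {f})"
      using f by (simp add: sum.remove)
    moreover have "sum to_nat ?F = to_nat q + sum to_nat (F - {f})"
      using \<open>q \<notin> F\<close> by simp
    ultimately have "to_nat f \<le> to_nat q" by linarith
    moreover have "f \<noteq> q" using f \<open>q \<notin> F\<close> by auto
    ultimately have "to_nat f < to_nat q" using inj_to_nat by (metis injD order_le_imp_less_or_eq)
    with q show ?thesis by blast
  qed
  with F(1) show "a \<in> shifts B i" by (auto simp: shifts_def \<F>_def)
qed (use sum_shifts shifts_le in auto)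

text \<open>The correction \<open>min i (m - 1)\<close> is concave in \<open>m\<close>, so it is
  submodular as a function of the cardinality. Its value at the empty set is \<open>-1\<close>,
  which is why only nonempty sets carry a constraint.\<close>

lemma mconvex_shifts: "mconvex (shifts B i)"
  unfolding shifts_eq
proof (rule mconvex_intersecting_submodular)
  fix S T :: "'n set" assume "S \<inter> T \<noteq> {}"
  have "card (S \<union> T) + card (S \<inter> T) = card S + card T"
    by (simp add: card_Un_Int[symmetric])
  moreover have "card (S \<inter> T) \<le> card S" "card (S \<inter> T) \<le> card T" by (simp_all add: card_mono)
  ultimately show "rk (S \<inter> T) + min (int i) (int (card (S \<inter> T)) - 1) +
      (rk (S \<union> T) + min (int i) (int (card (S \<union> T)) - 1))
      \<le> rk S + min (int i) (int (card S) - 1) + (rk T + min (int i) (int (card T) - 1))"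
    using rk_submodular[of S T] by (simp add: min_def)
qed

end

section \<open>Minkowski sums of M-convex sets\<close>

definition msum :: "('n \<Rightarrow> int) set \<Rightarrow> ('n \<Rightarrow> int) set \<Rightarrow> ('n \<Rightarrow> int) set" where
  "msum A B = {\<lambda>k. a k + b k | a b. a \<in> A \<and> b \<in> B}"

text \<open>An exchange in one summand may put the unit on a coordinate \<open>m\<close> where the
  sum has no deficit. Then one of the summands exceeds its counterpart at \<open>m\<close> and
  passes the unit on; the total distance to \<open>y1\<close> and \<open>y2\<close> decreases until
  a coordinate with a deficit is reached.\<close>

lemma mconvex_msum:
  fixes A B :: "('n::finite \<Rightarrow> int) set"
  assumes A: "mconvex A" and B: "mconvex B"
  shows "mconvex (msum A B)"
  unfolding mconvex_def
proof (intro ballI allI impI)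
  fix x y i assume x: "x \<in> msum A B" and y: "y \<in> msum A B" and i: "y i < x i"
  obtain y1 y2 where y12: "y = (\<lambda>k. y1 k + y2 k)" "y1 \<in> A" "y2 \<in> B"
    using y by (auto simp: msum_def)
  have *: "\<exists>j. x j < y j \<and> move i j x \<in> msum A B"
    if "x1 \<in> A" "x2 \<in> B" "(\<lambda>k. x1 k + x2 k) = move i m x" for x1 x2 m
    using that
  proof (induction "l1dist x1 y1 + l1dist x2 y2" arbitrary: x1 x2 m rule: less_induct)
    case less
    show ?case
    proof (cases "x m < y m")
      case True
      have "move i m x \<in> msum A B"
        unfolding msum_def less.prems(3)[symmetric] using less.prems(1,2) by blast
      with True show ?thesis by blast
    next
      case False
      \<comment> \<open>At the start \<open>m = i\<close> and the move is the identity, with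
        \<open>y i < x i\<close>. Later \<open>m\<close> carries the extra unit on top of a value
        that is already at least \<open>y m\<close>.\<close>
      then have "y m < move i m x m" using i by (cases "m = i") (auto simp: move_def)
      also have "\<dots> = x1 m + x2 m" by (simp add: less.prems(3)[symmetric])
      finally consider "y1 m < x1 m" | "y2 m < x2 m" unfolding y12 by linarith
      then show ?thesis
      proof cases
        case 1
        then obtain j where j: "x1 j < y1 j" "move m j x1 \<in> A"
          by (rule mconvexD[OF A less.prems(1) y12(2)])
        have "(\<lambda>k. move m j x1 k + x2 k) = move i j x"
          using less.prems(3) by (auto simp: move_def fun_eq_iff algebra_simps)
        then show ?thesis using less.hyps[OF _ j(2) less.prems(2)] l1dist_move[OF 1 j(1)] by simp
      next
        case 2
        then obtain j where j: "x2 j < y2 j" "move m j x2 \<in> B"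
          by (rule mconvexD[OF B less.prems(2) y12(3)])
        have "(\<lambda>k. x1 k + move m j x2 k) = move i j x"
          using less.prems(3) by (auto simp: move_def fun_eq_iff algebra_simps)
        then show ?thesis using less.hyps[OF _ less.prems(1) j(2)] l1dist_move[OF 2 j(1)] by simp
      qed
    qed
  qed
  obtain x1 x2 where "x = (\<lambda>k. x1 k + x2 k)" "x1 \<in> A" "x2 \<in> B"
    using x by (auto simp: msum_def)
  then show "\<exists>j. x j < y j \<and> move i j x \<in> msum A B" by (intro *[of x1 x2 i]) auto
qed

section \<open>Koszul complexes\<close>

text \<open>A Koszul chain is a function \<open>c\<close> on sets of variables, \<open>c F\<close> being the coefficient of
  \<open>e\<^sub>F\<close>. The signs refer to the order of the variables given by \<open>to_nat\<close>.\<close>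

definition sg :: "'n::countable \<Rightarrow> 'n set \<Rightarrow> 'a::comm_ring_1" where
  "sg p G = (- 1) ^ card {q \<in> G. to_nat q < to_nat p}"

text \<open>The Koszul differential read on coefficients. \<open>x\<close> is a parameter so that
  the same operator serves for the variables \<open>xv\<close> and, inside one multidegree, for the
  constant \<open>1\<close>.\<close>

definition kosz :: "('n::finite \<Rightarrow> 'a::comm_ring_1) \<Rightarrow> ('n set \<Rightarrow> 'a) \<Rightarrow> 'n set \<Rightarrow> 'a" where
  "kosz x c G = (\<Sum>p\<in>- G. sg p G * x p * c (insert p G))"

text \<open>Exterior multiplication by the basis element of \<open>q\<close>.\<close>

definition khom :: "'n::finite \<Rightarrow> ('n set \<Rightarrow> 'a::comm_ring_1) \<Rightarrow> 'n set \<Rightarrow> 'a" where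
  "khom q c F = (if q \<in> F then sg q (F - {q}) * c (F - {q}) else 0)"

lemma to_nat_less_linear:
  fixes p q :: "'n::countable"
  shows "to_nat p < to_nat q \<or> p = q \<or> to_nat q < to_nat p"
proof (cases "p = q")
  case False
  then have "to_nat p \<noteq> to_nat q" by simp
  then show ?thesis by linarith
qed simp

lemma sg_sq [simp]: "sg p G * sg p G = 1"
  by (simp add: sg_def)

lemma sg_sq_left [simp]: "sg p G * (sg p G * c) = c"
  by (simp add: mult.assoc[symmetric])

lemma sg_insert:
  fixes q :: "'n::finite"
  assumes "q \<notin> G"
  shows "sg p (insert q G) = (if to_nat q < to_nat p then - sg p G else sg p G)"
proof (cases "to_nat q < to_nat p")
  case True
  then have "{r \<in> insert q G. to_nat r < to_nat p} = insert q {r \<in> G. to_nat r < to_nat p}"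
    by auto
  with True assms show ?thesis by (simp add: sg_def)
next
  case False
  then have "{r \<in> insert q G. to_nat r < to_nat p} = {r \<in> G. to_nat r < to_nat p}"
    by auto
  with False show ?thesis by (simp add: sg_def)
qed

lemma sg_anticommute:
  fixes p q :: "'n::finite"
  assumes "p \<noteq> q" "p \<notin> G" "q \<notin> G"
  shows "sg p (insert q G) * sg q (insert p G) = - (sg p G * sg q G)"
proof -
  have "to_nat p < to_nat q \<or> to_nat q < to_nat p" using assms(1) to_nat_less_linear by blast
  then show ?thesis using assms by (auto simp: sg_insert)
qed

lemma kosz_add: "kosz x (\<lambda>F. c F + d F) = (\<lambda>F. kosz x c F + kosz x d F)"
  by (simp add: kosz_def fun_eq_iff algebra_simps sum.distrib)

lemma kosz_diff: "kosz x (\<lambda>F. c F - d F) = (\<lambda>F. kosz x c F - kosz x d F)"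
  by (simp add: kosz_def fun_eq_iff algebra_simps sum_subtractf)

lemma kosz_scale: "kosz x (\<lambda>F. s * c F) = (\<lambda>F. s * kosz x c F)"
  by (simp add: kosz_def fun_eq_iff algebra_simps sum_distrib_left)

lemma kosz_zero [simp]: "kosz x (\<lambda>F. 0) = (\<lambda>F. 0)"
  by (simp add: kosz_def fun_eq_iff)

lemma kosz_kosz: "kosz x (kosz x c) = (\<lambda>F. 0)"
proof
  fix G :: "'a set"
  define t where "t p q = sg p G * x p * (sg q (insert p G) * x q * c (insert q (insert p G)))" for p q
  have anti: "t p q = - t q p" if "p \<noteq> q" "p \<notin> G" "q \<notin> G" for p q
  proof -
    have neg: "- (a * b) * (a * b) = - ((a * a) * (b * b))" for a b :: 'b by (simp add: ac_simps)
    let ?a = "sg p G * sg q (insert p G) :: 'b" and ?b = "sg p (insert q G) * sg q G :: 'b"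
    have "?a * ?b = (sg p (insert q G) * sg q (insert p G)) * (sg p G * sg q G)"
      by (simp only: ac_simps)
    also have "\<dots> = - 1" unfolding sg_anticommute[OF that] neg by simp
    finally have "?a * ?b * ?b = - ?b" by simp
    moreover have "?a * ?b * ?b = ?a * (sg p (insert q G) * sg p (insert q G)) * (sg q G * sg q G)"
      by (simp only: ac_simps)
    ultimately have "?a = - ?b" by simp
    then have "?a * (x p * x q * c (insert p (insert q G)))
        = - (?b * (x p * x q * c (insert p (insert q G))))" by simp
    then show ?thesis by (simp add: t_def ac_simps insert_commute)
  qed
  let ?D = "SIGMA p:- G. - insert p G"
  let ?L = "{(p, q) \<in> ?D. to_nat p < to_nat q}" and ?R = "{(p, q) \<in> ?D. to_nat q < to_nat p}"
  have "kosz x (kosz x c) G = (\<Sum>p\<in>- G. \<Sum>q\<in>- insert p G. t p q)"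
    by (simp add: kosz_def t_def sum_distrib_left)
  also have "\<dots> = (\<Sum>(p, q)\<in>?D. t p q)"
    by (subst sum.Sigma) auto
  also have "?D = ?L \<union> ?R"
  proof -
    have "p = q \<or> to_nat p < to_nat q \<or> to_nat q < to_nat p" for p q :: 'a
      using to_nat_less_linear by blast
    then show ?thesis by (auto simp: set_eq_iff)
  qed
  also have "(\<Sum>(p, q)\<in>?L \<union> ?R. t p q) = (\<Sum>(p, q)\<in>?L. t p q) + (\<Sum>(p, q)\<in>?R. t p q)"
    by (rule sum.union_disjoint) auto
  also have "(\<Sum>(p, q)\<in>?R. t p q) = (\<Sum>(p, q)\<in>?L. t q p)"
    by (rule sum.reindex_bij_witness[of _ prod.swap prod.swap]) auto
  also have "\<dots> = - (\<Sum>(p, q)\<in>?L. t p q)"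
    unfolding sum_negf[symmetric] by (rule sum.cong) (auto intro!: anti)
  finally show "kosz x (kosz x c) G = 0" by simp
qed

text \<open>The Leibniz rule: exterior multiplication is a homotopy from multiplication by
  \<open>x q\<close> to zero. It gives exactness where \<open>x q = 1\<close>, and shows that the
  maximal ideal annihilates Koszul homology.\<close>

lemma kosz_khom: "kosz x (khom q c) G + khom q (kosz x c) G = x q * c G"
proof (cases "q \<in> G")
  case False
  have "kosz x (khom q c) G = (\<Sum>p\<in>- G. if p = q then sg q G * x q * (sg q G * c G) else 0)"
    unfolding kosz_def by (rule sum.cong) (use False in \<open>auto simp: khom_def insert_Diff_if\<close>)
  also have "\<dots> = x q * c G" using False by (simp add: ac_simps)
  finally show ?thesis using False by (simp add: khom_def)
next
  case True
  define H where "H = G - {q}"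
  have G: "G = insert q H" "q \<notin> H" using True by (auto simp: H_def)
  have "khom q (kosz x c) G = sg q H * (\<Sum>p\<in>- H. sg p H * x p * c (insert p H))"
    using G by (simp add: khom_def kosz_def)
  also have "- H = insert q (- G)" using G by auto
  also have "sg q H * (\<Sum>p\<in>insert q (- G). sg p H * x p * c (insert p H)) =
      x q * c G + (\<Sum>p\<in>- G. sg q H * (sg p H * x p * c (insert p H)))"
    using True by (simp add: G(1)[symmetric] distrib_left sum_distrib_left mult.assoc)
  also have "(\<Sum>p\<in>- G. sg q H * (sg p H * x p * c (insert p H))) =
      (\<Sum>p\<in>- G. - (sg p G * x p * khom q c (insert p G)))"
  proof (rule sum.cong)
    fix p assume "p \<in> - G"
    then have p: "p \<noteq> q" "p \<notin> H" using G by auto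
    have "insert p G - {q} = insert p H" using G p by auto
    then have "sg p G * x p * khom q c (insert p G) =
        (sg p (insert q H) * sg q (insert p H)) * (x p * c (insert p H))"
      using True by (simp add: khom_def G(1)[symmetric] ac_simps)
    also have "\<dots> = - (sg q H * (sg p H * x p * c (insert p H)))"
      unfolding sg_anticommute[OF p G(2)] by (simp add: ac_simps)
    finally show "sg q H * (sg p H * x p * c (insert p H)) = - (sg p G * x p * khom q c (insert p G))"
      by simp
  qed simp
  finally show ?thesis by (simp add: kosz_def[of x "khom q c"] sum_negf)
qed

definition kchains :: "nat \<Rightarrow> ('n::finite set \<Rightarrow> 'a::zero) set" where
  "kchains j = {c. \<forall>F. c F \<noteq> 0 \<longrightarrow> card F = j}"

lemma kosz_nonzeroD:
  assumes "kosz x c G \<noteq> 0"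
  obtains p where "p \<notin> G" "c (insert p G) \<noteq> 0"
  using assms unfolding kosz_def by (metis (no_types, lifting) ComplD mult_zero_right sum.neutral)

lemma kosz_kchains:
  assumes "c \<in> kchains (Suc j)"
  shows "kosz x c \<in> kchains j"
  unfolding kchains_def
proof (intro CollectI allI impI)
  fix G assume "kosz x c G \<noteq> 0"
  then obtain p where "p \<notin> G" "c (insert p G) \<noteq> 0" by (rule kosz_nonzeroD)
  then have "card (insert p G) = Suc j" using assms by (auto simp: kchains_def)
  with \<open>p \<notin> G\<close> show "card G = j" by simp
qed

lemma kosz_kchains_0:
  assumes "c \<in> kchains 0"
  shows "kosz x c = (\<lambda>F. 0)"
proof
  fix G
  have "c (insert p G) = 0" for p
    using assms by (fastforce simp: kchains_def)
  then show "kosz x c G = 0" by (simp add: kosz_def)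
qed

lemma khom_kchains:
  assumes "c \<in> kchains j"
  shows "khom q c \<in> kchains (Suc j)"
  unfolding kchains_def
proof (intro CollectI allI impI)
  fix F assume "khom q c F \<noteq> 0"
  then have "q \<in> F" "c (F - {q}) \<noteq> 0" by (auto simp: khom_def split: if_splits)
  moreover from this have "card (F - {q}) = j" using assms by (auto simp: kchains_def)
  ultimately show "card F = Suc j" by (metis card.remove finite)
qed

section \<open>Exponent vectors and multigraded strands of the Koszul complex\<close>

definition ind :: "'n::finite set \<Rightarrow> 'n mon" where
  "ind F = Abs_poly_mapping (\<lambda>p. of_bool (p \<in> F))"

lemma lookup_ind [simp]: "lookup (ind F) p = of_bool (p \<in> F)"
  unfolding ind_def by (subst Abs_poly_mapping_inverse) simp_all

lemma mon_eq_iff: "(u::'n mon) = v \<longleftrightarrow> (\<forall>p. lookup u p = lookup v p)"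
  by (simp add: poly_mapping_eq_iff fun_eq_iff)

lemma ind_empty [simp]: "ind {} = 0"
  by (simp add: mon_eq_iff)

lemma ind_insert: "p \<notin> F \<Longrightarrow> ind (insert p F) = single p 1 + ind F"
  by (auto simp: mon_eq_iff lookup_add lookup_single when_def)

definition mdeg :: "'n::finite mon \<Rightarrow> nat" where
  "mdeg u = (\<Sum>i\<in>UNIV. lookup u i)"

lemma mdeg_add [simp]: "mdeg (u + v) = mdeg u + mdeg v"
  by (simp add: mdeg_def lookup_add sum.distrib)

lemma mdeg_zero [simp]: "mdeg 0 = 0"
  by (simp add: mdeg_def)

lemma mdeg_ind [simp]: "mdeg (ind F) = card F"
  by (simp add: mdeg_def of_bool_def sum.If_cases)

definition upset :: "'n mon set \<Rightarrow> 'n mon set" where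
  "upset A = {u + w | u w. u \<in> A}"

lemma upset_closed: "u \<in> upset A \<Longrightarrow> u + w \<in> upset A"
  unfolding upset_def by (force simp: add.assoc)

lemma upset_superset: "u \<in> A \<Longrightarrow> u \<in> upset A"
  unfolding upset_def by (force intro: exI[of _ 0])

lemma upset_mono: "A \<subseteq> B \<Longrightarrow> upset A \<subseteq> upset B"
  by (auto simp: upset_def)

text \<open>The degree \<open>a\<close> part of the Koszul complex with coefficients in the span of the monomials
  in \<open>M\<close>: the coefficient of the basis element \<open>e\<^sub>F\<close> is a multiple of \<open>x\<^sup>t\<close> with
  \<open>a = t + F\<close>.\<close>

definition gchains :: "'n::finite mon set \<Rightarrow> 'n mon \<Rightarrow> nat \<Rightarrow> ('n set \<Rightarrow> 'k::zero) set" where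
  "gchains M a j = {c. \<forall>F. c F \<noteq> 0 \<longrightarrow> card F = j \<and> (\<exists>t\<in>M. a = t + ind F)}"

text \<open>Vanishing of the multidegree \<open>a\<close> part of \<open>Tor_j(K, J)\<close> for the
  span \<open>J\<close> of the monomials in \<open>M\<close>. The \<open>itself\<close> argument
  carries the field, which the other arguments do not mention.\<close>

definition gexact :: "'k::comm_ring_1 itself \<Rightarrow> nat \<Rightarrow> 'n::finite mon set \<Rightarrow> 'n mon \<Rightarrow> bool" where
  "gexact K j M a \<longleftrightarrow> (\<forall>c \<in> gchains M a j. kosz (\<lambda>_. 1 :: 'k) c = (\<lambda>_. 0) \<longrightarrow>
     (\<exists>y \<in> gchains M a (Suc j). kosz (\<lambda>_. 1) y = c))"

lemma gchains_kchains: "c \<in> gchains M a j \<Longrightarrow> c \<in> kchains j"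
  by (auto simp: gchains_def kchains_def)

lemma gchains_mono: "M \<subseteq> M' \<Longrightarrow> gchains M a j \<subseteq> gchains M' a j"
  unfolding gchains_def by blast

lemma gchains_diff: "c \<in> gchains M a j \<Longrightarrow> d \<in> gchains M a j \<Longrightarrow> (\<lambda>F. c F - d F) \<in> gchains M a j"
  for c :: "_ \<Rightarrow> 'k::ab_group_add"
  unfolding gchains_def by force

lemma gchains_add: "c \<in> gchains M a j \<Longrightarrow> d \<in> gchains M a j \<Longrightarrow> (\<lambda>F. c F + d F) \<in> gchains M a j"
  for c :: "_ \<Rightarrow> 'k::ab_group_add"
  unfolding gchains_def by force

lemma gchains_zero [simp]: "(\<lambda>F. 0) \<in> gchains M a j"
  by (simp add: gchains_def)

lemma gchains_kosz:
  assumes "c \<in> gchains (upset A) a (Suc j)"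
  shows "kosz x c \<in> gchains (upset A) a j"
  unfolding gchains_def
proof (intro CollectI allI impI)
  fix G assume nz: "kosz x c G \<noteq> 0"
  then obtain p where p: "p \<notin> G" "c (insert p G) \<noteq> 0" by (rule kosz_nonzeroD)
  then obtain t where t: "t \<in> upset A" "a = t + ind (insert p G)"
    using assms by (auto simp: gchains_def)
  then have "a = (t + single p 1) + ind G" using p by (simp add: ind_insert add.assoc)
  moreover have "card G = j" using kosz_kchains[OF gchains_kchains[OF assms]] nz
    by (auto simp: kchains_def)
  ultimately show "card G = j \<and> (\<exists>t\<in>upset A. a = t + ind G)"
    using upset_closed[OF t(1)] by blast
qed

text \<open>\<open>khom q\<close> is a contraction for any variable \<open>q\<close> that occurs in
  \<open>a\<close>.\<close>

lemma gexact_UNIV: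
  assumes "a \<noteq> 0"
  shows "gexact TYPE('k::comm_ring_1) j UNIV a"
  unfolding gexact_def
proof (intro ballI impI)
  fix c :: "_ \<Rightarrow> 'k" assume c: "c \<in> gchains UNIV a j" "kosz (\<lambda>_. 1) c = (\<lambda>_. 0)"
  obtain q where q: "lookup a q \<noteq> 0" using assms by (auto simp: mon_eq_iff)
  show "\<exists>y \<in> gchains UNIV a (Suc j). kosz (\<lambda>_. 1) y = c"
  proof
    have "kosz (\<lambda>_. 1) (khom q c) G = c G" for G
      using kosz_khom[of "\<lambda>_. 1" q c G] unfolding c(2) khom_def[of q "\<lambda>_. 0"]
      by (simp split: if_splits)
    then show "kosz (\<lambda>_. 1) (khom q c) = c" by blast
    show "khom q c \<in> gchains UNIV a (Suc j)"
      unfolding gchains_def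
    proof (intro CollectI allI impI conjI)
      fix F assume nz: "khom q c F \<noteq> 0"
      show "card F = Suc j" using khom_kchains[OF gchains_kchains[OF c(1)]] nz
        by (auto simp: kchains_def)
      have qF: "q \<in> F" "c (F - {q}) \<noteq> 0" using nz by (auto simp: khom_def split: if_splits)
      then obtain t where t: "a = t + ind (F - {q})" using c(1) by (auto simp: gchains_def)
      \<comment> \<open>The subtraction is not truncated: as \<open>q\<close> is missing from
        \<open>F - {q}\<close>, its exponent in \<open>t\<close> is that in \<open>a\<close>, which
        is nonzero.\<close>
      have "a = (t - single q 1) + ind F"
        unfolding mon_eq_iff
      proof
        fix p
        have "lookup a p = lookup t p + of_bool (p \<in> F - {q})"
          by (simp add: t lookup_add)
        then show "lookup a p = lookup (t - single q 1 + ind F) p"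
          using q qF by (cases "p = q") (auto simp: lookup_add lookup_minus lookup_single)
      qed
      then show "\<exists>t\<in>UNIV. a = t + ind F" by blast
    qed
  qed
qed

section \<open>Linear quotients\<close>

lemma upset_insert: "upset (insert u H) = upset H \<union> {u + w | w. True}"
  by (auto simp: upset_def)

lemma gchains_restrict:
  assumes "c \<in> gchains M a j"
    and "\<And>F t. c F \<noteq> 0 \<Longrightarrow> a = t + ind F \<Longrightarrow> t \<in> M \<Longrightarrow> t \<in> M'"
  shows "c \<in> gchains M' a j"
  using assms unfolding gchains_def by blast

lemma mon_split_single:
  assumes "lookup (m :: 'n mon) p \<noteq> 0"
  obtains m' where "m = single p 1 + m'"
proof
  show "m = single p 1 + (m - single p 1)"
    unfolding mon_eq_iff
  proof
    fix q show "lookup m q = lookup (single p 1 + (m - single p 1)) q"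
      using assms by (cases "p = q") (simp_all add: lookup_add lookup_minus lookup_single)
  qed
qed

text \<open>The cells of \<open>R\<close> are those whose monomial is new in \<open>upset (insert u H)\<close>. Either \<open>R\<close> is a
  cone with some apex \<open>q\<close>, and the new cells can be removed in pairs, or it contains at most one
  cell.\<close>

lemma gexact_insert:
  fixes u :: "'n::finite mon" and H V
  defines "R a \<equiv> {F. \<exists>m. (\<forall>p\<in>V. lookup m p = 0) \<and> a = u + m + ind F}"
  assumes V1: "\<And>p. p \<in> V \<Longrightarrow> u + single p 1 \<in> upset H"
    and V2: "\<And>m. u + m \<in> upset H \<Longrightarrow> \<exists>p\<in>V. lookup m p \<noteq> 0"
    and deg: "mdeg u = d" "\<And>w. w \<in> H \<Longrightarrow> mdeg w = d"
    and IH: "\<And>j. mdeg a \<noteq> d + j \<Longrightarrow> gexact TYPE('k::comm_ring_1) j (upset H) a"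
  shows "gexact TYPE('k) j (upset (insert u H)) a \<longleftrightarrow>
    gexact TYPE('k) j (upset H) a \<and> \<not> (\<exists>F\<subseteq>V. card F = j \<and> a = u + ind F)"
proof -
  let ?M = "upset (insert u H)" and ?M' = "upset H"
  have sub: "?M' \<subseteq> ?M" by (rule upset_mono) auto
  have old: "t \<notin> ?M'" if F: "F \<in> R a" "a = t + ind F" for F t
  proof
    assume t: "t \<in> ?M'"
    obtain m where m: "\<forall>p\<in>V. lookup m p = 0" "a = u + m + ind F"
      using F(1) by (auto simp: R_def)
    then have "t = u + m" using F(2) by simp
    then have "\<exists>p\<in>V. lookup m p \<noteq> 0" using V2 t by simp
    with m(1) show False by simp
  qed
  have new: "F \<in> R a" if t: "a = t + ind F" "t \<in> ?M" "t \<notin> ?M'" for F t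
  proof -
    obtain m where m: "t = u + m" using t by (auto simp: upset_insert)
    have "lookup m p = 0" if p: "p \<in> V" for p
    proof (rule ccontr)
      assume "lookup m p \<noteq> 0"
      then obtain m' where "m = single p 1 + m'" by (rule mon_split_single)
      then have "t \<in> ?M'" using upset_closed[OF V1[OF p], of m'] m by (simp add: add.assoc)
      with t(3) show False by simp
    qed
    with t m show ?thesis by (auto simp: R_def)
  qed
  have restr: "c \<in> gchains ?M' a j" if "c \<in> gchains ?M a j" "\<And>F. F \<in> R a \<Longrightarrow> c F = 0"
    for c :: "'n set \<Rightarrow> 'k" and j
    by (rule gchains_restrict[OF that(1)]) (use new that(2) in blast)
  have vanish: "c F = 0" if "c \<in> gchains ?M' a j" "F \<in> R a" for c :: "'n set \<Rightarrow> 'k" and j F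
    using that old unfolding gchains_def by blast
  \<comment> \<open>In case \<open>cone\<close>, \<open>R a\<close> is closed under adding and
    deleting \<open>q\<close>. In case \<open>critical\<close>, \<open>F0\<close> is its only cell.
    In case \<open>none\<close> it is empty: a cell would have \<open>m = 0\<close> and lie in
    \<open>V\<close>.\<close>
  consider (cone) q m0 where "q \<notin> V" "a = u + m0" "lookup m0 q \<noteq> 0"
    | (critical) F0 where "F0 \<subseteq> V" "a = u + ind F0"
    | (none) "\<And>m0 q. a = u + m0 \<Longrightarrow> q \<notin> V \<Longrightarrow> lookup m0 q = 0"
       "\<And>F. F \<subseteq> V \<Longrightarrow> a \<noteq> u + ind F" by metis
  then show ?thesis
  proof cases
    case (cone q m0)
    have R_ins: "insert q F \<in> R a" if F: "F \<in> R a" for F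
    proof (cases "q \<in> F")
      case False
      obtain m where m: "\<forall>p\<in>V. lookup m p = 0" "a = u + m + ind F"
        using F by (auto simp: R_def)
      then have "m0 = m + ind F" using cone(2) by (simp add: add.assoc)
      then have "lookup m q \<noteq> 0" using cone(3) False by (simp add: lookup_add)
      then obtain m' where m': "m = single q 1 + m'" by (rule mon_split_single)
      have "\<forall>p\<in>V. lookup m' p = 0" using m(1) by (simp add: m' lookup_add)
      moreover have "a = u + m' + ind (insert q F)"
        using False by (simp add: m(2) m' ind_insert ac_simps)
      ultimately show ?thesis by (auto simp: R_def)
    qed (use F in \<open>simp add: insert_absorb\<close>)
    have R_del: "F - {q} \<in> R a" if F: "F \<in> R a" for F
    proof (cases "q \<in> F")
      case True
      obtain m where m: "\<forall>p\<in>V. lookup m p = 0" "a = u + m + ind F"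
        using F by (auto simp: R_def)
      have "ind F = single q 1 + ind (F - {q})"
        using ind_insert[of q "F - {q}"] True by (simp add: insert_absorb)
      then have "a = u + (single q 1 + m) + ind (F - {q})"
        by (simp add: m(2) ac_simps)
      moreover have "\<forall>p\<in>V. lookup (single q 1 + m) p = 0"
        using m(1) cone(1) by (auto simp: lookup_add lookup_single when_def)
      ultimately show ?thesis unfolding R_def by blast
    qed (use F in simp)
    \<comment> \<open>A chain whose boundary has no new cells is moved into the old complex by
      subtracting the boundary of \<open>khom q\<close> applied to its new part. This holds for
      cycles and for fillings alike, and so gives both directions.\<close>
    have reduce: "\<exists>b\<in>gchains ?M a (Suc j). (\<lambda>F. c F - kosz (\<lambda>_. 1) b F) \<in> gchains ?M' a j"
      if c: "c \<in> gchains ?M a j" and cR: "\<And>F. F \<in> R a \<Longrightarrow> kosz (\<lambda>_. 1) c F = 0"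
      for c :: "'n set \<Rightarrow> 'k" and j
    proof
      define r where "r = (\<lambda>F. if F \<in> R a then c F else 0)"
      \<comment> \<open>The faces of old cells are old, so on new cells the boundary of
        \<open>c\<close> is the boundary of its new part \<open>r\<close>.\<close>
      have kr: "kosz (\<lambda>_. 1) r G = 0" if G: "G \<in> R a" for G
      proof -
        have "kosz (\<lambda>_. 1) (\<lambda>F. c F - r F) G = 0"
        proof (rule ccontr)
          assume "kosz (\<lambda>_. 1) (\<lambda>F. c F - r F) G \<noteq> 0"
          then obtain p where p: "p \<notin> G" "c (insert p G) - r (insert p G) \<noteq> 0"
            by (rule kosz_nonzeroD)
          then have "insert p G \<notin> R a" "c (insert p G) \<noteq> 0" by (auto simp: r_def split: if_splits)
          then obtain t where t: "t \<in> ?M'" "a = t + ind (insert p G)"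
            using c new unfolding gchains_def by blast
          then have "a = (t + single p 1) + ind G"
            using p by (simp add: ind_insert add.assoc)
          from old[OF G this] upset_closed[OF t(1)] show False by blast
        qed
        then show ?thesis using cR[OF G] by (simp add: kosz_diff)
      qed
      let ?b = "khom q r"
      show b: "?b \<in> gchains ?M a (Suc j)"
        unfolding gchains_def
      proof (intro CollectI allI impI conjI)
        fix F assume nz: "?b F \<noteq> 0"
        have "r \<in> kchains j" using gchains_kchains[OF c] by (auto simp: r_def kchains_def)
        from khom_kchains[OF this] nz show "card F = Suc j" by (auto simp: kchains_def)
        have "q \<in> F" "F - {q} \<in> R a" using nz by (auto simp: khom_def r_def split: if_splits)
        then have "F \<in> R a" using R_ins[of "F - {q}"] by (simp add: insert_absorb)
        then show "\<exists>t\<in>?M. a = t + ind F" by (auto simp: R_def upset_insert)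
      qed
      have "(\<lambda>F. c F - kosz (\<lambda>_. 1) ?b F) \<in> gchains ?M a j"
        by (intro gchains_diff c gchains_kosz b)
      moreover have "c F - kosz (\<lambda>_. 1) ?b F = 0" if F: "F \<in> R a" for F
      proof -
        have "khom q (kosz (\<lambda>_. 1) r) F = 0" using kr[OF R_del[OF F]] by (simp add: khom_def)
        with kosz_khom[of "\<lambda>_. 1" q r F] F show ?thesis by (simp add: r_def)
      qed
      ultimately show "(\<lambda>F. c F - kosz (\<lambda>_. 1) ?b F) \<in> gchains ?M' a j" by (rule restr)
    qed
    have "gexact TYPE('k) j ?M a \<longleftrightarrow> gexact TYPE('k) j ?M' a"
    proof
      assume ex: "gexact TYPE('k) j ?M a"
      show "gexact TYPE('k) j ?M' a"
        unfolding gexact_def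
      proof (intro ballI impI)
        fix c :: "'n set \<Rightarrow> 'k" assume c: "c \<in> gchains ?M' a j" "kosz (\<lambda>_. 1) c = (\<lambda>_. 0)"
        then obtain y where y: "y \<in> gchains ?M a (Suc j)" "kosz (\<lambda>_. 1) y = c"
          using ex gchains_mono[OF sub] unfolding gexact_def by blast
        obtain b where b: "b \<in> gchains ?M a (Suc (Suc j))"
          "(\<lambda>F. y F - kosz (\<lambda>_. 1) b F) \<in> gchains ?M' a (Suc j)"
          using reduce[OF y(1)] vanish[OF c(1)] y(2) by metis
        moreover have "kosz (\<lambda>_. 1) (\<lambda>F. y F - kosz (\<lambda>_. 1) b F) = c"
          by (simp add: kosz_diff kosz_kosz y(2))
        ultimately show "\<exists>y\<in>gchains ?M' a (Suc j). kosz (\<lambda>_. 1) y = c" by blast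
      qed
    next
      assume ex: "gexact TYPE('k) j ?M' a"
      show "gexact TYPE('k) j ?M a"
        unfolding gexact_def
      proof (intro ballI impI)
        fix c :: "'n set \<Rightarrow> 'k" assume c: "c \<in> gchains ?M a j" "kosz (\<lambda>_. 1) c = (\<lambda>_. 0)"
        obtain b where b: "b \<in> gchains ?M a (Suc j)"
          "(\<lambda>F. c F - kosz (\<lambda>_. 1) b F) \<in> gchains ?M' a j"
          using reduce[OF c(1)] c(2) by metis
        moreover have "kosz (\<lambda>_. 1) (\<lambda>F. c F - kosz (\<lambda>_. 1) b F) = (\<lambda>_. 0)"
          by (simp add: kosz_diff kosz_kosz c(2))
        ultimately obtain y where y: "y \<in> gchains ?M' a (Suc j)"
          "kosz (\<lambda>_. 1) y = (\<lambda>F. c F - kosz (\<lambda>_. 1) b F)"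
          using ex unfolding gexact_def by blast
        have "(\<lambda>F. y F + b F) \<in> gchains ?M a (Suc j)"
          using y(1) b(1) gchains_mono[OF sub] by (intro gchains_add) blast+
        moreover have "kosz (\<lambda>_. 1) (\<lambda>F. y F + b F) = c"
          by (simp add: kosz_add y(2))
        ultimately show "\<exists>y\<in>gchains ?M a (Suc j). kosz (\<lambda>_. 1) y = c" by blast
      qed
    qed
    moreover have "a \<noteq> u + ind F" if "F \<subseteq> V" for F
    proof
      assume "a = u + ind F"
      then have "m0 = ind F" using cone(2) by simp
      then show False using cone(1,3) that by auto
    qed
    ultimately show ?thesis by blast
  next
    case (critical F0)
    have RF: "F = F0" if F: "F \<in> R a" for F
    proof -
      obtain m where m: "\<forall>p\<in>V. lookup m p = 0" "a = u + m + ind F"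
        using F by (auto simp: R_def)
      then have eq: "ind F0 = m + ind F" using critical(2) by (simp add: add.assoc)
      have "of_bool (p \<in> F0) = lookup m p + of_bool (p \<in> F)" for p
        using arg_cong[OF eq, of "\<lambda>v. lookup v p"] by (simp add: lookup_add)
      then have "p \<in> F \<longleftrightarrow> p \<in> F0" for p
        using m(1) critical(1) by (cases "p \<in> V") (force simp: of_bool_def split: if_splits)+
      then show ?thesis by blast
    qed
    have uniq: "F = F0" if "a = u + ind F" for F
    proof -
      have "ind F = ind F0" using that critical(2) by simp
      then have "of_bool (p \<in> F) = (of_bool (p \<in> F0) :: nat)" for p by (metis lookup_ind)
      then show ?thesis by (simp only: of_bool_eq_iff set_eq_iff) simp
    qed
    have mdeg: "mdeg a = d + card F0" using critical(2) deg(1) by simp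
    show ?thesis
    proof (cases "j = card F0")
      case False
      have ex: "gexact TYPE('k) j ?M' a" using False mdeg by (intro IH) simp
      have "gexact TYPE('k) j ?M a"
        unfolding gexact_def
      proof (intro ballI impI)
        fix c :: "'n set \<Rightarrow> 'k" assume c: "c \<in> gchains ?M a j" "kosz (\<lambda>_. 1) c = (\<lambda>_. 0)"
        have "c \<in> gchains ?M' a j"
          by (rule restr[OF c(1)]) (use RF c(1) False in \<open>auto simp: gchains_def\<close>)
        then show "\<exists>y\<in>gchains ?M a (Suc j). kosz (\<lambda>_. 1) y = c"
          using ex c(2) gchains_mono[OF sub] unfolding gexact_def by blast
      qed
      with ex uniq False show ?thesis by blast
    next
      case True
      \<comment> \<open>The single new cell, on its own not a cycle. Its boundary is an old cycle in
        homological degree \<open>j - 1\<close>, where the old complex is exact because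
        \<open>mdeg a = d + j\<close>; subtracting a filling turns it into the new class.\<close>
      define \<delta> :: "'n set \<Rightarrow> 'k" where "\<delta> = (\<lambda>F. of_bool (F = F0))"
      have \<delta>: "\<delta> \<in> gchains ?M a j"
        using True critical(2) by (force simp: gchains_def \<delta>_def upset_insert intro: exI[of _ 0])
      obtain c where c: "c \<in> gchains ?M a j" "kosz (\<lambda>_. 1) c = (\<lambda>_. 0)" "c F0 = (1 :: 'k)"
      proof (cases j)
        case 0
        show ?thesis
          by (rule that[OF \<delta>]) (use kosz_kchains_0 gchains_kchains[OF \<delta>] 0 in \<open>auto simp: \<delta>_def\<close>)
      next
        case (Suc i)
        have "kosz (\<lambda>_. 1) \<delta> \<in> gchains ?M' a i"
        proof (rule gchains_restrict)
          show "kosz (\<lambda>_. 1) \<delta> \<in> gchains ?M a i" using gchains_kosz \<delta> Suc by blast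
          fix F t assume nz: "kosz (\<lambda>_. 1) \<delta> F \<noteq> 0" and t: "a = t + ind F"
          from nz obtain p where p: "p \<notin> F" "\<delta> (insert p F) \<noteq> 0" by (rule kosz_nonzeroD)
          then have F0: "F0 = insert p F" by (auto simp: \<delta>_def)
          then have "t = u + single p 1"
            using critical(2) t p(1) by (simp add: ind_insert add.assoc[symmetric])
          then show "t \<in> ?M'" using V1[of p] F0 critical(1) by auto
        qed
        moreover have "gexact TYPE('k) i ?M' a" using Suc True mdeg by (intro IH) simp
        ultimately obtain y where y: "y \<in> gchains ?M' a (Suc i)" "kosz (\<lambda>_. 1) y = kosz (\<lambda>_. 1) \<delta>"
          using kosz_kosz unfolding gexact_def by blast
        have "F0 \<in> R a" using critical(2) unfolding R_def by (auto intro: exI[of _ 0])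
        then have "y F0 = 0" using vanish[OF y(1)] by blast
        moreover have "(\<lambda>F. \<delta> F - y F) \<in> gchains ?M a j"
          using \<delta> y(1) gchains_mono[OF sub] Suc by (intro gchains_diff) blast+
        ultimately show ?thesis
          by (intro that[of "\<lambda>F. \<delta> F - y F"]) (auto simp: kosz_diff y(2) \<delta>_def)
      qed
      \<comment> \<open>There is nothing to bound it: a chain of homological degree
        \<open>j + 1\<close> in this multidegree would have coefficient monomials of degree
        \<open>d - 1\<close>.\<close>
      have "\<not> gexact TYPE('k) j ?M a"
      proof
        assume "gexact TYPE('k) j ?M a"
        then obtain y :: "'n set \<Rightarrow> 'k" where y: "y \<in> gchains ?M a (Suc j)" "kosz (\<lambda>_. 1) y = c"
          using c unfolding gexact_def by blast
        have "y F = 0" for F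
        proof (rule ccontr)
          assume "y F \<noteq> 0"
          then obtain t where t: "t \<in> ?M" "a = t + ind F" "card F = Suc j"
            using y(1) by (auto simp: gchains_def)
          then have "d \<le> mdeg t" using deg by (auto simp: upset_def)
          with t mdeg True show False by simp
        qed
        then have "y = (\<lambda>_. 0)" by blast
        with y(2) c(3) show False by auto
      qed
      with critical True show ?thesis by blast
    qed
  next
    case none
    have "F \<notin> R a" for F
    proof
      assume "F \<in> R a"
      then obtain m where m: "\<forall>p\<in>V. lookup m p = 0" "a = u + (m + ind F)"
        by (auto simp: R_def add.assoc)
      have *: "lookup m q = 0 \<and> q \<notin> F" if "q \<notin> V" for q
        using none(1)[OF m(2) that] by (simp add: lookup_add)
      with m(1) have "m = 0" by (force simp: mon_eq_iff)
      with m(2) none(2)[of F] * show False by auto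
    qed
    then have "(gchains ?M a i :: ('n set \<Rightarrow> 'k) set) = gchains ?M' a i" for i
      by (intro equalityI subsetI restr) (use gchains_mono[OF sub] in auto)
    with none(2) show ?thesis unfolding gexact_def by auto
  qed
qed

section \<open>The lexicographic order and linear quotients\<close>

definition lexgt :: "'n::finite mon \<Rightarrow> 'n mon \<Rightarrow> bool" where
  "lexgt v u \<longleftrightarrow> (\<exists>p. lookup u p < lookup v p \<and>
     (\<forall>q. to_nat q < to_nat p \<longrightarrow> lookup v q = lookup u q))"

lemma lexgt_irrefl: "\<not> lexgt u u"
  by (auto simp: lexgt_def)

lemma lexgt_trans:
  assumes "lexgt w v" "lexgt v u"
  shows "lexgt w u"
proof -
  obtain p where p: "lookup v p < lookup w p"
    "\<And>q. to_nat q < to_nat p \<Longrightarrow> lookup w q = lookup v q"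
    using assms(1) by (auto simp: lexgt_def)
  obtain r where r: "lookup u r < lookup v r"
    "\<And>q. to_nat q < to_nat r \<Longrightarrow> lookup v q = lookup u q"
    using assms(2) by (auto simp: lexgt_def)
  consider "to_nat p < to_nat r" | "p = r" | "to_nat r < to_nat p"
    using to_nat_less_linear[of p r] by blast
  then show ?thesis
  proof cases
    case 1
    then show ?thesis using p r(2) unfolding lexgt_def
      by (intro exI[of _ p]) auto
  next
    case 2
    then show ?thesis using p r unfolding lexgt_def by (intro exI[of _ p]) auto
  next
    case 3
    then show ?thesis using p r unfolding lexgt_def by (intro exI[of _ r]) auto
  qed
qed

lemma lexgt_total:
  assumes "u \<noteq> v"
  shows "lexgt u v \<or> lexgt v u"
proof -
  let ?P = "\<lambda>p. lookup u p \<noteq> lookup v p"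
  obtain p0 where "?P p0" using assms by (auto simp: mon_eq_iff)
  then obtain p where p: "?P p" "\<And>q. ?P q \<Longrightarrow> to_nat p \<le> to_nat q"
    using ex_has_least_nat[of ?P p0 to_nat] by auto
  then have eq: "lookup u q = lookup v q" if "to_nat q < to_nat p" for q
    using that by fastforce
  from p(1) consider "lookup u p < lookup v p"
    | "lookup v p < lookup u p" by linarith
  then show ?thesis unfolding lexgt_def using eq by cases metis+
qed

text \<open>The variables generating the colon ideal of the lexicographically larger elements of \<open>G\<close>
  by \<open>u\<close>.\<close>

definition lset :: "'n::finite mon set \<Rightarrow> 'n mon \<Rightarrow> 'n set" where
  "lset G u = {f. \<exists>q. to_nat f < to_nat q \<and>
     (\<exists>v\<in>G. v + single q 1 = u + single f 1)}"

text \<open>Induction over the subsets \<open>H\<close> of \<open>G\<close> that contain with an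
  element all lexicographically larger ones. The sets \<open>lset G u\<close> refer to the whole
  \<open>G\<close>, but their witnesses are lexicographically larger than \<open>u\<close> and hence
  remain in \<open>H\<close>.\<close>

lemma gexact_linear_quotients:
  fixes G :: "'n::finite mon set"
  assumes fin: "finite G" and deg: "\<And>u. u \<in> G \<Longrightarrow> mdeg u = d"
    and ex: "\<And>u v i. u \<in> G \<Longrightarrow> v \<in> G \<Longrightarrow> lookup u i < lookup v i \<Longrightarrow>
      \<exists>j. lookup v j < lookup u j \<and>
        (\<exists>w\<in>G. w + single j 1 = u + single i 1)"
  shows "gexact TYPE('k::comm_ring_1) j (upset G) a \<longleftrightarrow>
    \<not> (\<exists>u\<in>G. \<exists>F\<subseteq>lset G u. card F = j \<and> a = u + ind F)"
proof -
  have "\<forall>j. gexact TYPE('k) j (upset H) a \<longleftrightarrow>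
      \<not> (\<exists>u\<in>H. \<exists>F\<subseteq>lset G u. card F = j \<and> a = u + ind F)"
    if "H \<subseteq> G" "\<And>u v. u \<in> H \<Longrightarrow> v \<in> G \<Longrightarrow> lexgt v u \<Longrightarrow> v \<in> H" for H
    using that
  proof (induction "card H" arbitrary: H)
    case 0
    then have "H = {}" using finite_subset[OF _ fin] by simp
    moreover have "gexact TYPE('k) j (upset {}) a" for j
      unfolding gexact_def
    proof (intro ballI impI)
      fix c :: "'n set \<Rightarrow> 'k" assume c: "c \<in> gchains (upset {}) a j"
      then have "c = (\<lambda>F. 0)" by (auto simp: gchains_def upset_def)
      then show "\<exists>y\<in>gchains (upset {}) a (Suc j). kosz (\<lambda>_. 1) y = c"
        by (intro bexI[of _ "\<lambda>F. 0"]) simp_all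
    qed
    ultimately show ?case by simp
  next
    case (Suc n)
    have finH: "finite H" using finite_subset[OF Suc.prems(1) fin] .
    have "H \<noteq> {}" using Suc.hyps(2) by auto
    \<comment> \<open>The lexicographically smallest element, so that \<open>H\<close> without it is
      again closed under larger elements of \<open>G\<close>.\<close>
    then obtain u where u: "u \<in> H" "\<And>v. v \<in> H \<Longrightarrow> v \<noteq> u \<Longrightarrow> \<not> lexgt u v"
      using Finite_Set.bex_min_element[OF finH, of "\<lambda>v u. lexgt u v"] lexgt_irrefl lexgt_trans
      unfolding asymp_on_def transp_on_def by blast
    define H' where "H' = H - {u}"
    have H: "H = insert u H'" "u \<notin> H'" "u \<in> G" "H' \<subseteq> G"
      using u(1) Suc.prems(1) by (auto simp: H'_def)
    have IH: "gexact TYPE('k) j (upset H') a \<longleftrightarrow>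
      \<not> (\<exists>u\<in>H'. \<exists>F\<subseteq>lset G u. card F = j \<and> a = u + ind F)" for j
    proof -
      have "n = card H'" using Suc.hyps(2) u(1) finH by (simp add: H'_def)
      moreover have "v \<in> H'" if "w \<in> H'" "v \<in> G" "lexgt v w" for w v
        using Suc.prems(2)[of w v] u(2)[of w] that by (auto simp: H'_def)
      ultimately show ?thesis using Suc.hyps(1)[of H'] H by blast
    qed
    have "gexact TYPE('k) j (upset (insert u H')) a \<longleftrightarrow>
      gexact TYPE('k) j (upset H') a \<and> \<not> (\<exists>F\<subseteq>lset G u. card F = j \<and> a = u + ind F)" for j
    proof (rule gexact_insert)
      fix p assume "p \<in> lset G u"
      then obtain q v where v: "to_nat p < to_nat q" "v \<in> G"
        "v + single q 1 = u + single p 1" by (auto simp: lset_def)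
      have lk: "lookup v r + of_bool (r = q) = lookup u r + of_bool (r = p)" for r
        using arg_cong[OF v(3), of "\<lambda>v. lookup v r"]
        by (cases "r = p"; cases "r = q") (simp_all add: lookup_add lookup_single)
      have "p \<noteq> q" using v(1) by auto
      have "lexgt v u" unfolding lexgt_def
      proof (intro exI conjI allI impI)
        show "lookup u p < lookup v p" using lk[of p] \<open>p \<noteq> q\<close> by simp
        fix r :: 'n assume "to_nat r < to_nat p"
        then have "r \<noteq> p" "r \<noteq> q" using v(1) by auto
        then show "lookup v r = lookup u r" using lk[of r] by simp
      qed
      then have "v \<in> H'" using Suc.prems(2)[OF u(1) v(2)] lexgt_irrefl H(1) by blast
      then show "u + single p 1 \<in> upset H'"
        unfolding v(3)[symmetric] by (intro upset_closed upset_superset)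
    next
      fix m assume "u + m \<in> upset H'"
      then obtain v w where v: "v \<in> H'" "u + m = v + w" by (auto simp: upset_def)
      then have "v \<noteq> u" "v \<in> H" "v \<in> G" using H by auto
      then have "lexgt v u" using u(2) lexgt_total by blast
      then obtain p where p: "lookup u p < lookup v p"
        "\<And>q. to_nat q < to_nat p \<Longrightarrow> lookup v q = lookup u q"
        by (auto simp: lexgt_def)
      \<comment> \<open>The exchange takes its unit from a coordinate where \<open>v\<close> is
        smaller than \<open>u\<close>. As \<open>u\<close> and \<open>v\<close> agree before
        \<open>p\<close>, such a coordinate comes after \<open>p\<close>, which puts
        \<open>p\<close> into \<open>lset G u\<close>.\<close>
      obtain q w' where q: "lookup v q < lookup u q" "w' \<in> G"
        "w' + single q 1 = u + single p 1"
        using ex[OF H(3) \<open>v \<in> G\<close> p(1)] by blast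
      have "q \<noteq> p" using p(1) q(1) by auto
      moreover have "\<not> to_nat q < to_nat p" using p(2)[of q] q(1) by auto
      ultimately have "to_nat p < to_nat q" using to_nat_less_linear[of p q] by blast
      then have "p \<in> lset G u" using q(2,3) by (auto simp: lset_def)
      moreover have "lookup m p \<noteq> 0"
        using arg_cong[OF v(2), of "\<lambda>v. lookup v p"] p(1) by (simp add: lookup_add)
      ultimately show "\<exists>p\<in>lset G u. lookup m p \<noteq> 0" by blast
    next
      fix j assume "mdeg a \<noteq> d + j"
      then show "gexact TYPE('k) j (upset H') a"
        unfolding IH using deg H(4) by (metis mdeg_add mdeg_ind subsetD)
    qed (use deg H in auto)
    then show ?case unfolding H(1) IH by auto
  qed
  from this[of G] show ?thesis by blast
qed

section \<open>Comparison of resolutions\<close>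

definition pm_filter :: "('a \<Rightarrow> bool) \<Rightarrow> ('a \<Rightarrow>\<^sub>0 'b::zero) \<Rightarrow> 'a \<Rightarrow>\<^sub>0 'b" where
  "pm_filter Q p = Abs_poly_mapping (\<lambda>t. if Q t then lookup p t else 0)"

lemma lookup_pm_filter [simp]:
  "lookup (pm_filter Q p) t = (if Q t then lookup p t else 0)"
proof -
  have "finite {t. (if Q t then lookup p t else 0) \<noteq> 0}"
    by (rule finite_subset[OF _ finite_keys[of p]]) (auto simp: in_keys_iff)
  then show ?thesis by (simp add: pm_filter_def)
qed

lemma pm_filter_zero [simp]: "pm_filter Q 0 = 0"
  by (simp add: poly_mapping_eq_iff fun_eq_iff)

definition hcomp :: "('n::finite, 'k::field) free_complex \<Rightarrow> nat \<Rightarrow> 'n mon \<Rightarrow> ('n, 'k) fvec \<Rightarrow> ('n, 'k) fvec" where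
  "hcomp P i a f = Abs_poly_mapping (\<lambda>b. pm_filter (\<lambda>t. t + gdeg P i b = a) (lookup f b))"

lemma lookup_hcomp:
  "lookup (hcomp P i a f) b = pm_filter (\<lambda>t. t + gdeg P i b = a) (lookup f b)"
proof -
  have "finite {b. pm_filter (\<lambda>t. t + gdeg P i b = a) (lookup f b) \<noteq> 0}"
    by (rule finite_subset[OF _ finite_keys[of f]])
       (auto simp: in_keys_iff poly_mapping_eq_iff fun_eq_iff)
  then show ?thesis by (simp add: hcomp_def)
qed

lemma fvec_eq_iff:
  "f = (g :: ('n, 'k::zero) fvec) \<longleftrightarrow>
    (\<forall>b t. lookup (lookup f b) t = lookup (lookup g b) t)"
  by (auto simp: poly_mapping_eq_iff fun_eq_iff)

lemma hcomp_add: "hcomp P i a (f + g) = hcomp P i a f + hcomp P i a g"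
  by (simp add: fvec_eq_iff lookup_hcomp lookup_add)

lemma hcomp_zero [simp]: "hcomp P i a 0 = 0"
  by (simp add: fvec_eq_iff lookup_hcomp)

lemma hcomp_strand: "f \<in> free_mod P i \<Longrightarrow> hcomp P i a f \<in> strand P i a"
  unfolding strand_def Int_iff free_mod_iff lookup_expand_mem lookup_hcomp
  by (intro conjI allI impI) (metis pm_filter_zero, simp split: if_splits)

lemma hcomp_of_strand:
  assumes "f \<in> strand P i c"
  shows "hcomp P i a f = (if a = c then f else 0)"
  using assms by (auto simp: fvec_eq_iff lookup_hcomp strand_def lookup_expand_mem)

lemma sum_hcomp:
  obtains A where "finite A" "f = (\<Sum>a\<in>A. hcomp P i a f)"
proof
  define A where "A = (\<Union>b\<in>keys f.
    (\<lambda>t. t + gdeg P i b) ` keys (lookup f b))"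
  show "finite A" by (simp add: A_def)
  show "f = (\<Sum>a\<in>A. hcomp P i a f)"
    unfolding fvec_eq_iff lookup_sum
  proof (intro allI)
    fix b t
    have "(\<Sum>a\<in>A. lookup (lookup (hcomp P i a f) b) t) =
        (\<Sum>a\<in>A. if t + gdeg P i b = a then lookup (lookup f b) t else 0)"
      by (simp add: lookup_hcomp)
    also have "\<dots> = (if t + gdeg P i b \<in> A then lookup (lookup f b) t else 0)"
      using \<open>finite A\<close> by (simp add: sum.delta)
    also have "\<dots> = lookup (lookup f b) t"
    proof (cases "lookup (lookup f b) t = 0")
      case False
      then have "b \<in> keys f" "t \<in> keys (lookup f b)"
        by (auto simp: in_keys_iff)
      then have "t + gdeg P i b \<in> A" by (auto simp: A_def)
      then show ?thesis by simp
    qed simp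
    finally show "lookup (lookup f b) t =
      (\<Sum>a\<in>A. lookup (lookup (hcomp P i a f) b) t)" by simp
  qed
qed

text \<open>Linearity is required on all vectors, since the maps are total functions; the degree
  condition concerns only vectors of the free module on the given generators.\<close>

definition graded_lin :: "('n::finite, 'k::field) free_complex \<Rightarrow> nat \<Rightarrow> ('n, 'k) free_complex \<Rightarrow> nat \<Rightarrow>
    (('n, 'k) fvec \<Rightarrow> ('n, 'k) fvec) \<Rightarrow> bool" where
  "graded_lin P n Q m u \<longleftrightarrow> (\<forall>f g. u (f + g) = u f + u g) \<and> (\<forall>s f. u (smult s f) = smult s (u f)) \<and>
     (\<forall>a. \<forall>f\<in>strand P n a. u f \<in> strand Q m a)"

lemma graded_linD:
  assumes "graded_lin P n Q m u"
  shows "u (f + g) = u f + u g" "u (smult s f) = smult s (u f)" "f \<in> strand P n a \<Longrightarrow> u f \<in> strand Q m a"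
    "u 0 = 0" "u (f - g) = u f - u g"
proof -
  show add: "u (f + g) = u f + u g" for f g using assms by (simp add: graded_lin_def)
  show "u (smult s f) = smult s (u f)" "f \<in> strand P n a \<Longrightarrow> u f \<in> strand Q m a"
    using assms by (auto simp: graded_lin_def)
  show "u 0 = 0" using add[of 0 0] by simp
  show "u (f - g) = u f - u g" using add[of "f - g" g] by (simp add: algebra_simps)
qed

lemma lin_ext_zero [simp]: "lin_ext D 0 = 0"
  by (simp add: lin_ext_def)

lemma lin_ext_smult: "lin_ext D (smult s f) = smult s (lin_ext D f)"
proof (induction f rule: fvec_induct)
  case (3 b t c)
  then show ?case by (simp add: trm_def smult_single lin_ext_single smult_simps)
qed (simp_all add: smult_simps lin_ext_add)

lemma graded_lin_lin_ext:
  assumes "\<And>b. b \<in> gens P n \<Longrightarrow> D b \<in> strand Q m (gdeg P n b)"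
  shows "graded_lin P n Q m (lin_ext D)"
  unfolding graded_lin_def
proof (intro conjI allI ballI)
  fix a f assume "f \<in> strand P n a"
  then show "lin_ext D f \<in> strand Q m a"
  proof (induction rule: strand_induct)
    case (trm b t c)
    then show ?case using strand_smult[OF assms[OF trm(1)], of t c]
      by (simp add: trm_def lin_ext_single)
  qed (auto simp: lin_ext_add strand_add)
qed (simp_all add: lin_ext_add lin_ext_smult)

text \<open>The scalar action \<open>sc\<close> of the target is a parameter because the lemma
  serves both for maps between free modules and for augmentations, where \<open>S\<close> acts on
  the field by constant coefficients.\<close>

lemma free_mod_eqI:
  fixes f :: "('n::finite, 'k::field) fvec"
  assumes f: "f \<in> free_mod P n"
    and u: "\<And>f g. u (f + g) = u f + (u g :: 'b::ab_group_add)" "\<And>s f. u (smult s f) = sc s (u f)"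
    and v: "\<And>f g. v (f + g) = v f + v g" "\<And>s f. v (smult s f) = sc s (v f)"
    and eq: "\<And>b. b \<in> gens P n \<Longrightarrow> u (single b 1) = v (single b 1)"
  shows "u f = v f"
  using f
proof (induction rule: free_mod_induct)
  case zero
  show ?case using u(1)[of 0 0] v(1)[of 0 0] by simp
next
  case (add x y)
  then show ?case by (simp add: u(1) v(1))
next
  case (trm b t c)
  show ?case unfolding trm_split[of b] u(2) v(2) eq[OF trm] ..
qed

lemma basis_strand: "b \<in> gens P n \<Longrightarrow> single b 1 \<in> strand P n (gdeg P n b)"
  using strand_trm[of b P n 0 1] by (simp add: trm_def)

text \<open>A graded resolution of the field, with exactness stated one multidegree at a time. In
  this form lifts can be chosen homogeneous, and exactness of the Koszul complex can be checked
  degree by degree.\<close>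

locale graded_res =
  fixes P :: "('n::finite, 'k::field) free_complex"
  assumes bd_lin: "graded_lin P (Suc i) P i (bd P i)"
    and aug_add: "aug P (f + g) = aug P f + aug P g"
    and aug_smult: "aug P (smult s f) = lookup s 0 * aug P f"
    and aug_strand: "f \<in> strand P 0 a \<Longrightarrow> a \<noteq> 0 \<Longrightarrow> aug P f = 0"
    and aug_one: "\<exists>f\<in>strand P 0 0. aug P f = 1"
    and aug_bd: "f \<in> free_mod P (Suc 0) \<Longrightarrow> aug P (bd P 0 f) = 0"
    and bd_bd: "f \<in> free_mod P (Suc (Suc i)) \<Longrightarrow> bd P i (bd P (Suc i) f) = 0"
    and exact_0: "f \<in> strand P 0 a \<Longrightarrow> aug P f = 0 \<Longrightarrow> \<exists>y\<in>strand P (Suc 0) a. bd P 0 y = f"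
    and exact_Suc: "f \<in> strand P (Suc i) a \<Longrightarrow> bd P i f = 0 \<Longrightarrow>
      \<exists>y\<in>strand P (Suc (Suc i)) a. bd P (Suc i) y = f"

lemma (in graded_res) aug_zero: "aug P 0 = 0"
  using aug_add[of 0 0] by (metis add_0 add_right_cancel)

lemma (in graded_res) aug_diff: "aug P (f - g) = aug P f - aug P g"
  using aug_add[of "f - g" g] by (simp add: algebra_simps)

lemma hcomp_bd:
  assumes lin: "graded_lin P (Suc i) P i (bd P i)" and "f \<in> free_mod P (Suc i)"
  shows "hcomp P i a (bd P i f) = bd P i (hcomp P (Suc i) a f)"
  using assms(2)
proof (induction rule: free_mod_induct)
  case (trm b t c)
  have *: "trm b t c \<in> strand P (Suc i) (t + gdeg P (Suc i) b)" using strand_trm[OF trm] .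
  show ?case unfolding hcomp_of_strand[OF *] hcomp_of_strand[OF graded_linD(3)[OF lin *]]
    using graded_linD(4)[OF lin] by simp
qed (simp_all add: graded_linD(1,4)[OF lin] hcomp_add)

text \<open>A preimage of a homogeneous vector may be replaced by its component of the same degree,
  because the differentials commute with \<open>hcomp\<close>.\<close>

lemma graded_res_resolution:
  assumes "is_resolution_of_field P"
  shows "graded_res P"
proof
  note r = assms[unfolded is_resolution_of_field_def]
  note r1 = r[THEN conjunct1] and r2 = r[THEN conjunct2, THEN conjunct1]
    and r3 = r[THEN conjunct2, THEN conjunct2, THEN conjunct1]
    and r' = r[THEN conjunct2, THEN conjunct2, THEN conjunct2]
  note hom_aug = r'[THEN conjunct1] and r5 = r'[THEN conjunct2, THEN conjunct1]
    and r6 = r'[THEN conjunct2, THEN conjunct2, THEN conjunct1]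
    and ex0 = r'[THEN conjunct2, THEN conjunct2, THEN conjunct2, THEN conjunct1]
    and exS = r'[THEN conjunct2, THEN conjunct2, THEN conjunct2, THEN conjunct2, rule_format]
  have hom: "module_hom smult smult (bd P i)" for i using r1 by simp
  have fm: "bd P i f \<in> free_mod P i" if "f \<in> free_mod P (Suc i)" for i f using r2 that by blast
  show lin: "graded_lin P (Suc i) P i (bd P i)" for i
    unfolding graded_lin_def
  proof (intro conjI allI ballI)
    fix a f assume "f \<in> strand P (Suc i) a"
    then show "bd P i f \<in> strand P i a" using r3 fm unfolding strand_def by blast
  qed (simp_all add: module_hom.add[OF hom] module_hom.scale[OF hom])
  show add: "aug P (f + g) = aug P f + aug P g" for f g by (rule module_hom.add[OF hom_aug])
  show "aug P (smult s f) = lookup s 0 * aug P f" for s f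
    by (rule module_hom.scale[OF hom_aug])
  show aug0: "aug P f = 0" if "f \<in> strand P 0 a" "a \<noteq> 0" for f a
    using r5 that unfolding strand_def by blast
  \<comment> \<open>The augmentation vanishes on all components of nonzero degree, so a preimage of
    \<open>1\<close> can be taken in degree \<open>0\<close>.\<close>
  have aug_comp: "aug P f = aug P (hcomp P 0 0 f)" if "f \<in> free_mod P 0" for f
    using that
  proof (induction rule: free_mod_induct)
    case (trm b t c)
    have *: "trm b t c \<in> strand P 0 (t + gdeg P 0 b)" using strand_trm[OF trm] .
    have "aug P 0 = 0" using add[of 0 0] by (metis add_0 add_right_cancel)
    then show ?case unfolding hcomp_of_strand[OF *] using aug0[OF *] by auto
  qed (simp_all add: add hcomp_add)
  show "\<exists>f\<in>strand P 0 0. aug P f = 1"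
  proof -
    have "1 \<in> aug P ` free_mod P 0" using r6 by simp
    then obtain f where "f \<in> free_mod P 0" "aug P f = 1" by auto
    then show ?thesis using aug_comp hcomp_strand by metis
  qed
  show "aug P (bd P 0 f) = 0" if "f \<in> free_mod P (Suc 0)" for f using ex0 that by blast
  show "bd P i (bd P (Suc i) f) = 0" if "f \<in> free_mod P (Suc (Suc i))" for i f using exS that by blast
  have comp: "\<exists>y\<in>strand P (Suc i) a. bd P i y = f"
    if "y \<in> free_mod P (Suc i)" "bd P i y = f" "f \<in> strand P i a" for y f i a
    using hcomp_bd[OF lin that(1), of a] hcomp_of_strand[OF that(3), of a] that(2) hcomp_strand[OF that(1)]
    by auto
  show "\<exists>y\<in>strand P (Suc 0) a. bd P 0 y = f" if "f \<in> strand P 0 a" "aug P f = 0" for f a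
  proof -
    have "f \<in> bd P 0 ` free_mod P (Suc 0)" using ex0 that strand_free_mod by blast
    then show ?thesis using comp that(1) by blast
  qed
  show "\<exists>y\<in>strand P (Suc (Suc i)) a. bd P (Suc i) y = f" if "f \<in> strand P (Suc i) a" "bd P i f = 0" for f i a
  proof -
    have "f \<in> bd P (Suc i) ` free_mod P (Suc (Suc i))" using exS that strand_free_mod by blast
    then show ?thesis using comp that(1) by blast
  qed
qed

section \<open>Comparison maps and homotopies\<close>

primrec cmp_basis :: "('n::finite, 'k::field) free_complex \<Rightarrow> ('n, 'k) free_complex \<Rightarrow> nat \<Rightarrow> nat \<Rightarrow> ('n, 'k) fvec" where
  "cmp_basis P Q 0 b = (SOME y. y \<in> strand Q 0 (gdeg P 0 b) \<and> aug Q y = aug P (single b 1))"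
| "cmp_basis P Q (Suc n) b = (SOME y. y \<in> strand Q (Suc n) (gdeg P (Suc n) b) \<and>
     bd Q n y = lin_ext (cmp_basis P Q n) (bd P n (single b 1)))"

definition cmp :: "('n::finite, 'k::field) free_complex \<Rightarrow> ('n, 'k) free_complex \<Rightarrow> nat \<Rightarrow> ('n, 'k) fvec \<Rightarrow> ('n, 'k) fvec" where
  "cmp P Q n = lin_ext (cmp_basis P Q n)"

lemma free_mod_bd:
  assumes "graded_lin P n Q m u" "f \<in> free_mod P n"
  shows "u f \<in> free_mod Q m"
  using assms(2)
proof (induction rule: free_mod_induct)
  case (trm b t c)
  show ?case by (rule strand_free_mod[OF graded_linD(3)[OF assms(1) strand_trm[OF trm]]])
next
  case zero
  show ?case using graded_linD(4)[OF assms(1)] by (simp add: free_mod_def)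
next
  case (add x y)
  then show ?case using graded_linD(1)[OF assms(1)] by (simp add: free_mod_add)
qed

text \<open>The element chosen in \<open>cmp_basis\<close> exists only because the level below is
  already a chain map: then the vector to be lifted is a cycle. Hence gradedness and compatibility
  with the differentials are proved in one induction.\<close>

lemma cmp_chain_map:
  assumes P: "graded_res P" and Q: "graded_res Q"
  shows "graded_lin P n Q n (cmp P Q n) \<and>
    (\<forall>f\<in>free_mod P n. case n of 0 \<Rightarrow> aug Q (cmp P Q 0 f) = aug P f
       | Suc m \<Rightarrow> bd Q m (cmp P Q n f) = cmp P Q m (bd P m f))"
proof (induction n)
  case 0
  have *: "cmp_basis P Q 0 b \<in> strand Q 0 (gdeg P 0 b) \<and>
      aug Q (cmp_basis P Q 0 b) = aug P (single b 1)" if b: "b \<in> gens P 0" for b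
  proof -
    have "\<exists>y. y \<in> strand Q 0 (gdeg P 0 b) \<and> aug Q y = aug P (single b 1)"
    proof (cases "gdeg P 0 b = 0")
      case True
      obtain f0 where f0: "f0 \<in> strand Q 0 0" "aug Q f0 = 1" using graded_res.aug_one[OF Q] by blast
      define c where "c = aug P (single b 1)"
      have "smult (single 0 c) f0 \<in> strand Q 0 (0 + 0)" by (rule strand_smult[OF f0(1)])
      moreover have "aug Q (smult (single 0 c) f0) = c"
        by (simp add: graded_res.aug_smult[OF Q] f0(2))
      ultimately show ?thesis using True by (auto simp: c_def)
    next
      case False
      then show ?thesis using graded_res.aug_strand[OF P basis_strand[OF b]] graded_res.aug_zero[OF Q]
        by (intro exI[of _ 0]) simp
    qed
    then show ?thesis unfolding cmp_basis.simps by (rule someI_ex)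
  qed
  have lin: "graded_lin P 0 Q 0 (cmp P Q 0)"
    unfolding cmp_def by (rule graded_lin_lin_ext) (use * in blast)
  moreover have "aug Q (cmp P Q 0 f) = aug P f" if "f \<in> free_mod P 0" for f
  proof (rule free_mod_eqI[OF that, where sc = "\<lambda>s c. lookup s 0 * c"])
    show "aug Q (cmp P Q 0 (single b 1)) = aug P (single b 1)" if "b \<in> gens P 0" for b
      using * that by (simp add: cmp_def lin_ext_single smult_simps)
  qed (simp_all add: graded_linD(1,2)[OF lin] graded_res.aug_add[OF P] graded_res.aug_add[OF Q]
      graded_res.aug_smult[OF P] graded_res.aug_smult[OF Q])
  ultimately show ?case by simp
next
  case (Suc n)
  note linn = Suc[THEN conjunct1]
  note bdP = graded_res.bd_lin[OF P] and bdQ = graded_res.bd_lin[OF Q]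
  have *: "cmp_basis P Q (Suc n) b \<in> strand Q (Suc n) (gdeg P (Suc n) b) \<and>
      bd Q n (cmp_basis P Q (Suc n) b) = cmp P Q n (bd P n (single b 1))"
    if b: "b \<in> gens P (Suc n)" for b
  proof -
    let ?e = "single b 1 :: ('a, 'b) fvec"
    let ?w = "cmp P Q n (bd P n ?e)"
    have e: "?e \<in> strand P (Suc n) (gdeg P (Suc n) b)" by (rule basis_strand[OF b])
    have be: "bd P n ?e \<in> strand P n (gdeg P (Suc n) b)" by (rule graded_linD(3)[OF bdP e])
    have w: "?w \<in> strand Q n (gdeg P (Suc n) b)" by (rule graded_linD(3)[OF linn be])
    have "\<exists>y\<in>strand Q (Suc n) (gdeg P (Suc n) b). bd Q n y = ?w"
    proof (cases n)
      case 0
      have "aug Q ?w = 0"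
        using Suc[THEN conjunct2] strand_free_mod[OF be] strand_free_mod[OF e] graded_res.aug_bd[OF P] 0 by simp
      then show ?thesis using graded_res.exact_0[OF Q] w 0 by simp
    next
      case m: (Suc m)
      have "bd Q m ?w = cmp P Q m (bd P m (bd P n ?e))"
        using Suc[THEN conjunct2] strand_free_mod[OF be] m by simp
      also have "\<dots> = 0"
        using graded_res.bd_bd[OF P] strand_free_mod[OF e] m by (simp add: cmp_def lin_ext_def)
      finally show ?thesis using graded_res.exact_Suc[OF Q] w m by simp
    qed
    then have "\<exists>y. y \<in> strand Q (Suc n) (gdeg P (Suc n) b) \<and> bd Q n y = ?w" by blast
    then show ?thesis unfolding cmp_basis.simps cmp_def by (rule someI_ex)
  qed
  have lin: "graded_lin P (Suc n) Q (Suc n) (cmp P Q (Suc n))"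
    unfolding cmp_def by (rule graded_lin_lin_ext) (use * in blast)
  moreover have "bd Q n (cmp P Q (Suc n) f) = cmp P Q n (bd P n f)" if "f \<in> free_mod P (Suc n)" for f
  proof (rule free_mod_eqI[OF that, where sc = smult])
    show "bd Q n (cmp P Q (Suc n) (single b 1)) = cmp P Q n (bd P n (single b 1))"
      if "b \<in> gens P (Suc n)" for b
    proof -
      have "cmp P Q (Suc n) (single b 1) = cmp_basis P Q (Suc n) b"
        unfolding cmp_def by (simp add: lin_ext_single smult_simps del: cmp_basis.simps)
      then show ?thesis using *[OF that] by simp
    qed
  qed (simp_all add: graded_linD(1,2)[OF lin] graded_linD(1,2)[OF linn] graded_linD(1,2)[OF bdP] graded_linD(1,2)[OF bdQ])
  ultimately show ?case by simp
qed

primrec htp_basis :: "(nat \<Rightarrow> ('n, 'k) fvec \<Rightarrow> ('n, 'k) fvec) \<Rightarrow> ('n::finite, 'k::field) free_complex \<Rightarrow> nat \<Rightarrow> nat \<Rightarrow> ('n, 'k) fvec" where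
  "htp_basis u P 0 b = (SOME y. y \<in> strand P (Suc 0) (gdeg P 0 b) \<and> bd P 0 y = u 0 (single b 1))"
| "htp_basis u P (Suc n) b = (SOME y. y \<in> strand P (Suc (Suc n)) (gdeg P (Suc n) b) \<and>
     bd P (Suc n) y = u (Suc n) (single b 1) - lin_ext (htp_basis u P n) (bd P n (single b 1)))"

definition htp :: "(nat \<Rightarrow> ('n, 'k) fvec \<Rightarrow> ('n, 'k) fvec) \<Rightarrow> ('n::finite, 'k::field) free_complex \<Rightarrow> nat \<Rightarrow> ('n, 'k) fvec \<Rightarrow> ('n, 'k) fvec" where
  "htp u P n = lin_ext (htp_basis u P n)"

text \<open>Inductively the part of \<open>u\<close> not yet explained by the lower homotopy is a
  cycle and lifts by exactness. At the bottom the lift comes from \<open>u 0\<close> being killed by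
  the augmentation.\<close>

lemma null_homotopic:
  assumes P: "graded_res P" and u: "\<And>n. graded_lin P n P n (u n)"
    and u0: "\<And>f. f \<in> free_mod P 0 \<Longrightarrow> aug P (u 0 f) = 0"
    and uS: "\<And>n f. f \<in> free_mod P (Suc n) \<Longrightarrow> bd P n (u (Suc n) f) = u n (bd P n f)"
  shows "graded_lin P n P (Suc n) (htp u P n) \<and>
    (\<forall>f\<in>free_mod P n. bd P n (htp u P n f) = u n f - (case n of 0 \<Rightarrow> 0 | Suc m \<Rightarrow> htp u P m (bd P m f)))"
proof (induction n)
  case 0
  note bdP = graded_res.bd_lin[OF P]
  have *: "htp_basis u P 0 b \<in> strand P (Suc 0) (gdeg P 0 b) \<and>
      bd P 0 (htp_basis u P 0 b) = u 0 (single b 1)" if b: "b \<in> gens P 0" for b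
  proof -
    note e = basis_strand[OF b]
    have "\<exists>y. y \<in> strand P (Suc 0) (gdeg P 0 b) \<and> bd P 0 y = u 0 (single b 1)"
      using graded_res.exact_0[OF P graded_linD(3)[OF u e] u0[OF strand_free_mod[OF e]]] by blast
    then show ?thesis unfolding htp_basis.simps by (rule someI_ex)
  qed
  have lin: "graded_lin P 0 P (Suc 0) (htp u P 0)"
    unfolding htp_def by (rule graded_lin_lin_ext) (use * in blast)
  moreover have "bd P 0 (htp u P 0 f) = u 0 f" if "f \<in> free_mod P 0" for f
  proof (rule free_mod_eqI[OF that, where sc = smult])
    show "bd P 0 (htp u P 0 (single b 1)) = u 0 (single b 1)" if "b \<in> gens P 0" for b
      using * that by (simp add: htp_def lin_ext_single smult_simps)
  qed (simp_all add: graded_linD(1,2)[OF lin] graded_linD(1,2)[OF u] graded_linD(1,2)[OF bdP])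
  ultimately show ?case by simp
next
  case (Suc n)
  note linn = Suc[THEN conjunct1] and IH = Suc[THEN conjunct2, rule_format]
  note bdP = graded_res.bd_lin[OF P]
  have *: "htp_basis u P (Suc n) b \<in> strand P (Suc (Suc n)) (gdeg P (Suc n) b) \<and>
      bd P (Suc n) (htp_basis u P (Suc n) b) =
      u (Suc n) (single b 1) - htp u P n (bd P n (single b 1))"
    if b: "b \<in> gens P (Suc n)" for b
  proof -
    let ?e = "single b 1 :: ('a, 'b) fvec"
    let ?w = "u (Suc n) ?e - htp u P n (bd P n ?e)"
    have e: "?e \<in> strand P (Suc n) (gdeg P (Suc n) b)" by (rule basis_strand[OF b])
    have be: "bd P n ?e \<in> strand P n (gdeg P (Suc n) b)" by (rule graded_linD(3)[OF bdP e])
    have w: "?w \<in> strand P (Suc n) (gdeg P (Suc n) b)"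
      by (intro strand_diff graded_linD(3)[OF u e] graded_linD(3)[OF linn be])
    have "(case n of 0 \<Rightarrow> 0 | Suc m \<Rightarrow> htp u P m (bd P m (bd P n ?e))) = 0"
      using graded_res.bd_bd[OF P] strand_free_mod[OF e] by (cases n) (simp_all add: htp_def)
    then have "bd P n ?w = 0"
      using IH[OF strand_free_mod[OF be]] uS[OF strand_free_mod[OF e]]
      by (simp add: graded_linD(5)[OF bdP])
    then have "\<exists>y. y \<in> strand P (Suc (Suc n)) (gdeg P (Suc n) b) \<and> bd P (Suc n) y = ?w"
      using graded_res.exact_Suc[OF P w] by blast
    then show ?thesis unfolding htp_basis.simps htp_def by (rule someI_ex)
  qed
  have lin: "graded_lin P (Suc n) P (Suc (Suc n)) (htp u P (Suc n))"
    unfolding htp_def by (rule graded_lin_lin_ext) (use * in blast)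
  moreover have "bd P (Suc n) (htp u P (Suc n) f) = u (Suc n) f - htp u P n (bd P n f)"
    if "f \<in> free_mod P (Suc n)" for f
  proof (rule free_mod_eqI[OF that, where sc = smult])
    show "bd P (Suc n) (htp u P (Suc n) (single b 1)) =
        u (Suc n) (single b 1) - htp u P n (bd P n (single b 1))"
      if "b \<in> gens P (Suc n)" for b
    proof -
      have "htp u P (Suc n) (single b 1) = htp_basis u P (Suc n) b"
        unfolding htp_def by (simp add: lin_ext_single smult_simps del: htp_basis.simps)
      then show ?thesis using *[OF that] by simp
    qed
  qed (simp_all add: graded_linD(1,2)[OF lin] graded_linD(1,2)[OF linn] graded_linD(1,2)[OF bdP]
      graded_linD(1,2)[OF u] smult_simps)
  ultimately show ?case by simp
qed

section \<open>Independence of Tor from the resolution\<close>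

definition is_ideal :: "'a::comm_ring_1 set \<Rightarrow> bool" where
  "is_ideal J \<longleftrightarrow> 0 \<in> J \<and> (\<forall>f\<in>J. \<forall>g\<in>J. f + g \<in> J) \<and> (\<forall>s. \<forall>f\<in>J. s * f \<in> J)"

definition coeffs_in :: "('n::finite, 'k::field) mpoly set \<Rightarrow> ('n, 'k) fvec \<Rightarrow> bool" where
  "coeffs_in J f \<longleftrightarrow> (\<forall>b. lookup f b \<in> J)"

lemma is_ideal_sum: "is_ideal J \<Longrightarrow> (\<And>x. x \<in> A \<Longrightarrow> g x \<in> J) \<Longrightarrow> sum g A \<in> J"
  by (rule sum_closed[where Q = "\<lambda>x. x \<in> J"]) (auto simp: is_ideal_def)

lemma is_ideal_diff: "is_ideal J \<Longrightarrow> f \<in> J \<Longrightarrow> g \<in> J \<Longrightarrow> f - g \<in> (J :: 'a::comm_ring_1 set)"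
  unfolding is_ideal_def by (metis (no_types, lifting) diff_conv_add_uminus mult_minus1)

lemma coeffs_in_add: "is_ideal J \<Longrightarrow> coeffs_in J f \<Longrightarrow> coeffs_in J g \<Longrightarrow> coeffs_in J (f + g)"
  by (simp add: coeffs_in_def lookup_add is_ideal_def)

text \<open>The image is a combination of images of basis elements with coefficients
  \<open>lookup f b\<close>, which lie in \<open>J\<close>. Thus chain maps and homotopies act on
  the complex tensored with \<open>J\<close>.\<close>

lemma coeffs_in_graded_lin:
  assumes u: "graded_lin P n Q m u" and J: "is_ideal J" and f: "coeffs_in J f"
  shows "coeffs_in J (u f)"
proof -
  have usum: "u (sum g A) = (\<Sum>x\<in>A. u (g x))" for g :: "nat \<Rightarrow> _" and A
    by (induction A rule: infinite_finite_induct) (simp_all add: graded_linD(1,4)[OF u])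
  have "f = (\<Sum>b\<in>keys f. smult (lookup f b) (single b 1))"
    using mpoly_expand[of f] by (simp add: smult_single)
  then have "u f = u (\<Sum>b\<in>keys f. smult (lookup f b) (single b 1))"
    by (rule arg_cong)
  then have "u f = (\<Sum>b\<in>keys f. smult (lookup f b) (u (single b 1)))"
    by (simp only: usum graded_linD(2)[OF u])
  moreover have "lookup f b * g \<in> J" for b g
    using J f by (metis coeffs_in_def is_ideal_def mult.commute)
  ultimately show ?thesis
    unfolding coeffs_in_def by (auto simp: lookup_sum intro!: is_ideal_sum[OF J])
qed

definition cycle :: "('n::finite, 'k::field) free_complex \<Rightarrow> nat \<Rightarrow> ('n, 'k) fvec \<Rightarrow> bool" where
  "cycle P i f \<longleftrightarrow> (case i of 0 \<Rightarrow> True | Suc m \<Rightarrow> bd P m f = 0)"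

definition tor_zero_at :: "('n::finite, 'k::field) free_complex \<Rightarrow> nat \<Rightarrow> ('n, 'k) mpoly set \<Rightarrow> 'n mon \<Rightarrow> bool" where
  "tor_zero_at P i J a \<longleftrightarrow> (\<forall>z\<in>strand P i a. coeffs_in J z \<longrightarrow> cycle P i z \<longrightarrow>
     (\<exists>y\<in>strand P (Suc i) a. coeffs_in J y \<and> bd P i y = z))"

text \<open>\<open>null_homotopic\<close> is applied to the identity minus the composite of the two
  comparison maps. The homotopy identity is stated on cycles, where its second term
  vanishes.\<close>

lemma comparison:
  assumes P: "graded_res P" and Q: "graded_res Q"
  obtains \<phi> \<psi> h where
    "\<And>n. graded_lin P n Q n (\<phi> n)" "\<And>n. graded_lin Q n P n (\<psi> n)" "\<And>n. graded_lin P n P (Suc n) (h n)"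
    "\<And>n f. f \<in> free_mod P (Suc n) \<Longrightarrow> bd Q n (\<phi> (Suc n) f) = \<phi> n (bd P n f)"
    "\<And>n f. f \<in> free_mod Q (Suc n) \<Longrightarrow> bd P n (\<psi> (Suc n) f) = \<psi> n (bd Q n f)"
    "\<And>n f. f \<in> free_mod P n \<Longrightarrow> cycle P n f \<Longrightarrow> bd P n (h n f) = f - \<psi> n (\<phi> n f)"
proof -
  let ?\<phi> = "cmp P Q" and ?\<psi> = "cmp Q P"
  define u where "u n f = f - ?\<psi> n (?\<phi> n f)" for n f
  have \<phi>: "graded_lin P n Q n (?\<phi> n)" and \<psi>: "graded_lin Q n P n (?\<psi> n)" for n
    using cmp_chain_map[OF P Q, of n] cmp_chain_map[OF Q P, of n] by auto
  have \<phi>S: "bd Q n (?\<phi> (Suc n) f) = ?\<phi> n (bd P n f)" if "f \<in> free_mod P (Suc n)" for n f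
    using cmp_chain_map[OF P Q, of "Suc n"] that by simp
  have \<psi>S: "bd P n (?\<psi> (Suc n) f) = ?\<psi> n (bd Q n f)" if "f \<in> free_mod Q (Suc n)" for n f
    using cmp_chain_map[OF Q P, of "Suc n"] that by simp
  have u: "graded_lin P n P n (u n)" for n
    unfolding graded_lin_def u_def
    by (auto simp: graded_linD(1,2)[OF \<phi>] graded_linD(1,2)[OF \<psi>] smult_simps
        intro!: strand_diff graded_linD(3)[OF \<phi>] graded_linD(3)[OF \<psi>])
  have u0: "aug P (u 0 f) = 0" if "f \<in> free_mod P 0" for f
    using cmp_chain_map[OF P Q, of 0] cmp_chain_map[OF Q P, of 0] that free_mod_bd[OF \<phi> that]
    by (simp add: u_def graded_res.aug_diff[OF P])
  have uS: "bd P n (u (Suc n) f) = u n (bd P n f)" if "f \<in> free_mod P (Suc n)" for n f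
    using \<phi>S[OF that] \<psi>S[OF free_mod_bd[OF \<phi> that]]
    by (simp add: u_def graded_linD(5)[OF graded_res.bd_lin[OF P]])
  note nh = null_homotopic[of P u, OF P u u0 uS]
  show ?thesis
  proof (rule that[of ?\<phi> ?\<psi> "htp u P"])
    show "graded_lin P n P (Suc n) (htp u P n)" for n using nh by blast
    show "bd P n (htp u P n f) = f - ?\<psi> n (?\<phi> n f)" if "f \<in> free_mod P n" "cycle P n f" for n f
    proof -
      have "htp u P m 0 = 0" for m by (simp add: htp_def lin_ext_def)
      then have "(case n of 0 \<Rightarrow> 0 | Suc m \<Rightarrow> htp u P m (bd P m f)) = 0"
        using that(2) by (simp add: cycle_def split: nat.splits)
      then show ?thesis using nh[of n] that(1) by (simp add: u_def)
    qed
  qed (use \<phi> \<psi> \<phi>S \<psi>S in auto)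
qed

lemma cycle_chain_map:
  assumes "\<And>n. graded_lin P n Q n (\<phi> n)"
    "\<And>n f. f \<in> free_mod P (Suc n) \<Longrightarrow> bd Q n (\<phi> (Suc n) f) = \<phi> n (bd P n f)"
    "f \<in> free_mod P i" "cycle P i f"
  shows "cycle Q i (\<phi> i f)"
  using assms(2-4) graded_linD(4)[OF assms(1)] by (auto simp: cycle_def split: nat.splits)

text \<open>If \<open>y\<close> fills \<open>\<phi> z\<close> in \<open>Q\<close>, then
  \<open>\<psi> y + h z\<close> fills \<open>z\<close> in \<open>P\<close>; all maps involved keep
  the degree and the coefficients in \<open>J\<close>.\<close>

lemma tor_zero_at_transfer:
  assumes P: "graded_res P" and Q: "graded_res Q" and J: "is_ideal J" and Z: "tor_zero_at Q i J a"
  shows "tor_zero_at P i J a"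
  unfolding tor_zero_at_def
proof (intro ballI impI)
  fix z assume z: "z \<in> strand P i a" "coeffs_in J z" "cycle P i z"
  obtain \<phi> \<psi> h where
    \<phi>: "\<And>n. graded_lin P n Q n (\<phi> n)" and \<psi>: "\<And>n. graded_lin Q n P n (\<psi> n)"
    and h: "\<And>n. graded_lin P n P (Suc n) (h n)"
    and \<phi>S: "\<And>n f. f \<in> free_mod P (Suc n) \<Longrightarrow> bd Q n (\<phi> (Suc n) f) = \<phi> n (bd P n f)"
    and \<psi>S: "\<And>n f. f \<in> free_mod Q (Suc n) \<Longrightarrow> bd P n (\<psi> (Suc n) f) = \<psi> n (bd Q n f)"
    and hb: "\<And>n f. f \<in> free_mod P n \<Longrightarrow> cycle P n f \<Longrightarrow> bd P n (h n f) = f - \<psi> n (\<phi> n f)"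
    using comparison[OF P Q] by metis
  note zf = strand_free_mod[OF z(1)]
  have "cycle Q i (\<phi> i z)" using cycle_chain_map[of P Q \<phi>, OF \<phi> \<phi>S zf z(3)] .
  then obtain y where y: "y \<in> strand Q (Suc i) a" "coeffs_in J y" "bd Q i y = \<phi> i z"
    using Z graded_linD(3)[OF \<phi> z(1)] coeffs_in_graded_lin[OF \<phi> J z(2)]
    unfolding tor_zero_at_def by blast
  let ?y = "\<psi> (Suc i) y + h i z"
  have "?y \<in> strand P (Suc i) a"
    by (intro strand_add graded_linD(3)[OF \<psi> y(1)] graded_linD(3)[OF h z(1)])
  moreover have "coeffs_in J ?y"
    by (intro coeffs_in_add J coeffs_in_graded_lin[OF \<psi> J y(2)] coeffs_in_graded_lin[OF h J z(2)])
  moreover have "bd P i ?y = z"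
    using \<psi>S[OF strand_free_mod[OF y(1)]] y(3) hb[OF zf z(3)]
    by (simp add: graded_linD(1)[OF graded_res.bd_lin[OF P]])
  ultimately show "\<exists>y\<in>strand P (Suc i) a. coeffs_in J y \<and> bd P i y = z" by blast
qed

lemma graded_res_res_field: "graded_res (res_field :: ('n::finite, 'k::field) free_complex)"
  by (rule graded_res_resolution[OF is_resolution_res_field])

lemma tor_nonzero_at_iff:
  assumes "0 \<in> J"
  shows "tor_nonzero_at i J a \<longleftrightarrow> \<not> tor_zero_at res_field i J a"
proof -
  have c: "(f \<in> free_mod res_field i \<and> (\<forall>b\<in>keys f. lookup f b \<in> J)) \<longleftrightarrow>
      f \<in> free_mod res_field i \<and> coeffs_in J f" for f i
    using assms by (auto simp: coeffs_in_def in_keys_iff)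
  have "tor_cycles i J \<inter> homog res_field i a = {z \<in> strand res_field i a. coeffs_in J z \<and> cycle res_field i z}"
    unfolding tor_cycles_def tor_chains_def c strand_def cycle_def by auto
  moreover have "tor_chains (Suc i) J \<inter> homog res_field (Suc i) a = {y \<in> strand res_field (Suc i) a. coeffs_in J y}"
    unfolding tor_chains_def c strand_def by auto
  ultimately show ?thesis unfolding tor_nonzero_at_def tor_zero_at_def by auto
qed

section \<open>Monomial ideals\<close>

definition pidl :: "'n mon set \<Rightarrow> ('n, 'k::field) mpoly set" where
  "pidl M = {p. keys p \<subseteq> M}"

lemma lookup_single_mult:
  fixes q :: "('n, 'k::field) mpoly"
  shows "lookup (single u c * q) (u + s) = c * lookup q s"
proof -
  have "single u c * q =
      (\<Sum>r\<in>keys q. single (u + r) (c * lookup q r))"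
    by (subst mpoly_expand[of q]) (simp add: sum_distrib_left mult_single)
  then have "lookup (single u c * q) (u + s) =
      (\<Sum>r\<in>keys q. if r = s then c * lookup q r else 0)"
    by (simp add: lookup_sum lookup_single when_def)
  also have "\<dots> = c * lookup q s"
    by (simp add: in_keys_iff)
  finally show ?thesis .
qed

lemma lookup_single_mult_nonzeroE:
  fixes q :: "('n, 'k::field) mpoly"
  assumes "lookup (single u c * q) t \<noteq> 0"
  obtains s where "t = u + s" "lookup q s \<noteq> 0"
proof -
  have "t \<in> keys (single u c * q)" using assms by (simp add: in_keys_iff)
  then have "t \<in> {x + y | x y. x \<in> keys (single u c) \<and> y \<in> keys q}"
    using keys_mult by fast
  then show ?thesis using that by (auto simp: in_keys_iff split: if_splits)
qed

lemma is_ideal_pidl: "is_ideal (pidl (upset A) :: ('n, 'k::field) mpoly set)"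
  unfolding is_ideal_def
proof (intro conjI ballI allI)
  fix f g :: "('n, 'k) mpoly" assume "f \<in> pidl (upset A)" "g \<in> pidl (upset A)"
  then show "f + g \<in> pidl (upset A)" using keys_add[of f g] by (auto simp: pidl_def)
next
  fix s f :: "('n, 'k) mpoly" assume f: "f \<in> pidl (upset A)"
  show "s * f \<in> pidl (upset A)"
    unfolding pidl_def
  proof (intro CollectI subsetI)
    fix t assume "t \<in> keys (s * f)"
    then have "t \<in> {x + y | x y. x \<in> keys s \<and> y \<in> keys f}"
      using keys_mult by fast
    then obtain x y where "t = y + x" "y \<in> upset A" using f by (auto simp: pidl_def add.commute)
    then show "t \<in> upset A" using upset_closed by blast
  qed
qed (simp add: pidl_def)

lemma ideal_gen_monom: "(ideal_gen (monom ` A) :: ('n, 'k::field) mpoly set) = pidl (upset A)"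
proof
  show "(ideal_gen (monom ` A) :: ('n, 'k) mpoly set) \<subseteq> pidl (upset A)"
    unfolding ideal_gen_def
  proof (rule module.span_minimal[OF module_mult])
    show "monom ` A \<subseteq> (pidl (upset A) :: ('n, 'k) mpoly set)"
      using upset_superset by (fastforce simp: pidl_def monom_def)
    show "module.subspace (*) (pidl (upset A) :: ('n, 'k) mpoly set)"
      using is_ideal_pidl[of A] unfolding module.subspace_def[OF module_mult] is_ideal_def by blast
  qed
  show "(pidl (upset A) :: ('n, 'k) mpoly set) \<subseteq> ideal_gen (monom ` A)"
  proof
    fix p :: "('n, 'k) mpoly" assume p: "p \<in> pidl (upset A)"
    have "single t (lookup p t) \<in> ideal_gen (monom ` A)"
      if t: "t \<in> keys p" for t
    proof -
      obtain u w where u: "t = u + w" "u \<in> A" using p t by (auto simp: pidl_def upset_def)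
      have "(monom u :: ('n, 'k) mpoly) \<in> ideal_gen (monom ` A)"
        unfolding ideal_gen_def using u(2) by (intro module.span_base[OF module_mult]) blast
      then have "single w (lookup p t) * monom u \<in> ideal_gen (monom ` A)"
        unfolding ideal_gen_def by (rule module.span_scale[OF module_mult])
      then show ?thesis by (simp add: u(1) monom_def mult_single add.commute)
    qed
    then have "(\<Sum>t\<in>keys p. single t (lookup p t)) \<in> ideal_gen (monom ` A)"
      unfolding ideal_gen_def by (rule module.span_sum[OF module_mult])
    then show "p \<in> ideal_gen (monom ` A)" by (simp only: mpoly_expand[symmetric])
  qed
qed

lemma monom_mem_pidl [simp]: "(monom u :: ('n, 'k::field) mpoly) \<in> pidl M \<longleftrightarrow> u \<in> M"
  by (simp add: pidl_def monom_def)

section \<open>The Koszul resolution\<close>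

definition xv :: "'n \<Rightarrow> ('n, 'k::field) mpoly" where
  "xv p = monom (single p 1)"

lemma lookup_sg_mult:
  "lookup (sg p G * q :: ('n::finite, 'k::field) mpoly) t = sg p G * lookup q t"
  by (cases "even (card {q \<in> G. to_nat q < to_nat p})") (simp_all add: sg_def)

text \<open>In multidegree \<open>a\<close> the coefficient of the basis element of \<open>F\<close>
  is a scalar times the monomial \<open>a - ind F\<close>. \<open>kcoeff\<close> reads off this
  scalar, with value \<open>0\<close> if \<open>ind F\<close> does not divide \<open>a\<close>, and
  \<open>klift\<close> restores the monomial; they translate between polynomial and scalar
  chains.\<close>

definition kcoeff :: "'n::finite mon \<Rightarrow> ('n set \<Rightarrow> ('n, 'k::field) mpoly) \<Rightarrow> 'n set \<Rightarrow> 'k" where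
  "kcoeff a z F = (if \<exists>t. a = t + ind F then lookup (z F) (a - ind F) else 0)"

definition klift :: "'n::finite mon \<Rightarrow> ('n set \<Rightarrow> 'k::field) \<Rightarrow> 'n set \<Rightarrow> ('n, 'k) mpoly" where
  "klift a c F = single (a - ind F) (c F)"

lemma kcoeff_add_ind: "kcoeff (t + ind F) z F = lookup (z F) t"
  by (auto simp: kcoeff_def)

text \<open>Multiplication by a variable shifts the monomial and keeps the scalar. Since the
  monomial is determined by \<open>a\<close> and the cell, the variables act as
  \<open>1\<close>.\<close>

lemma kosz_kcoeff: "kosz (\<lambda>_. 1) (kcoeff a z) = kcoeff a (kosz xv z)"
proof
  fix G
  show "kosz (\<lambda>_. 1) (kcoeff a z) G = kcoeff a (kosz xv z) G"
  proof (cases "\<exists>t. a = t + ind G")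
    case True
    then obtain t where t: "a = t + ind G" ..
    have "kcoeff a z (insert p G) = lookup (xv p * z (insert p G)) t" if p: "p \<notin> G" for p
    proof (cases "lookup t p = 0")
      case True
      have "lookup (xv p * z (insert p G)) t = 0"
      proof (rule ccontr)
        assume "\<not> ?thesis"
        then obtain s where "t = single p 1 + s"
          unfolding xv_def monom_def by (rule lookup_single_mult_nonzeroE)
        with True show False by (simp add: lookup_add)
      qed
      moreover have "a \<noteq> s + ind (insert p G)" for s
      proof
        assume "a = s + ind (insert p G)"
        then have "t = s + single p 1" using t p by (simp add: ind_insert add.assoc[symmetric])
        with True show False by (simp add: lookup_add)
      qed
      ultimately show ?thesis by (auto simp: kcoeff_def)
    next
      case False
      then obtain s where s: "t = single p 1 + s" by (rule mon_split_single)
      have "a = s + ind (insert p G)" using t s p by (simp add: ind_insert ac_simps)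
      then show ?thesis unfolding s xv_def monom_def lookup_single_mult by (simp add: kcoeff_add_ind)
    qed
    then show ?thesis
      by (simp add: t kcoeff_add_ind kosz_def lookup_sum lookup_sg_mult mult.assoc)
  next
    case False
    have "kcoeff a z (insert p G) = 0" if p: "p \<notin> G" for p
    proof -
      have "a \<noteq> s + ind (insert p G)" for s
      proof
        assume "a = s + ind (insert p G)"
        then have "a = (s + single p 1) + ind G" using p by (simp add: ind_insert add.assoc)
        with False show False by blast
      qed
      then show ?thesis by (auto simp: kcoeff_def)
    qed
    then show ?thesis using False by (simp add: kosz_def kcoeff_def)
  qed
qed

definition khomog :: "'n::finite mon \<Rightarrow> ('n set \<Rightarrow> ('n, 'k::field) mpoly) \<Rightarrow> bool" where
  "khomog a z \<longleftrightarrow> (\<forall>F t. lookup (z F) t \<noteq> 0 \<longrightarrow> t + ind F = a)"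

lemma khomog_kosz:
  assumes "khomog a z"
  shows "khomog a (kosz xv z)"
  unfolding khomog_def
proof (intro allI impI)
  fix G t assume "lookup (kosz xv z G) t \<noteq> 0"
  then obtain p where p: "p \<notin> G" "lookup (xv p * z (insert p G)) t \<noteq> 0"
    unfolding kosz_def lookup_sum mult.assoc lookup_sg_mult
    by (metis (no_types, lifting) ComplD mult_zero_right sum.neutral)
  from p(2) obtain s where s: "t = single p 1 + s" "lookup (z (insert p G)) s \<noteq> 0"
    unfolding xv_def monom_def by (rule lookup_single_mult_nonzeroE)
  then have "s + ind (insert p G) = a" using assms by (simp add: khomog_def)
  with p(1) s(1) show "t + ind G = a" by (simp add: ind_insert ac_simps)
qed

lemma klift_kcoeff:
  assumes "khomog a z"
  shows "klift a (kcoeff a z) = z"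
proof
  fix F show "klift a (kcoeff a z) F = z F"
  proof (rule poly_mapping_eqI)
    fix t
    show "lookup (klift a (kcoeff a z) F) t = lookup (z F) t"
    proof (cases "t + ind F = a")
      case True
      show ?thesis unfolding True[symmetric] by (simp add: klift_def kcoeff_add_ind)
    next
      case False
      then have "lookup (z F) t = 0" using assms by (auto simp: khomog_def)
      moreover have "lookup (klift a (kcoeff a z) F) t = 0"
        using False by (auto simp: klift_def kcoeff_def lookup_single when_def)
      ultimately show ?thesis by simp
    qed
  qed
qed

lemma khomog_klift:
  assumes "c \<in> gchains M a j"
  shows "khomog a (klift a c)"
  unfolding khomog_def
proof (intro allI impI)
  fix F t assume "lookup (klift a c F) t \<noteq> 0"
  then have t: "t = a - ind F" "c F \<noteq> 0" by (auto simp: klift_def lookup_single when_def split: if_splits)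
  then obtain s where "a = s + ind F" using assms by (auto simp: gchains_def)
  with t show "t + ind F = a" by simp
qed

lemma kcoeff_klift:
  assumes "c \<in> gchains M a j"
  shows "kcoeff a (klift a c) = c"
proof
  fix F show "kcoeff a (klift a c) F = c F"
  proof (cases "c F = 0")
    case False
    then obtain t where "a = t + ind F" using assms by (auto simp: gchains_def)
    then show ?thesis by (simp add: kcoeff_add_ind klift_def)
  qed (simp add: kcoeff_def klift_def)
qed

lemma kosz_klift:
  assumes "c \<in> gchains M a j"
  shows "kosz xv (klift a c) = klift a (kosz (\<lambda>_. 1) c)"
  using klift_kcoeff[OF khomog_kosz[OF khomog_klift[OF assms]]]
  by (simp add: kosz_kcoeff[symmetric] kcoeff_klift[OF assms])

lemma kcoeff_gchains:
  assumes "z \<in> kchains j" "\<And>F. z F \<in> pidl M"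
  shows "kcoeff a z \<in> gchains M a j"
  unfolding gchains_def
proof (intro CollectI allI impI)
  fix F assume nz: "kcoeff a z F \<noteq> 0"
  then obtain t where t: "a = t + ind F" by (auto simp: kcoeff_def split: if_splits)
  then have l: "lookup (z F) t \<noteq> 0" using nz by (simp add: kcoeff_add_ind)
  then have "z F \<noteq> 0" by auto
  then have "card F = j" using assms(1) by (simp add: kchains_def)
  moreover have "t \<in> M" using l assms(2)[of F] by (auto simp: pidl_def in_keys_iff)
  ultimately show "card F = j \<and> (\<exists>t\<in>M. a = t + ind F)" using t by blast
qed

lemma klift_pidl:
  assumes "c \<in> gchains M a j"
  shows "klift a c F \<in> pidl M"
proof (cases "c F = 0")
  case False
  then obtain t where "t \<in> M" "a = t + ind F" using assms by (auto simp: gchains_def)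
  then show ?thesis by (simp add: klift_def pidl_def)
qed (simp add: klift_def pidl_def)

lemma klift_kchains:
  assumes "c \<in> gchains M a j"
  shows "klift a c \<in> kchains j"
  unfolding kchains_def
proof (intro CollectI allI impI)
  fix F assume "klift a c F \<noteq> 0"
  then have "c F \<noteq> 0" by (cases "c F = 0") (simp_all add: klift_def)
  then show "card F = j" using assms by (simp add: gchains_def)
qed

lemma klift_zero [simp]: "klift a (\<lambda>_. 0) = (\<lambda>_. 0)"
  by (simp add: klift_def fun_eq_iff)

lemma kcoeff_zero [simp]: "kcoeff a (\<lambda>_. 0) = (\<lambda>_. 0)"
  by (simp add: kcoeff_def fun_eq_iff)

definition kexact :: "nat \<Rightarrow> ('n::finite, 'k::field) mpoly set \<Rightarrow> bool" where
  "kexact j J \<longleftrightarrow> (\<forall>z\<in>kchains j. (\<forall>F. z F \<in> J) \<longrightarrow> kosz xv z = (\<lambda>_. 0) \<longrightarrow>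
     (\<exists>y\<in>kchains (Suc j). (\<forall>F. y F \<in> J) \<and> kosz xv y = z))"

lemma kosz_sum: "kosz x (\<lambda>F. \<Sum>a\<in>A. y a F) = (\<lambda>F. \<Sum>a\<in>A. kosz x (y a) F)"
  by (induction A rule: infinite_finite_induct) (simp_all add: kosz_add)

lemma kdecompose:
  fixes z :: "'n::finite set \<Rightarrow> ('n, 'k::field) mpoly"
  obtains A where "finite A" "z = (\<lambda>F. \<Sum>a\<in>A. klift a (kcoeff a z) F)"
proof
  define A where "A = (\<Union>F\<in>UNIV. (\<lambda>t. t + ind F) ` keys (z F))"
  show fin: "finite A" by (simp add: A_def)
  show "z = (\<lambda>F. \<Sum>a\<in>A. klift a (kcoeff a z) F)"
  proof (intro ext poly_mapping_eqI)
    fix F t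
    have "lookup (klift a (kcoeff a z) F) t =
        (if a = t + ind F then lookup (z F) t else 0)" for a
      by (auto simp: klift_def lookup_single when_def kcoeff_add_ind) (auto simp: kcoeff_def)
    then have "lookup (\<Sum>a\<in>A. klift a (kcoeff a z) F) t =
        (if t + ind F \<in> A then lookup (z F) t else 0)"
      using fin by (simp add: lookup_sum)
    moreover have "t + ind F \<in> A" if "lookup (z F) t \<noteq> 0"
    proof -
      have "t \<in> keys (z F)" using that by (simp add: in_keys_iff)
      then show ?thesis unfolding A_def by blast
    qed
    ultimately show "lookup (z F) t = lookup (\<Sum>a\<in>A. klift a (kcoeff a z) F) t"
      by auto
  qed
qed

lemma pidl_sum:
  fixes g :: "'b \<Rightarrow> ('n, 'k::field) mpoly"
  assumes "\<And>a. a \<in> A \<Longrightarrow> g a \<in> pidl M"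
  shows "sum g A \<in> pidl M"
proof (rule sum_closed[where Q = "\<lambda>p. p \<in> pidl M"])
  fix x y :: "('n, 'k) mpoly" assume "x \<in> pidl M" "y \<in> pidl M"
  then show "x + y \<in> pidl M" using keys_add[of x y] by (auto simp: pidl_def)
qed (use assms in \<open>auto simp: pidl_def\<close>)

text \<open>A chain has finitely many nonzero homogeneous parts and the differential preserves
  multidegree, so fillings can be found part by part and added.\<close>

lemma kexact_iff:
  "kexact j (pidl M :: ('n::finite, 'k::field) mpoly set) \<longleftrightarrow> (\<forall>a. gexact TYPE('k) j M a)"
proof
  assume ex: "\<forall>a. gexact TYPE('k) j M a"
  show "kexact j (pidl M :: ('n, 'k) mpoly set)"
    unfolding kexact_def
  proof (intro ballI impI)
    fix z :: "'n set \<Rightarrow> ('n, 'k) mpoly"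
    assume z: "z \<in> kchains j" "\<forall>F. z F \<in> pidl M" "kosz xv z = (\<lambda>_. 0)"
    obtain A where A: "finite A" "z = (\<lambda>F. \<Sum>a\<in>A. klift a (kcoeff a z) F)" by (rule kdecompose)
    have "\<exists>y. y \<in> gchains M a (Suc j) \<and> kosz (\<lambda>_. 1) y = kcoeff a z" for a
    proof -
      have "kcoeff a z \<in> gchains M a j" using z by (intro kcoeff_gchains) auto
      moreover have "kosz (\<lambda>_. 1) (kcoeff a z) = (\<lambda>_. 0)" by (simp add: kosz_kcoeff z(3))
      ultimately show ?thesis using ex unfolding gexact_def by blast
    qed
    then obtain y where y: "\<And>a. y a \<in> gchains M a (Suc j)" "\<And>a. kosz (\<lambda>_. 1) (y a) = kcoeff a z"
      by metis
    let ?y = "\<lambda>F. \<Sum>a\<in>A. klift a (y a) F"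
    have Y1: "?y \<in> kchains (Suc j)"
      unfolding kchains_def
    proof (intro CollectI allI impI)
      fix F assume "?y F \<noteq> 0"
      then obtain a where "klift a (y a) F \<noteq> 0" by (meson sum.neutral)
      then show "card F = Suc j" using klift_kchains[OF y(1)] by (auto simp: kchains_def)
    qed
    have Y2: "\<forall>F. ?y F \<in> pidl M" by (rule allI, rule pidl_sum) (rule klift_pidl[OF y(1)])
    have Y3: "kosz xv ?y = z"
      by (subst A(2)) (simp add: kosz_sum kosz_klift[OF y(1)] y(2))
    show "\<exists>y\<in>kchains (Suc j). (\<forall>F. y F \<in> pidl M) \<and> kosz xv y = z"
    proof (rule bexI[of _ ?y])
      show "(\<forall>F. ?y F \<in> pidl M) \<and> kosz xv ?y = z" using Y2 Y3 by (rule conjI)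
    qed (rule Y1)
  qed
next
  assume ex: "kexact j (pidl M :: ('n, 'k) mpoly set)"
  show "\<forall>a. gexact TYPE('k) j M a"
    unfolding gexact_def
  proof (intro allI ballI impI)
    fix a and c :: "'n set \<Rightarrow> 'k" assume c: "c \<in> gchains M a j" "kosz (\<lambda>_. 1) c = (\<lambda>_. 0)"
    have "kosz xv (klift a c) = (\<lambda>_. 0)" by (simp add: kosz_klift[OF c(1)] c(2))
    then obtain y :: "'n set \<Rightarrow> ('n, 'k) mpoly" where y: "y \<in> kchains (Suc j)" "\<And>F. y F \<in> pidl M" "kosz xv y = klift a c"
      using ex klift_kchains[OF c(1)] klift_pidl[OF c(1)] unfolding kexact_def by meson
    have "kosz (\<lambda>_. 1) (kcoeff a y) = c" by (simp add: kosz_kcoeff y(3) kcoeff_klift[OF c(1)])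
    then show "\<exists>y\<in>gchains M a (Suc j). kosz (\<lambda>_. 1) y = c"
      using kcoeff_gchains[OF y(1,2)] by blast
  qed
qed

section \<open>The Koszul complex as a free resolution\<close>

definition kdec :: "('n::finite, 'k::field) fvec \<Rightarrow> 'n set \<Rightarrow> ('n, 'k) mpoly" where
  "kdec f F = lookup f (to_nat F)"

definition kenc :: "('n::finite set \<Rightarrow> ('n, 'k::field) mpoly) \<Rightarrow> ('n, 'k) fvec" where
  "kenc c = (\<Sum>F\<in>UNIV. single (to_nat F) (c F))"

text \<open>Basis elements of a \<open>free_complex\<close> are natural numbers, so the cell
  \<open>F\<close> appears as \<open>to_nat F\<close>. The homological degree is the cardinality of
  \<open>F\<close>, and one formula gives the differential in every degree.\<close>

definition koszul_res :: "('n::finite, 'k::field) free_complex" where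
  "koszul_res = \<lparr>gens = (\<lambda>i. to_nat ` {F :: 'n set. card F = i}), gdeg = (\<lambda>i b. ind (from_nat b)),
     bd = (\<lambda>i f. kenc (kosz xv (kdec f))), aug = (\<lambda>f. lookup (kdec f {}) 0)\<rparr>"

lemma koszul_res_simps [simp]:
  "gens (koszul_res :: ('n::finite, 'k::field) free_complex) i = to_nat ` {F :: 'n set. card F = i}"
  "gdeg (koszul_res :: ('n::finite, 'k::field) free_complex) i b = ind (from_nat b)"
  "bd (koszul_res :: ('n::finite, 'k::field) free_complex) i f = kenc (kosz xv (kdec f))"
  "aug (koszul_res :: ('n::finite, 'k::field) free_complex) f = lookup (kdec f {}) 0"
  by (simp_all add: koszul_res_def)

lemma lookup_kenc_to_nat: "lookup (kenc c) (to_nat F) = c F"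
  by (simp add: kenc_def lookup_sum lookup_single when_def)

lemma lookup_kenc_other: "b \<notin> range (to_nat :: 'n set \<Rightarrow> nat) \<Longrightarrow> lookup (kenc (c :: 'n::finite set \<Rightarrow> _)) b = 0"
  by (auto simp: kenc_def lookup_sum lookup_single when_def intro!: sum.neutral)

lemma kdec_kenc [simp]: "kdec (kenc c) = c"
  by (simp add: kdec_def lookup_kenc_to_nat fun_eq_iff)

lemma kenc_kdec:
  assumes "f \<in> free_mod koszul_res i"
  shows "kenc (kdec f) = f"
proof (rule poly_mapping_eqI)
  fix b show "lookup (kenc (kdec f)) b = lookup f b"
  proof (cases "b \<in> range (to_nat :: 'a set \<Rightarrow> nat)")
    case True
    then show ?thesis by (auto simp: lookup_kenc_to_nat kdec_def)
  next
    case False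
    then have "lookup f b = 0" using assms by (auto simp: free_mod_iff)
    then show ?thesis using False by (simp add: lookup_kenc_other)
  qed
qed

lemma kdec_kchains: "f \<in> free_mod koszul_res i \<Longrightarrow> kdec f \<in> kchains i"
  by (auto simp: free_mod_iff kchains_def kdec_def)

lemma kenc_free_mod:
  fixes c :: "'n::finite set \<Rightarrow> ('n, 'k::field) mpoly"
  assumes "c \<in> kchains i"
  shows "kenc c \<in> free_mod koszul_res i"
  unfolding free_mod_iff
proof (intro allI impI)
  fix b assume b: "lookup (kenc c) b \<noteq> 0"
  then obtain F :: "'n set" where F: "b = to_nat F" using lookup_kenc_other by blast
  then have "card F = i" using b assms by (simp add: lookup_kenc_to_nat kchains_def)
  then have "F \<in> {F. card F = i}" by simp
  then show "b \<in> gens (koszul_res :: ('n, 'k) free_complex) i"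
    unfolding koszul_res_simps F by (rule imageI)
qed

lemma strand_koszul_iff:
  "f \<in> strand koszul_res i a \<longleftrightarrow> f \<in> free_mod koszul_res i \<and> khomog a (kdec f)"
proof -
  have "f \<in> homog koszul_res i a \<longleftrightarrow> khomog a (kdec f)" if f: "f \<in> free_mod koszul_res i"
  proof -
    have "b \<in> range (to_nat :: 'a set \<Rightarrow> nat)" if "lookup (lookup f b) t \<noteq> 0" for b t
    proof -
      have "lookup f b \<noteq> 0" using that by auto
      then show ?thesis using f by (auto simp: free_mod_iff)
    qed
    then show ?thesis unfolding lookup_expand_mem khomog_def kdec_def by fastforce
  qed
  then show ?thesis by (auto simp: strand_def)
qed

lemma kenc_add: "kenc (\<lambda>F. c F + d F) = kenc c + kenc d"
  by (simp add: kenc_def single_add sum.distrib)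

lemma kenc_smult: "kenc (\<lambda>F. s * c F) = smult s (kenc c)"
proof -
  have "smult s (sum g A) = (\<Sum>x\<in>A. smult s (g x))" for g :: "'a set \<Rightarrow> _" and A
    by (induction A rule: infinite_finite_induct) (simp_all add: smult_simps)
  then show ?thesis by (simp add: kenc_def smult_single)
qed

lemma kdec_add: "kdec (f + g) = (\<lambda>F. kdec f F + kdec g F)"
  by (simp add: kdec_def lookup_add fun_eq_iff)

lemma kdec_smult: "kdec (smult s f) = (\<lambda>F. s * kdec f F)"
  by (simp add: kdec_def fun_eq_iff)

lemma kenc_zero [simp]: "kenc (\<lambda>_. 0) = 0"
  by (simp add: kenc_def)

lemma coeffs_in_kdec: "coeffs_in J f \<Longrightarrow> kdec f F \<in> J"
  by (simp add: coeffs_in_def kdec_def)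

lemma coeffs_in_kenc: "(\<And>F. c F \<in> J) \<Longrightarrow> 0 \<in> J \<Longrightarrow> coeffs_in J (kenc c)"
  for c :: "'n::finite set \<Rightarrow> _"
  unfolding coeffs_in_def by (metis lookup_kenc_to_nat lookup_kenc_other rangeE)

lemma cycle_koszul:
  assumes "f \<in> free_mod koszul_res i"
  shows "cycle koszul_res i f \<longleftrightarrow> kosz xv (kdec f) = (\<lambda>_. 0)"
proof (cases i)
  case 0
  then show ?thesis using kosz_kchains_0 kdec_kchains[OF assms] by (auto simp: cycle_def)
next
  case (Suc m)
  then show ?thesis by (auto simp: cycle_def) (metis kdec_kenc lookup_zero kdec_def ext)
qed

lemma tor_zero_at_koszul:
  fixes M :: "'n::finite mon set"
  shows "tor_zero_at koszul_res i (pidl M :: ('n, 'k::field) mpoly set) a \<longleftrightarrow> gexact TYPE('k) i M a"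
proof
  assume ex: "gexact TYPE('k) i M a"
  show "tor_zero_at koszul_res i (pidl M :: ('n, 'k) mpoly set) a"
    unfolding tor_zero_at_def
  proof (intro ballI impI)
    fix f :: "('n, 'k) fvec"
    assume f: "f \<in> strand koszul_res i a" "coeffs_in (pidl M) f" "cycle koszul_res i f"
    have fm: "f \<in> free_mod koszul_res i" and hom: "khomog a (kdec f)" using f(1) by (auto simp: strand_koszul_iff)
    let ?c = "kcoeff a (kdec f)"
    have "?c \<in> gchains M a i" using kdec_kchains[OF fm] coeffs_in_kdec[OF f(2)] by (rule kcoeff_gchains)
    moreover have "kosz (\<lambda>_. 1) ?c = (\<lambda>_. 0)"
      using f(3) cycle_koszul[OF fm] by (simp add: kosz_kcoeff)
    ultimately obtain y where y: "y \<in> gchains M a (Suc i)" "kosz (\<lambda>_. 1) y = ?c"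
      using ex unfolding gexact_def by blast
    have "kenc (klift a y) \<in> strand koszul_res (Suc i) a"
      using kenc_free_mod[OF klift_kchains[OF y(1)]] khomog_klift[OF y(1)] by (simp add: strand_koszul_iff)
    moreover have "coeffs_in (pidl M) (kenc (klift a y))"
      by (rule coeffs_in_kenc[OF klift_pidl[OF y(1)]]) (simp add: pidl_def)
    moreover have "bd koszul_res i (kenc (klift a y)) = f"
      by (simp add: kosz_klift[OF y(1)] y(2) klift_kcoeff[OF hom] kenc_kdec[OF fm])
    ultimately show "\<exists>y\<in>strand koszul_res (Suc i) a. coeffs_in (pidl M) y \<and> bd koszul_res i y = f" by blast
  qed
next
  assume ex: "tor_zero_at koszul_res i (pidl M :: ('n, 'k) mpoly set) a"
  show "gexact TYPE('k) i M a"
    unfolding gexact_def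
  proof (intro ballI impI)
    fix c :: "'n set \<Rightarrow> 'k" assume c: "c \<in> gchains M a i" "kosz (\<lambda>_. 1) c = (\<lambda>_. 0)"
    let ?f = "kenc (klift a c)"
    have fm: "?f \<in> free_mod koszul_res i" using kenc_free_mod[OF klift_kchains[OF c(1)]] .
    then have "?f \<in> strand koszul_res i a" using khomog_klift[OF c(1)] by (simp add: strand_koszul_iff)
    moreover have "coeffs_in (pidl M) ?f"
      by (rule coeffs_in_kenc[OF klift_pidl[OF c(1)]]) (simp add: pidl_def)
    moreover have "cycle koszul_res i ?f"
      using cycle_koszul[OF fm] by (simp add: kosz_klift[OF c(1)] c(2))
    ultimately obtain y where y: "y \<in> strand koszul_res (Suc i) a" "coeffs_in (pidl M) y" "bd koszul_res i y = ?f"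
      using ex unfolding tor_zero_at_def by blast
    have "kosz xv (kdec y) = klift a c" using y(3) by (metis kdec_kenc koszul_res_simps(3))
    then have "kosz (\<lambda>_. 1) (kcoeff a (kdec y)) = c"
      by (simp add: kosz_kcoeff kcoeff_klift[OF c(1)])
    moreover have "kcoeff a (kdec y) \<in> gchains M a (Suc i)"
      using kdec_kchains[OF strand_free_mod[OF y(1)]] coeffs_in_kdec[OF y(2)] by (rule kcoeff_gchains)
    ultimately show "\<exists>y\<in>gchains M a (Suc i). kosz (\<lambda>_. 1) y = c" by blast
  qed
qed

text \<open>In multidegrees \<open>a \<noteq> 0\<close> exactness is \<open>gexact_UNIV\<close> with
  the whole ring as coefficients. In multidegree \<open>0\<close> only the empty cell survives, and
  there the augmentation is injective.\<close>

lemma graded_res_koszul: "graded_res (koszul_res :: ('n::finite, 'k::field) free_complex)"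
proof
  let ?K = "koszul_res :: ('n, 'k) free_complex"
  show "graded_lin ?K (Suc i) ?K i (bd ?K i)" for i
    unfolding graded_lin_def
  proof (intro conjI allI ballI)
    fix f g :: "('n, 'k) fvec"
    show "bd ?K i (f + g) = bd ?K i f + bd ?K i g" by (simp add: kdec_add kosz_add kenc_add)
  next
    fix s and f :: "('n, 'k) fvec"
    show "bd ?K i (smult s f) = smult s (bd ?K i f)" by (simp add: kdec_smult kosz_scale kenc_smult)
  next
    fix a and f :: "('n, 'k) fvec" assume "f \<in> strand ?K (Suc i) a"
    then have f: "f \<in> free_mod ?K (Suc i)" "khomog a (kdec f)" by (auto simp: strand_koszul_iff)
    then show "bd ?K i f \<in> strand ?K i a"
      using kenc_free_mod[OF kosz_kchains[OF kdec_kchains[OF f(1)]]] khomog_kosz[OF f(2)]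
      by (simp add: strand_koszul_iff)
  qed
  have hom0: "f = 0" if f: "f \<in> strand ?K i 0" and "i \<noteq> 0" for i f
  proof -
    have fm: "f \<in> free_mod ?K i" "khomog 0 (kdec f)" using f by (auto simp: strand_koszul_iff)
    have "kdec f F = 0" for F
    proof (rule ccontr)
      assume nz: "kdec f F \<noteq> 0"
      then have "card F \<noteq> 0" using kdec_kchains[OF fm(1)] that(2) by (auto simp: kchains_def)
      obtain t where "lookup (kdec f F) t \<noteq> 0"
        using nz by (auto simp: poly_mapping_eq_iff fun_eq_iff)
      then have "t + ind F = 0" using fm(2) by (simp add: khomog_def)
      then have "mdeg t + card F = 0" by (metis mdeg_add mdeg_ind mdeg_zero)
      with \<open>card F \<noteq> 0\<close> show False by simp
    qed
    then show ?thesis using kenc_kdec[OF fm(1)] by (metis ext kenc_zero)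
  qed
  have exact: "\<exists>y\<in>strand ?K (Suc i) a. bd ?K i y = f" if "f \<in> strand ?K i a" "cycle ?K i f" "a \<noteq> 0" for i f a
  proof -
    have "tor_zero_at ?K i (pidl UNIV) a" using gexact_UNIV[OF that(3)] by (simp add: tor_zero_at_koszul)
    then show ?thesis using that unfolding tor_zero_at_def by (auto simp: coeffs_in_def pidl_def)
  qed
  fix f g :: "('n, 'k) fvec" and s i and a :: "'n mon"
  show "aug ?K (f + g) = aug ?K f + aug ?K g" by (simp add: kdec_add lookup_add)
  show "aug ?K (smult s f) = lookup s 0 * aug ?K f" by (simp add: kdec_smult lookup_mult_zero)
  show "aug ?K f = 0" if "f \<in> strand ?K 0 a" "a \<noteq> 0"
    using that by (auto simp: strand_koszul_iff khomog_def) (metis add_0 ind_empty)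
  show "\<exists>f\<in>strand ?K 0 0. aug ?K f = 1"
  proof
    show "single (to_nat ({} :: 'n set)) 1 \<in> strand ?K 0 0"
      using basis_strand[of "to_nat ({} :: 'n set)" ?K 0] by simp
    show "aug ?K (single (to_nat ({} :: 'n set)) 1) = 1"
      by (simp add: kdec_def lookup_one)
  qed
  show "aug ?K (bd ?K 0 f) = 0"
  proof -
    have "kosz xv (kdec f) {} = (\<Sum>p\<in>UNIV. xv p * (sg p {} * kdec f {p}))"
      by (simp add: kosz_def ac_simps)
    moreover have "lookup (xv p * q) 0 = 0" for p and q :: "('n, 'k) mpoly"
      by (simp add: lookup_mult_zero xv_def monom_def lookup_single when_def poly_mapping_eq_iff fun_eq_iff)
    ultimately show ?thesis by (simp add: lookup_sum)
  qed
  show "bd ?K i (bd ?K (Suc i) f) = 0" by (simp add: kosz_kosz)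
  show "\<exists>y\<in>strand ?K (Suc 0) a. bd ?K 0 y = f" if f: "f \<in> strand ?K 0 a" "aug ?K f = 0"
  proof (cases "a = 0")
    case True
    have fm: "f \<in> free_mod ?K 0" "khomog 0 (kdec f)" using f True by (auto simp: strand_koszul_iff)
    have "kdec f F = 0" for F
    proof (cases "F = {}")
      case F: True
      show ?thesis
      proof (rule poly_mapping_eqI)
        fix t show "lookup (kdec f F) t = lookup 0 t"
          using f(2) fm(2)[unfolded khomog_def, THEN spec[of _ "{}"], THEN spec[of _ t]] F
          by (cases "t = 0") auto
      qed
    next
      case False
      then show ?thesis using kdec_kchains[OF fm(1)] by (auto simp: kchains_def)
    qed
    then have "f = 0" using kenc_kdec[OF fm(1)] by (metis ext kenc_zero)
    moreover have "kdec 0 = (\<lambda>_. 0 :: ('n, 'k) mpoly)" by (simp add: kdec_def fun_eq_iff)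
    ultimately show ?thesis by (intro bexI[of _ 0]) simp_all
  qed (use exact[OF f(1)] in \<open>simp add: cycle_def\<close>)
  show "\<exists>y\<in>strand ?K (Suc (Suc i)) a. bd ?K (Suc i) y = f" if f: "f \<in> strand ?K (Suc i) a" "bd ?K i f = 0"
  proof (cases "a = 0")
    case True
    then have "f = 0" using hom0 f(1) by blast
    moreover have "kdec 0 = (\<lambda>_. 0 :: ('n, 'k) mpoly)" by (simp add: kdec_def fun_eq_iff)
    ultimately show ?thesis by (intro bexI[of _ 0]) simp_all
  qed (use exact[OF f(1)] f(2) in \<open>simp add: cycle_def\<close>)
qed

lemma tor_zero_at_res_field:
  "tor_zero_at res_field i (pidl (upset A) :: ('n::finite, 'k::field) mpoly set) a \<longleftrightarrow> gexact TYPE('k) i (upset A) a"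
  unfolding tor_zero_at_koszul[symmetric]
  using tor_zero_at_transfer[OF _ _ is_ideal_pidl] graded_res_koszul graded_res_res_field by blast

lemma HS_pidl:
  "HS i (pidl (upset A) :: ('n::finite, 'k::field) mpoly set) = pidl (upset {a. \<not> gexact TYPE('k) i (upset A) a})"
proof -
  have "(0 :: ('n, 'k) mpoly) \<in> pidl (upset A)" by (simp add: pidl_def)
  from tor_nonzero_at_iff[OF this] have
    "HS i (pidl (upset A) :: ('n, 'k) mpoly set) = ideal_gen (monom ` {a. \<not> gexact TYPE('k) i (upset A) a})"
    unfolding HS_def tor_zero_at_res_field by (simp add: image_Collect)
  then show ?thesis by (simp only: ideal_gen_monom)
qed

section \<open>Betti numbers\<close>

lemma tor_chains_iff: "f \<in> tor_chains i (pidl M) \<longleftrightarrow> f \<in> free_mod res_field i \<and> coeffs_in (pidl M) f"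
proof -
  have "0 \<in> pidl M" by (simp add: pidl_def)
  then show ?thesis by (auto simp: tor_chains_def coeffs_in_def in_keys_iff)
qed

lemma coeffs_inD:
  assumes "coeffs_in (pidl M) f" "lookup (lookup f b) t \<noteq> 0"
  shows "t \<in> M"
proof -
  have "t \<in> keys (lookup f b)" using assms(2) by (simp add: in_keys_iff)
  then show ?thesis using assms(1) unfolding coeffs_in_def pidl_def by blast
qed

lemma tor_cycles_iff: "f \<in> tor_cycles i J \<longleftrightarrow> f \<in> tor_chains i J \<and> cycle res_field i f"
  by (simp add: tor_cycles_def cycle_def)

lemma coeffs_in_hcomp:
  assumes "coeffs_in (pidl M) f"
  shows "coeffs_in (pidl M) (hcomp P i a f)"
proof -
  have "keys (pm_filter Q p) \<subseteq> keys p" for Q and p :: "('a, 'b) mpoly"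
    by (auto simp: in_keys_iff split: if_splits)
  then show ?thesis using assms unfolding coeffs_in_def pidl_def lookup_hcomp by blast
qed

lemma coeffs_in_sum: "(\<And>a. a \<in> A \<Longrightarrow> coeffs_in (pidl M) (g a)) \<Longrightarrow> coeffs_in (pidl M) (sum g A)"
  unfolding coeffs_in_def lookup_sum by (intro allI pidl_sum) blast

lemma free_mod_sum: "(\<And>a. a \<in> A \<Longrightarrow> g a \<in> free_mod P i) \<Longrightarrow> sum g A \<in> free_mod P i"
  by (rule sum_closed[where Q = "\<lambda>f. f \<in> free_mod P i"]) (simp add: free_mod_def, erule (1) free_mod_add, blast)

lemma graded_lin_sum:
  assumes "graded_lin P n Q m u"
  shows "u (sum g A) = (\<Sum>a\<in>A. u (g a))"
  by (induction A rule: infinite_finite_induct) (simp_all add: graded_linD(1,4)[OF assms])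

lemma hcomp_smult_monom:
  "hcomp P i (w + a) (smult (monom w) f) = smult (monom w) (hcomp P i a f)"
  unfolding fvec_eq_iff
proof (intro allI)
  fix b t
  show "lookup (lookup (hcomp P i (w + a) (smult (monom w) f)) b) t =
      lookup (lookup (smult (monom w) (hcomp P i a f)) b) t"
  proof (cases "\<exists>s. t = w + s")
    case True
    then obtain s where s: "t = w + s" ..
    show ?thesis
      unfolding s monom_def lookup_smult lookup_hcomp lookup_pm_filter lookup_single_mult
      by (simp add: add.assoc)
  next
    case False
    then have "lookup (single w 1 * q) t = 0" for q :: "('a, 'b) mpoly"
      using lookup_single_mult_nonzeroE[of w 1 q t] by blast
    then show ?thesis by (simp add: lookup_hcomp monom_def)
  qed
qed

lemma smult_monom_eq_0_iff [simp]:
  fixes f :: "('n, 'k::field) fvec"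
  shows "smult (monom w) f = 0 \<longleftrightarrow> f = 0"
proof
  assume "smult (monom w) f = 0"
  then have "lookup (monom w * lookup f b) (w + t) = 0" for b t
    by (metis lookup_smult lookup_zero)
  then show "f = 0" unfolding monom_def lookup_single_mult by (simp add: fvec_eq_iff)
qed (simp add: smult_simps)

text \<open>The \<open>j\<close>-th Tor of \<open>L\<close> lives in total degree \<open>e + j\<close>; after multiplication by \<open>w\<close>, the
  Koszul complex with coefficients in \<open>L'\<close> has no boundaries in that degree.\<close>

lemma boundary_cancel_monom:
  fixes G G' :: "'n::finite mon set" and L L' :: "('n, 'k::field) mpoly set"
  defines "L \<equiv> pidl (upset G)" and "L' \<equiv> pidl (upset G')"
  assumes deg': "\<And>v. v \<in> G' \<Longrightarrow> mdeg v = e + mdeg w"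
    and linear: "\<And>a. mdeg a \<noteq> e + j \<Longrightarrow> gexact TYPE('k) j (upset G) a"
    and z: "z \<in> tor_cycles j L" and wz: "smult (monom w) z \<in> tor_boundaries j L'"
  shows "z \<in> tor_boundaries j L"
proof -
  let ?R = "res_field :: ('n, 'k) free_complex" and ?K = "koszul_res :: ('n, 'k) free_complex"
  note R = graded_res_res_field[where 'n = 'n and 'k = 'k]
  note bdR = graded_res.bd_lin[OF R]
  have zf: "z \<in> free_mod ?R j" and zL: "coeffs_in L z" and zc: "cycle ?R j z"
    using z by (auto simp: tor_cycles_iff tor_chains_iff L_def)
  obtain y where y: "y \<in> free_mod ?R (Suc j)" "coeffs_in L' y" "smult (monom w) z = bd ?R j y"
    using wz by (auto simp: tor_boundaries_def tor_chains_iff L'_def)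
  have "\<exists>v. v \<in> free_mod ?R (Suc j) \<and> coeffs_in L v \<and> bd ?R j v = hcomp ?R j a z" for a
  proof -
    let ?z = "hcomp ?R j a z"
    have za: "?z \<in> strand ?R j a" by (rule hcomp_strand[OF zf])
    have zaL: "coeffs_in L ?z" using zL unfolding L_def by (rule coeffs_in_hcomp)
    have zac: "cycle ?R j ?z"
    proof (cases j)
      case (Suc m)
      then have "bd ?R m ?z = hcomp ?R m a (bd ?R m z)" using hcomp_bd[OF bdR] zf by simp
      then show ?thesis using zc Suc by (simp add: cycle_def)
    qed (simp add: cycle_def)
    show ?thesis
    proof (cases "mdeg a = e + j")
      case False
      then have "tor_zero_at ?R j L a" unfolding L_def tor_zero_at_res_field by (rule linear)
      then show ?thesis using za zaL zac strand_free_mod unfolding tor_zero_at_def by blast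
    next
      case True
      \<comment> \<open>The total degrees of the basis of \<open>res_field\<close> are unknown, so
        the degree count is made after mapping to the Koszul complex.\<close>
      obtain \<phi> \<psi> h where
        \<phi>: "\<And>n. graded_lin ?R n ?K n (\<phi> n)" and \<psi>: "\<And>n. graded_lin ?K n ?R n (\<psi> n)"
        and h: "\<And>n. graded_lin ?R n ?R (Suc n) (h n)"
        and \<phi>S: "\<And>n f. f \<in> free_mod ?R (Suc n) \<Longrightarrow> bd ?K n (\<phi> (Suc n) f) = \<phi> n (bd ?R n f)"
        and hb: "\<And>n f. f \<in> free_mod ?R n \<Longrightarrow> cycle ?R n f \<Longrightarrow> bd ?R n (h n f) = f - \<psi> n (\<phi> n f)"
        using comparison[OF R graded_res_koszul] by metis
      let ?y = "hcomp ?R (Suc j) (w + a) y"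
      have ya: "?y \<in> strand ?R (Suc j) (w + a)" by (rule hcomp_strand[OF y(1)])
      have "bd ?R j ?y = smult (monom w) ?z"
        unfolding hcomp_bd[OF bdR y(1), symmetric] y(3)[symmetric] by (rule hcomp_smult_monom)
      then have "smult (monom w) (\<phi> j ?z) = bd ?K j (\<phi> (Suc j) ?y)"
        using \<phi>S[OF strand_free_mod[OF ya]] by (simp add: graded_linD(2)[OF \<phi>])
      \<comment> \<open>Its cells have \<open>j + 1\<close> elements and the total degree is
        \<open>e + j + mdeg w\<close>. The coefficients would have degree
        \<open>e + mdeg w - 1\<close>, below the generators of \<open>L'\<close>.\<close>
      also have "\<phi> (Suc j) ?y = 0"
      proof -
        have yK: "\<phi> (Suc j) ?y \<in> strand ?K (Suc j) (w + a)" by (rule graded_linD(3)[OF \<phi> ya])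
        have yL: "coeffs_in L' (\<phi> (Suc j) ?y)"
          unfolding L'_def
          by (rule coeffs_in_graded_lin[OF \<phi> is_ideal_pidl coeffs_in_hcomp]) (use y(2) in \<open>simp add: L'_def\<close>)
        have "lookup (lookup (\<phi> (Suc j) ?y) b) t = 0" for b t
        proof (rule ccontr)
          assume nz: "lookup (lookup (\<phi> (Suc j) ?y) b) t \<noteq> 0"
          then have "lookup (\<phi> (Suc j) ?y) b \<noteq> 0" by auto
          then have "b \<in> gens ?K (Suc j)" using strand_free_mod[OF yK] by (simp add: free_mod_iff)
          then obtain F :: "'n set" where F: "b = to_nat F" "card F = Suc j" by auto
          have "t + gdeg ?K (Suc j) b = w + a"
            using yK nz unfolding strand_def Int_iff lookup_expand_mem by blast
          then have "t + ind F = w + a" by (simp add: F(1))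
          then have "mdeg t + card F = mdeg w + mdeg a" by (metis mdeg_add mdeg_ind)
          moreover have "t \<in> upset G'" using coeffs_inD[OF yL[unfolded L'_def] nz] .
          then have "e + mdeg w \<le> mdeg t" using deg' by (auto simp: upset_def)
          ultimately show False using F(2) True by simp
        qed
        then show ?thesis by (simp add: fvec_eq_iff)
      qed
      \<comment> \<open>Multiplication by a monomial is injective. Now the homotopy alone fills
        \<open>?z\<close>, and its coefficients lie in \<open>L\<close>, because \<open>?z\<close>
        itself has coefficients in \<open>L\<close> and \<open>y\<close> no longer enters.\<close>
      finally have "\<phi> j ?z = 0" using graded_linD(4)[OF graded_res.bd_lin[OF graded_res_koszul[where 'n = 'n and 'k = 'k]]]
        by simp
      then have "bd ?R j (h j ?z) = ?z"
        using hb[OF strand_free_mod[OF za] zac] graded_linD(4)[OF \<psi>] by simp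
      moreover have "coeffs_in L (h j ?z)"
        unfolding L_def by (rule coeffs_in_graded_lin[OF h is_ideal_pidl zaL[unfolded L_def]])
      moreover have "h j ?z \<in> free_mod ?R (Suc j)"
        by (rule strand_free_mod[OF graded_linD(3)[OF h za]])
      ultimately show ?thesis by blast
    qed
  qed
  then obtain v where v: "\<And>a. v a \<in> free_mod ?R (Suc j)" "\<And>a. coeffs_in L (v a)"
    "\<And>a. bd ?R j (v a) = hcomp ?R j a z" by metis
  obtain A where A: "finite A" "z = (\<Sum>a\<in>A. hcomp ?R j a z)" by (rule sum_hcomp)
  have "sum v A \<in> tor_chains (Suc j) L"
    using v by (auto simp: tor_chains_iff L_def intro!: free_mod_sum coeffs_in_sum)
  moreover have "bd ?R j (sum v A) = z"
    unfolding graded_lin_sum[OF bdR] v(3) using A(2) by simp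
  ultimately show ?thesis unfolding tor_boundaries_def by blast
qed

text \<open>\<open>quotient_dim\<close> is a supremum over finite independent sets, so it suffices
  to carry each such set over by multiplication with \<open>w\<close>. A relation among the images
  modulo boundaries is \<open>w\<close> times a cycle, to which \<open>boundary_cancel_monom\<close>
  applies.\<close>

lemma betti_mono:
  fixes G G' :: "'n::finite mon set"
  assumes deg': "\<And>v. v \<in> G' \<Longrightarrow> mdeg v = e + mdeg w"
    and w: "\<And>u. u \<in> G \<Longrightarrow> w + u \<in> G'"
    and linear: "\<And>a. mdeg a \<noteq> e + j \<Longrightarrow> gexact TYPE('k::field) j (upset G) a"
  shows "betti j (pidl (upset G) :: ('n, 'k) mpoly set) \<le> betti j (pidl (upset G') :: ('n, 'k) mpoly set)"
  unfolding betti_def quotient_dim_def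
proof (rule SUP_mono)
  let ?L = "pidl (upset G) :: ('n, 'k) mpoly set" and ?L' = "pidl (upset G') :: ('n, 'k) mpoly set"
  let ?R = "res_field :: ('n, 'k) free_complex"
  let ?w = "smult (monom w) :: ('n, 'k) fvec \<Rightarrow> _"
  note bdR = graded_res.bd_lin[OF graded_res_res_field[where 'n = 'n and 'k = 'k]]
  fix C assume "C \<in> {C. finite C \<and> C \<subseteq> tor_cycles j ?L \<and>
    (\<forall>c. (\<Sum>x\<in>C. smult (const (c x)) x) \<in> tor_boundaries j ?L \<longrightarrow> (\<forall>x\<in>C. c x = 0))}"
  then have C: "finite C" "C \<subseteq> tor_cycles j ?L"
    "\<And>c. (\<Sum>x\<in>C. smult (const (c x)) x) \<in> tor_boundaries j ?L \<Longrightarrow> \<forall>x\<in>C. c x = 0" by auto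
  have inj: "inj_on ?w C"
  proof
    fix x y assume "?w x = ?w y"
    then have "?w (x - y) = 0" by (simp add: smult_simps)
    then show "x = y" by simp
  qed
  have smult_cyc: "smult s x \<in> tor_cycles j ?L" if x: "x \<in> tor_cycles j ?L" for s x
  proof -
    have "smult s x \<in> free_mod ?R j"
      unfolding free_mod_iff
    proof (intro allI impI)
      fix b assume "lookup (smult s x) b \<noteq> 0"
      then have "lookup x b \<noteq> 0" by auto
      then show "b \<in> gens ?R j" using x by (simp add: tor_cycles_iff tor_chains_iff free_mod_iff)
    qed
    moreover have "coeffs_in ?L (smult s x)"
      using x is_ideal_pidl[of G] unfolding tor_cycles_iff tor_chains_iff coeffs_in_def is_ideal_def lookup_smult
      by blast
    moreover have "cycle ?R j (smult s x)"
      using x by (auto simp: tor_cycles_iff cycle_def graded_linD(2)[OF bdR] smult_simps split: nat.splits)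
    ultimately show ?thesis by (simp add: tor_cycles_iff tor_chains_iff)
  qed
  have add_cyc: "x + y \<in> tor_cycles j ?L" if "x \<in> tor_cycles j ?L" "y \<in> tor_cycles j ?L" for x y
    using that by (auto simp: tor_cycles_iff tor_chains_iff cycle_def graded_linD(1)[OF bdR]
        intro!: free_mod_add coeffs_in_add is_ideal_pidl split: nat.splits)
  have zero_cyc: "0 \<in> tor_cycles j ?L"
  proof -
    have "(0 :: ('n, 'k) mpoly) \<in> ?L" by (simp add: pidl_def)
    then show ?thesis
      by (auto simp: tor_cycles_iff tor_chains_iff cycle_def graded_linD(4)[OF bdR] free_mod_def
          coeffs_in_def split: nat.splits)
  qed
  show "\<exists>C'\<in>{C. finite C \<and> C \<subseteq> tor_cycles j ?L' \<and>
    (\<forall>c. (\<Sum>x\<in>C. smult (const (c x)) x) \<in> tor_boundaries j ?L' \<longrightarrow> (\<forall>x\<in>C. c x = 0))}. enat (card C) \<le> enat (card C')"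
  proof (intro bexI CollectI conjI allI impI)
    show "enat (card C) \<le> enat (card (?w ` C))" using inj by (simp add: card_image)
    show "finite (?w ` C)" using C(1) by simp
    show "?w ` C \<subseteq> tor_cycles j ?L'"
    proof (rule image_subsetI)
      fix x assume "x \<in> C"
      then have x: "?w x \<in> tor_cycles j ?L" "x \<in> tor_cycles j ?L" using C(2) smult_cyc by auto
      have "lookup (?w x) b \<in> ?L'" for b
        unfolding pidl_def
      proof (intro CollectI subsetI)
        fix t assume "t \<in> keys (lookup (?w x) b)"
        then have "lookup (single w 1 * lookup x b) t \<noteq> 0"
          by (simp add: in_keys_iff monom_def)
        then obtain s where s: "t = w + s" "lookup (lookup x b) s \<noteq> 0"
          by (rule lookup_single_mult_nonzeroE)
        then have "s \<in> upset G"
          using x(2) coeffs_inD by (auto simp: tor_cycles_iff tor_chains_iff)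
        then obtain u r where "u \<in> G" "s = u + r" by (auto simp: upset_def)
        then have "t = (w + u) + r" "w + u \<in> G'" using w s(1) by (simp_all add: add.assoc)
        then show "t \<in> upset G'" unfolding upset_def by blast
      qed
      then show "?w x \<in> tor_cycles j ?L'" using x(1)
        by (simp add: tor_cycles_iff tor_chains_iff coeffs_in_def)
    qed
  next
    fix c assume "(\<Sum>x\<in>?w ` C. smult (const (c x)) x) \<in> tor_boundaries j ?L'"
    also have "(\<Sum>x\<in>?w ` C. smult (const (c x)) x) = (\<Sum>x\<in>C. ?w (smult (const (c (?w x))) x))"
      using inj by (simp add: sum.reindex smult_simps mult.commute)
    also have "\<dots> = ?w (\<Sum>x\<in>C. smult (const (c (?w x))) x)"
    proof -
      have "?w (sum g A) = (\<Sum>x\<in>A. ?w (g x))" for g :: "('n, 'k) fvec \<Rightarrow> _" and A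
        by (induction A rule: infinite_finite_induct) (simp_all add: smult_simps)
      then show ?thesis by simp
    qed
    finally have "(\<Sum>x\<in>C. smult (const (c (?w x))) x) \<in> tor_boundaries j ?L"
    proof (rule boundary_cancel_monom[OF deg' linear, rotated -1])
      show "(\<Sum>x\<in>C. smult (const (c (?w x))) x) \<in> tor_cycles j ?L"
        by (rule sum_closed[where Q = "\<lambda>x. x \<in> tor_cycles j ?L"]) (use zero_cyc add_cyc smult_cyc C(2) in auto)
    qed
    then have "\<forall>x\<in>C. c (?w x) = 0" using C(3)[of "\<lambda>x. c (?w x)"] by simp
    then show "\<forall>x\<in>?w ` C. c x = 0" by auto
  qed
qed

section \<open>Noetherianity\<close>

text \<open>Keep the indices whose value is the minimum of the tail starting there; every tail
  contains one, so there are infinitely many.\<close>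

lemma nat_seq_mono_subseq:
  fixes t :: "nat \<Rightarrow> nat"
  obtains r :: "nat \<Rightarrow> nat" where "strict_mono r" "mono (\<lambda>k. t (r k))"
proof -
  define S where "S = {n. \<forall>m\<ge>n. t n \<le> t m}"
  have "\<exists>n\<ge>k. n \<in> S" for k
  proof -
    obtain n where n: "k \<le> n" "\<And>m. k \<le> m \<Longrightarrow> t n \<le> t m"
      using ex_has_least_nat[of "\<lambda>n. k \<le> n" k t] by auto
    then show ?thesis by (intro exI[of _ n]) (simp add: S_def)
  qed
  then have inf: "infinite S" by (metis finite_nat_set_iff_bounded not_le)
  show ?thesis
  proof
    show sm: "strict_mono (enumerate S)" by (rule strict_mono_enumerate[OF inf])
    show "mono (\<lambda>k. t (enumerate S k))"
    proof
      fix x y :: nat assume "x \<le> y"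
      then have "enumerate S x \<le> enumerate S y" by (rule monoD[OF strict_mono_mono[OF sm]])
      moreover have "enumerate S x \<in> S" by (rule enumerate_in_set[OF inf])
      ultimately show "t (enumerate S x) \<le> t (enumerate S y)" by (simp add: S_def)
    qed
  qed
qed

text \<open>Pass to subsequences for one variable after the other until all exponents are
  nondecreasing.\<close>

lemma dickson:
  fixes s :: "nat \<Rightarrow> 'n::finite mon"
  obtains i j w where "i < j" "s j = s i + w"
proof -
  have "\<exists>r :: nat \<Rightarrow> nat. strict_mono r \<and> (\<forall>p\<in>A. mono (\<lambda>k. lookup (s (r k)) p))" if "finite A" for A :: "'n set"
    using that
  proof (induction A)
    case empty
    show ?case by (intro exI[of _ id]) (simp add: strict_mono_def)
  next
    case (insert q A)
    then obtain r :: "nat \<Rightarrow> nat" where r: "strict_mono r" "\<forall>p\<in>A. mono (\<lambda>k. lookup (s (r k)) p)" by blast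
    obtain r' :: "nat \<Rightarrow> nat" where r': "strict_mono r'" "mono (\<lambda>k. lookup (s (r (r' k))) q)"
      using nat_seq_mono_subseq[of "\<lambda>k. lookup (s (r k)) q"] by blast
    have "mono (\<lambda>k. lookup (s (r (r' k))) p)" if "p \<in> A" for p
    proof
      fix x y :: nat assume "x \<le> y"
      then have "r' x \<le> r' y" by (rule monoD[OF strict_mono_mono[OF r'(1)]])
      then show "lookup (s (r (r' x))) p \<le> lookup (s (r (r' y))) p"
        using r(2) that monoD by fastforce
    qed
    then show ?case using r' r(1)
      by (intro exI[of _ "\<lambda>k. r (r' k)"]) (auto simp: strict_mono_def)
  qed
  from this[of UNIV] obtain r :: "nat \<Rightarrow> nat" where r: "strict_mono r" "\<And>p. mono (\<lambda>k. lookup (s (r k)) p)"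
    by auto
  show ?thesis
  proof
    show "r 0 < r 1" using r(1) by (simp add: strict_mono_def)
    show "s (r 1) = s (r 0) + (s (r 1) - s (r 0))"
      unfolding mon_eq_iff lookup_add lookup_minus using monoD[OF r(2), of 0 1] by simp
  qed
qed

lemma lexgt_add: "lexgt v u \<Longrightarrow> lexgt (v + w) (u + w)"
  by (auto simp: lexgt_def lookup_add)

text \<open>In an infinite descending chain some later member would be a multiple of an earlier one,
  but a proper divisor is lexicographically smaller.\<close>

lemma wf_lexgt: "wf {(u, v). lexgt v (u :: 'n::finite mon)}"
  unfolding wf_iff_no_infinite_down_chain
proof
  assume "\<exists>s. \<forall>k. (s (Suc k), s k) \<in> {(u, v). lexgt v (u :: 'n mon)}"
  then obtain s :: "nat \<Rightarrow> 'n mon" where s: "\<And>k. lexgt (s k) (s (Suc k))" by auto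
  have "lexgt (s i) (s j)" if "i < j" for i j
    using that s by (induction j) (auto simp: less_Suc_eq intro: lexgt_trans)
  moreover obtain i j w where "i < j" "s j = s i + w" by (rule dickson)
  ultimately have "lexgt (s i) (s i + w)" by metis
  then show False by (auto simp: lexgt_def lookup_add)
qed

section \<open>Leading monomials and the ascending chain condition\<close>

definition lead :: "('n::finite, 'k::field) mpoly \<Rightarrow> 'n mon \<Rightarrow> bool" where
  "lead f a \<longleftrightarrow> a \<in> keys f \<and> (\<forall>t\<in>keys f. t \<noteq> a \<longrightarrow> lexgt a t)"

lemma lead_exists:
  assumes "f \<noteq> 0"
  obtains a where "lead f a"
proof -
  have "keys f \<noteq> {}" using assms by simp
  then obtain a where a: "a \<in> keys f" "\<And>t. t \<in> keys f \<Longrightarrow> t \<noteq> a \<Longrightarrow> \<not> lexgt t a"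
    using Finite_Set.bex_min_element[OF finite_keys, of f "\<lambda>v u. lexgt v u"] lexgt_irrefl lexgt_trans
    unfolding asymp_on_def transp_on_def by blast
  then have "lead f a" unfolding lead_def using lexgt_total by blast
  then show ?thesis by (rule that)
qed

lemma is_ideal_ideal_gen: "is_ideal (ideal_gen A)"
  using module.subspace_span[OF module_mult, of A]
  unfolding is_ideal_def ideal_gen_def module.subspace_def[OF module_mult] by blast

text \<open>In a strictly increasing chain, choose at each step an element new in
  \<open>Q (Suc k)\<close> with the least possible leading monomial. By Dickson's lemma an earlier
  leading monomial divides a later one. Cancelling it keeps the later element new but lowers its
  leading monomial, against the choice.\<close>

lemma ascending_chain_condition:
  fixes Q :: "nat \<Rightarrow> ('n::finite, 'k::field) mpoly set"
  assumes ideal: "\<And>k. is_ideal (Q k)" and inc: "\<And>k. Q k \<subseteq> Q (Suc k)"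
  shows "\<exists>k. Q (Suc k) = Q k"
proof (rule ccontr)
  assume "\<nexists>k. Q (Suc k) = Q k"
  then have strict: "\<exists>f. f \<in> Q (Suc k) \<and> f \<notin> Q k" for k using inc[of k] by blast
  have mono: "Q i \<subseteq> Q j" if "i \<le> j" for i j
    using that by (rule lift_Suc_mono_le[of Q, OF inc])
  define A where "A k = {a. \<exists>f. f \<in> Q (Suc k) \<and> f \<notin> Q k \<and> lead f a}" for k
  have "\<exists>a. a \<in> A k \<and> (\<forall>b. lexgt a b \<longrightarrow> b \<notin> A k)" for k
  proof -
    obtain f where f: "f \<in> Q (Suc k)" "f \<notin> Q k" using strict by blast
    then have "f \<noteq> 0" using ideal[of k] by (auto simp: is_ideal_def)
    then obtain a where "lead f a" by (rule lead_exists)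
    with f have "a \<in> A k" by (auto simp: A_def)
    then show ?thesis using wfE_min[OF wf_lexgt, of a "A k"] by auto
  qed
  then obtain a where a: "\<And>k. a k \<in> A k" "\<And>k b. lexgt (a k) b \<Longrightarrow> b \<notin> A k" by metis
  have "\<exists>f. f \<in> Q (Suc k) \<and> f \<notin> Q k \<and> lead f (a k)" for k
    using a(1)[of k] by (simp add: A_def)
  then obtain f where f: "\<And>k. f k \<in> Q (Suc k)" "\<And>k. f k \<notin> Q k" "\<And>k. lead (f k) (a k)"
    by metis
  obtain i j w where ij: "i < j" "a j = a i + w" by (rule dickson)
  define c where "c = lookup (f j) (a j) / lookup (f i) (a i)"
  define g where "g = f j - single w c * f i"
  have "f i \<in> Q j" using f(1)[of i] mono[of "Suc i" j] ij(1) by auto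
  then have fi: "single w c * f i \<in> Q j" using ideal[of j] by (simp add: is_ideal_def)
  then have "g \<in> Q (Suc j)" using is_ideal_diff[OF ideal f(1)[of j]] inc[of j] by (auto simp: g_def)
  moreover have "g \<notin> Q j"
  proof
    assume "g \<in> Q j"
    then have "g + single w c * f i \<in> Q j" using fi ideal[of j] by (simp add: is_ideal_def)
    then show False using f(2)[of j] by (simp add: g_def)
  qed
  moreover from this have "g \<noteq> 0" using ideal[of j] by (auto simp: is_ideal_def)
  then obtain b where b: "lead g b" by (rule lead_exists)
  ultimately have "b \<in> A j" by (auto simp: A_def)
  moreover have "lexgt (a j) b"
  proof -
    have ai: "lookup (f i) (a i) \<noteq> 0" using f(3)[of i] by (simp add: lead_def in_keys_iff)
    have gb: "lookup g b \<noteq> 0" using b by (simp add: lead_def in_keys_iff)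
    have "lookup (single w c * f i) (a j) = lookup (f j) (a j)"
      unfolding ij(2) add.commute[of "a i"] lookup_single_mult using ai ij(2)
      by (simp add: c_def add.commute)
    then have "b \<noteq> a j" using gb by (auto simp: g_def lookup_minus)
    from gb consider "lookup (f j) b \<noteq> 0" | "lookup (single w c * f i) b \<noteq> 0"
      by (cases "lookup (f j) b = 0") (auto simp: g_def lookup_minus)
    then show ?thesis
    proof cases
      case 1
      then show ?thesis using f(3)[of j] \<open>b \<noteq> a j\<close> by (auto simp: lead_def in_keys_iff)
    next
      case 2
      then obtain t where t: "b = w + t" "lookup (f i) t \<noteq> 0" by (rule lookup_single_mult_nonzeroE)
      then have "t \<noteq> a i" using \<open>b \<noteq> a j\<close> ij(2) by (auto simp: add.commute)
      then have "lexgt (a i) t" using f(3)[of i] t(2) by (auto simp: lead_def in_keys_iff)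
      from lexgt_add[OF this, of w] show ?thesis by (simp add: t(1) ij(2) add.commute)
    qed
  qed
  ultimately show False using a(2) by blast
qed

text \<open>If no nonzero element of \<open>R/N\<close> is killed by \<open>m\<close>, then \<open>m\<close> is not contained in an
  associated prime of \<open>R/N\<close>; prime avoidance gives a nonzerodivisor in \<open>m\<close>.\<close>

lemma exists_nonzerodivisor:
  fixes N m :: "'a::comm_ring_1 set"
  assumes acc: "\<And>Q :: nat \<Rightarrow> 'a set. (\<And>k. is_ideal (Q k)) \<Longrightarrow> (\<And>k. Q k \<subseteq> Q (Suc k)) \<Longrightarrow> \<exists>k. Q (Suc k) = Q k"
    and N: "is_ideal N" and m: "is_ideal m"
    and socle: "\<And>g. (\<And>f. f \<in> m \<Longrightarrow> f * g \<in> N) \<Longrightarrow> g \<in> N"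
  shows "\<exists>f\<in>m. \<forall>g. f * g \<in> N \<longrightarrow> g \<in> N"
proof -
  define col where "col g = {f. f * g \<in> N}" for g
  have N0: "0 \<in> N" and Nadd: "\<And>f g. f \<in> N \<Longrightarrow> g \<in> N \<Longrightarrow> f + g \<in> N" and Nmult: "\<And>s f. f \<in> N \<Longrightarrow> s * f \<in> N"
    using N by (auto simp: is_ideal_def)
  have col_ideal: "is_ideal (col g)" for g
    unfolding is_ideal_def col_def using N0 Nadd Nmult by (auto simp: distrib_right mult.assoc)
  \<comment> \<open>Annihilators \<open>col g\<close> of classes modulo \<open>N\<close> that are
    maximal among those of nonzero classes. They are prime, and by the chain condition every element
    annihilating a nonzero class lies in one of them.\<close>
  define M where "M g \<longleftrightarrow> g \<notin> N \<and> (\<forall>h. h \<notin> N \<longrightarrow> col g \<subseteq> col h \<longrightarrow> col h = col g)" for g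
  have above: "\<exists>h. M h \<and> col g \<subseteq> col h" if g: "g \<notin> N" for g
  proof (rule ccontr)
    assume no: "\<nexists>h. M h \<and> col g \<subseteq> col h"
    have step: "\<exists>h'. (h' \<notin> N \<and> col g \<subseteq> col h') \<and> col h \<subset> col h'" if "h \<notin> N \<and> col g \<subseteq> col h" for h
      using no that unfolding M_def by blast
    have "\<exists>s. \<forall>k. (s k \<notin> N \<and> col g \<subseteq> col (s k)) \<and> col (s k) \<subset> col (s (Suc k))"
      by (rule dependent_nat_choice) (use g in blast, rule step)
    then obtain s where s: "\<And>k. col (s k) \<subset> col (s (Suc k))" by blast
    then show False using acc[of "\<lambda>k. col (s k)", OF col_ideal] by blast
  qed
  have prime: "a \<in> col g" if "M g" "a * b \<in> col g" "b \<notin> col g" for a b g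
  proof -
    have "b * g \<notin> N" using that(3) by (simp add: col_def)
    moreover have "f * (b * g) \<in> N" if "f * g \<in> N" for f
      using Nmult[OF that, of b] by (simp add: mult.left_commute)
    then have "col g \<subseteq> col (b * g)" by (auto simp: col_def)
    ultimately have "col (b * g) = col g" using that(1) by (simp add: M_def)
    moreover have "a \<in> col (b * g)" using that(2) by (simp add: col_def mult.assoc)
    ultimately show ?thesis by simp
  qed
  have one: "1 \<notin> col g" if "M g" for g using that by (simp add: col_def M_def)
  have prime_prod: "prod z A \<notin> col g" if "M g" "finite A" "\<And>x. x \<in> A \<Longrightarrow> z x \<notin> col g" for g A and z :: "'b \<Rightarrow> 'a"
    using that(2,3) by (induction A) (use one[OF that(1)] prime[OF that(1)] in auto)
  have prod_mem: "prod z A \<in> J" if "is_ideal J" "finite A" "x \<in> A" "z x \<in> J" for z :: "'b \<Rightarrow> 'a" and A x J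
    using that by (simp add: prod.remove[of A x] is_ideal_def mult.commute[of "z x"])
  have incomparable: "\<exists>f. f \<in> col g \<and> f \<notin> col h" if "M g" "M h" "col g \<noteq> col h" for g h
    using that unfolding M_def by blast
  \<comment> \<open>With infinitely many, the ideals generated by the first \<open>k\<close>
    representatives would stabilise. Then some \<open>s k\<close> lies in the ideal of the earlier
    ones, so \<open>P k\<close> contains the intersection of the earlier primes. A product of
    elements of \<open>P i\<close> outside \<open>P k\<close> contradicts this.\<close>
  have fin: "finite (col ` {g. M g})"
  proof (rule ccontr)
    assume "\<not> ?thesis"
    then obtain P :: "nat \<Rightarrow> 'a set" where P: "inj P" "range P \<subseteq> col ` {g. M g}"
      using infinite_countable_subset by blast
    then have "\<exists>g. M g \<and> P k = col g" for k by blast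
    then obtain s where s: "\<And>k. M (s k)" "\<And>k. P k = col (s k)" by metis
    define Q where "Q k = ideal_gen (s ` {..<k})" for k
    have "\<exists>k. Q (Suc k) = Q k"
    proof (rule acc)
      show "Q k \<subseteq> Q (Suc k)" for k
        unfolding Q_def ideal_gen_def by (rule module.span_mono[OF module_mult]) auto
    qed (simp add: Q_def is_ideal_ideal_gen)
    then obtain k where k: "Q (Suc k) = Q k" ..
    have "s k \<in> Q (Suc k)" unfolding Q_def ideal_gen_def
      by (rule module.span_base[OF module_mult]) auto
    then have sk: "s k \<in> ideal_gen (s ` {..<k})" using k by (simp add: Q_def)
    have inter: "f \<in> P k" if fP: "\<And>i. i < k \<Longrightarrow> f \<in> P i" for f
    proof -
      have "f * x \<in> N" if x: "x \<in> ideal_gen (s ` {..<k})" for x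
        using x unfolding ideal_gen_def
      proof (induction rule: module.span_induct_alt[OF module_mult, consumes 1, case_names base step])
        case (step c x y)
        then obtain i where "i < k" "x = s i" by auto
        then have "f * x \<in> N" using fP[of i] s(2) by (auto simp: col_def)
        then have "c * (f * x) + f * y \<in> N" using Nadd Nmult step.IH by blast
        then show ?case by (simp add: distrib_left mult.left_commute)
      qed (simp add: N0)
      from this[OF sk] show ?thesis by (simp add: s(2) col_def)
    qed
    have "\<exists>f. f \<in> P i \<and> f \<notin> P k" if "i < k" for i
      using incomparable[OF s(1)[of i] s(1)[of k]] P(1) that s(2) by (metis injD less_irrefl)
    then obtain z where z: "\<And>i. i < k \<Longrightarrow> z i \<in> P i" "\<And>i. i < k \<Longrightarrow> z i \<notin> P k" by metis
    have "prod z {..<k} \<in> P i" if "i < k" for i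
      using prod_mem[of "P i" "{..<k}" i z] z(1) that col_ideal s(2) by simp
    then have "prod z {..<k} \<in> P k" by (rule inter)
    moreover have "prod z {..<k} \<notin> P k"
      unfolding s(2) by (rule prime_prod[OF s(1)]) (use z(2) s(2) in auto)
    ultimately show False by simp
  qed
  \<comment> \<open>Prime avoidance, one prime at a time. If \<open>f\<close> falls into the new
    prime, a correction is added that lies in \<open>m\<close> and in all the old primes but not in
    the new one.\<close>
  have "\<exists>f\<in>m. \<forall>P\<in>\<Q>. f \<notin> P" if "\<Q> \<subseteq> col ` {g. M g}" "finite \<Q>" for \<Q>
    using that(2,1)
  proof (induction \<Q>)
    case empty
    then show ?case using m by (auto simp: is_ideal_def)
  next
    case (insert P \<Q>)
    then obtain f where f: "f \<in> m" "\<And>Q. Q \<in> \<Q> \<Longrightarrow> f \<notin> Q" by auto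
    obtain g where g: "M g" "P = col g" using insert.prems by auto
    show ?case
    proof (cases "f \<in> P")
      case False
      with f show ?thesis by auto
    next
      case True
      obtain y where y: "y \<in> m" "y \<notin> P" using socle[of g] g by (auto simp: M_def col_def)
      have "\<exists>z. z \<in> Q \<and> z \<notin> P" if Q: "Q \<in> \<Q>" for Q
      proof -
        obtain h where h: "M h" "Q = col h" using insert.prems Q by auto
        have "col h \<noteq> col g" using insert.hyps(2) Q h(2) g(2) by auto
        then show ?thesis unfolding h(2) g(2) by (rule incomparable[OF h(1) g(1)])
      qed
      then obtain z where z: "\<And>Q. Q \<in> \<Q> \<Longrightarrow> z Q \<in> Q" "\<And>Q. Q \<in> \<Q> \<Longrightarrow> z Q \<notin> P" by metis
      let ?h = "y * prod z \<Q>"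
      have hP: "?h \<notin> P"
      proof
        assume "?h \<in> P"
        moreover have "prod z \<Q> \<notin> P" unfolding g(2) by (rule prime_prod[OF g(1) insert.hyps(1)]) (use z(2) g(2) in auto)
        ultimately show False using prime[OF g(1)] y(2) g(2) by blast
      qed
      have hQ: "?h \<in> Q" "is_ideal Q" if "Q \<in> \<Q>" for Q
      proof -
        show Q: "is_ideal Q" using insert.prems that col_ideal by auto
        show "?h \<in> Q" using prod_mem[of Q \<Q> Q z] Q insert.hyps(1) that z(1)[OF that] by (simp add: is_ideal_def)
      qed
      have "is_ideal P" using g(2) col_ideal by simp
      show ?thesis
      proof (intro bexI ballI)
        have "prod z \<Q> * y \<in> m" using m y(1) by (simp add: is_ideal_def)
        then show "f + ?h \<in> m" using m f(1) by (simp add: is_ideal_def mult.commute)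
        fix Q assume "Q \<in> insert P \<Q>"
        then show "f + ?h \<notin> Q"
        proof
          assume "Q = P"
          show ?thesis
          proof
            assume "f + ?h \<in> Q"
            then have "f + ?h - f \<in> P" using is_ideal_diff[OF \<open>is_ideal P\<close>] True \<open>Q = P\<close> by blast
            with hP show False by simp
          qed
        next
          assume Q: "Q \<in> \<Q>"
          show ?thesis
          proof
            assume "f + ?h \<in> Q"
            then have "f + ?h - ?h \<in> Q" using is_ideal_diff[OF hQ(2)[OF Q]] hQ(1)[OF Q] by blast
            with f(2)[OF Q] show False by simp
          qed
        qed
      qed
    qed
  qed
  from this[OF order_refl fin] obtain f where f: "f \<in> m" "\<And>g. M g \<Longrightarrow> f \<notin> col g" by auto
  show ?thesis
  proof (intro bexI allI impI)
    fix g assume "f * g \<in> N"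
    then have "f \<in> col g" by (simp add: col_def)
    then show "g \<in> N" using above[of g] f(2) by blast
  qed (rule f(1))
qed

section \<open>Depth\<close>

lemma max_ideal_pidl: "(max_ideal :: ('n::finite, 'k::field) mpoly set) = pidl (UNIV - {0})"
proof -
  have "upset {single i 1 | i. True} = UNIV - {0 :: 'n mon}"
  proof (intro equalityI subsetI)
    fix t :: "'n mon" assume "t \<in> UNIV - {0}"
    then obtain p where "lookup t p \<noteq> 0" by (auto simp: mon_eq_iff)
    then obtain m where "t = single p 1 + m" by (rule mon_split_single)
    then show "t \<in> upset {single i 1 | i. True}" unfolding upset_def by blast
  next
    fix t :: "'n mon" assume "t \<in> upset {single i 1 | i. True}"
    then obtain p w where t: "t = single p 1 + w" by (auto simp: upset_def)
    then have "lookup t p \<noteq> 0" by (simp add: lookup_add)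
    then show "t \<in> UNIV - {0}" by auto
  qed
  moreover have "{monom (single i 1) | i. True} =
      (monom ` {single i 1 | i. True} :: ('n, 'k) mpoly set)" by auto
  ultimately show ?thesis unfolding max_ideal_def by (simp only: ideal_gen_monom)
qed

lemma is_ideal_max_ideal: "is_ideal max_ideal"
  unfolding max_ideal_def by (rule is_ideal_ideal_gen)

lemma one_notin_max_ideal: "1 \<notin> (max_ideal :: ('n::finite, 'k::field) mpoly set)"
  unfolding max_ideal_pidl by (simp add: pidl_def)

lemma ideal_gen_ideal: "is_ideal J \<Longrightarrow> ideal_gen J = (J :: 'a::comm_ring_1 set)"
  unfolding ideal_gen_def module.span_eq_iff[OF module_mult] module.subspace_def[OF module_mult] is_ideal_def
  by blast

lemma ideal_gen_insert: "ideal_gen (insert f A) = {g. \<exists>k. g - k * f \<in> ideal_gen (A :: 'a::comm_ring_1 set)}"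
  unfolding ideal_gen_def by (rule module.span_insert[OF module_mult])

text \<open>Vanishing of the Koszul homology \<open>H\<^sub>j(x; S/N)\<close>.\<close>

definition koszul_vanishes :: "nat \<Rightarrow> ('n::finite, 'k::field) mpoly set \<Rightarrow> bool" where
  "koszul_vanishes j N \<longleftrightarrow> (\<forall>z\<in>kchains j. (\<forall>F. kosz xv z F \<in> N) \<longrightarrow>
     (\<exists>y\<in>kchains (Suc j). \<forall>F. z F - kosz xv y F \<in> N))"

text \<open>\<open>H\<close> makes multiplication by \<open>f\<close> homotopic to zero on the
  Koszul complex of \<open>S\<close>. The last clause lets it descend to coefficients in
  \<open>S/N\<close> for every ideal \<open>N\<close>.\<close>

definition null_homotopy ::
  "('n::finite, 'k::field) mpoly \<Rightarrow> (('n set \<Rightarrow> ('n, 'k) mpoly) \<Rightarrow> 'n set \<Rightarrow> ('n, 'k) mpoly) \<Rightarrow> bool" where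
  "null_homotopy f H \<longleftrightarrow> (\<forall>j. \<forall>c\<in>kchains j. H c \<in> kchains (Suc j)) \<and>
    (\<forall>c G. kosz xv (H c) G + H (kosz xv c) G = f * c G) \<and>
    (\<forall>N c. is_ideal N \<longrightarrow> (\<forall>F. c F \<in> N) \<longrightarrow> (\<forall>F. H c F \<in> N))"

lemma null_homotopyD:
  assumes "null_homotopy f H"
  shows "c \<in> kchains j \<Longrightarrow> H c \<in> kchains (Suc j)"
    and "kosz xv (H c) G + H (kosz xv c) G = f * c G"
    and "is_ideal N \<Longrightarrow> (\<And>F. c F \<in> N) \<Longrightarrow> H c F \<in> N"
  using assms unfolding null_homotopy_def by simp_all

text \<open>If \<open>f\<close> is the sum of the \<open>s_p x_p\<close>, the sum of the
  \<open>s_p khom p\<close> works by \<open>kosz_khom\<close>.\<close>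

lemma max_ideal_null_homotopic:
  fixes f :: "('n::finite, 'k::field) mpoly"
  assumes "f \<in> max_ideal"
  shows "\<exists>H. null_homotopy f H"
  using assms unfolding max_ideal_def ideal_gen_def
proof (induction rule: module.span_induct_alt[OF module_mult, consumes 1, case_names base step])
  case base
  show ?case by (intro exI[of _ "\<lambda>c F. 0"]) (auto simp: null_homotopy_def kchains_def is_ideal_def)
next
  case (step s x f)
  from step.hyps obtain p where x: "x = xv p" by (auto simp: xv_def)
  obtain H where "null_homotopy f H" using step.IH by blast
  note H = null_homotopyD[OF this]
  let ?H = "\<lambda>c F. s * khom p c F + H c F"
  have H1: "?H c \<in> kchains (Suc j)" if "c \<in> kchains j" for c j
    unfolding kchains_def
  proof (intro CollectI allI impI)
    fix F assume "s * khom p c F + H c F \<noteq> 0"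
    then have "khom p c F \<noteq> 0 \<or> H c F \<noteq> 0" by auto
    then show "card F = Suc j" using khom_kchains[OF that, of p] H(1)[OF that] by (auto simp: kchains_def)
  qed
  have H2: "kosz xv (?H c) G + ?H (kosz xv c) G = (s * x + f) * c G" for c G
  proof -
    have "kosz xv (?H c) G + ?H (kosz xv c) G =
        s * (kosz xv (khom p c) G + khom p (kosz xv c) G) + (kosz xv (H c) G + H (kosz xv c) G)"
      by (simp add: kosz_add kosz_scale distrib_left)
    then show ?thesis unfolding kosz_khom H(2) x by (simp add: distrib_right mult.assoc)
  qed
  have H3: "?H c F \<in> N" if N: "is_ideal N" "\<And>F. c F \<in> N" for N c F
  proof -
    have "khom p c F \<in> N" using N by (simp add: khom_def is_ideal_def)
    then show ?thesis using N(1) H(3)[OF N] by (simp add: is_ideal_def)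
  qed
  show ?case
    unfolding null_homotopy_def
  proof (intro exI[of _ ?H] conjI allI ballI impI)
    show "?H c \<in> kchains (Suc j)" if "c \<in> kchains j" for c j by (rule H1[OF that])
    show "kosz xv (?H c) G + ?H (kosz xv c) G = (s * x + f) * c G" for c G by (rule H2)
    show "?H c F \<in> N" if "is_ideal N" "\<forall>F. c F \<in> N" for N c F using H3 that by blast
  qed
qed

section \<open>Koszul homology modulo a nonzerodivisor\<close>

lemma kosz_mem_ideal:
  assumes "is_ideal N" "\<And>F. c F \<in> N"
  shows "kosz x c F \<in> N"
  unfolding kosz_def using assms by (intro is_ideal_sum) (auto simp: is_ideal_def)

lemma kchains_diff: "c \<in> kchains j \<Longrightarrow> d \<in> kchains j \<Longrightarrow> (\<lambda>F. c F - d F) \<in> kchains j"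
  for c :: "_ \<Rightarrow> 'a::ab_group_add"
  unfolding kchains_def by force

lemma kchains_scale: "c \<in> kchains j \<Longrightarrow> (\<lambda>F. s * c F) \<in> kchains j"
  for c :: "_ \<Rightarrow> 'a::comm_ring_1"
  unfolding kchains_def by force

lemma kchains_choose:
  fixes c :: "'n::finite set \<Rightarrow> 'a::comm_ring_1"
  assumes "c \<in> kchains j" "is_ideal N" "\<And>F. \<exists>k. c F - k * f \<in> N"
  obtains s where "s \<in> kchains j" "\<And>F. c F - s F * f \<in> N"
proof -
  from assms(3) obtain k where k: "\<And>F. c F - k F * f \<in> N" by metis
  define s where "s F = (if card F = j then k F else 0)" for F
  show ?thesis
  proof (rule that[of s])
    show "s \<in> kchains j" by (simp add: s_def kchains_def)
    fix F show "c F - s F * f \<in> N"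
    proof (cases "card F = j")
      case False
      then have "c F = 0" using assms(1) by (auto simp: kchains_def)
      with False assms(2) show ?thesis by (simp add: s_def is_ideal_def)
    qed (simp add: s_def k)
  qed
qed

text \<open>In the long exact sequence of multiplication by \<open>f\<close> on \<open>S/N\<close>,
  the map \<open>f\<close> is zero on Koszul homology, so the connecting map from
  \<open>H_(j+1)(S/(N,f))\<close> to \<open>H_j(S/N)\<close> is onto. Concretely, \<open>H z\<close>
  is a cycle modulo \<open>(N,f)\<close> with boundary \<open>f z\<close> modulo
  \<open>N\<close>.\<close>

lemma koszul_vanishes_of_quotient:
  fixes f :: "('n::finite, 'k::field) mpoly"
  assumes N: "is_ideal N" and f: "f \<in> max_ideal" and reg: "\<And>g. f * g \<in> N \<Longrightarrow> g \<in> N"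
    and van: "koszul_vanishes (Suc j) {g. \<exists>k. g - k * f \<in> N}"
  shows "koszul_vanishes j N"
  unfolding koszul_vanishes_def
proof (intro ballI impI)
  fix z :: "'n set \<Rightarrow> ('n, 'k) mpoly" assume z: "z \<in> kchains j" "\<forall>F. kosz xv z F \<in> N"
  obtain H where "null_homotopy f H" using max_ideal_null_homotopic[OF f] by blast
  note H = null_homotopyD[OF this]
  have Hz: "H (kosz xv z) F \<in> N" for F using H(3)[OF N] z(2) by blast
  have "kosz xv (H z) F \<in> {g. \<exists>k. g - k * f \<in> N}" for F
  proof -
    have "kosz xv (H z) F - z F * f = - H (kosz xv z) F"
      using H(2)[of z F] by (simp add: algebra_simps)
    moreover have "- H (kosz xv z) F \<in> N"
      using is_ideal_diff[OF N _ Hz, of 0] N by (simp add: is_ideal_def)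
    ultimately have "kosz xv (H z) F - z F * f \<in> N" by simp
    then show ?thesis by blast
  qed
  then obtain v where v: "v \<in> kchains (Suc (Suc j))" "\<And>F. \<exists>k. (H z F - kosz xv v F) - k * f \<in> N"
    using van H(1)[OF z(1)] unfolding koszul_vanishes_def by blast
  have "(\<lambda>F. H z F - kosz xv v F) \<in> kchains (Suc j)"
    by (intro kchains_diff H(1) z(1) kosz_kchains v(1))
  from kchains_choose[OF this N v(2)]
  obtain s where s: "s \<in> kchains (Suc j)" "\<And>F. (H z F - kosz xv v F) - s F * f \<in> N"
    by blast
  have "z F - kosz xv s F \<in> N" for F
  proof (rule reg)
    have "kosz xv (\<lambda>F. (H z F - kosz xv v F) - f * s F) F \<in> N"
      by (rule kosz_mem_ideal[OF N]) (use s(2) in \<open>simp add: mult.commute\<close>)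
    then have "kosz xv (H z) F - f * kosz xv s F \<in> N"
      by (simp add: kosz_diff kosz_scale kosz_kosz)
    then have "kosz xv (H z) F - f * kosz xv s F + H (kosz xv z) F \<in> N"
      using Hz N by (simp add: is_ideal_def)
    then show "f * (z F - kosz xv s F) \<in> N"
      using H(2)[of z F] by (simp add: algebra_simps)
  qed
  with s(1) show "\<exists>y\<in>kchains (Suc j). \<forall>F. z F - kosz xv y F \<in> N" by blast
qed

text \<open>In the same sequence \<open>H_(j+1)(S/(N,f))\<close> stands between
  \<open>H_(j+1)(S/N)\<close> and \<open>H_j(S/N)\<close>.\<close>

lemma koszul_vanishes_quotient:
  fixes f :: "('n::finite, 'k::field) mpoly"
  assumes N: "is_ideal N" and reg: "\<And>g. f * g \<in> N \<Longrightarrow> g \<in> N"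
    and van: "koszul_vanishes j N" "koszul_vanishes (Suc j) N"
  shows "koszul_vanishes (Suc j) {g. \<exists>k. g - k * f \<in> N}"
  unfolding koszul_vanishes_def
proof (intro ballI impI)
  fix z :: "'n set \<Rightarrow> ('n, 'k) mpoly"
  assume z: "z \<in> kchains (Suc j)" "\<forall>F. kosz xv z F \<in> {g. \<exists>k. g - k * f \<in> N}"
  then obtain v where v: "v \<in> kchains j" "\<And>F. kosz xv z F - v F * f \<in> N"
    using kchains_choose[OF kosz_kchains[OF z(1)] N] by blast
  have "kosz xv v F \<in> N" for F
  proof (rule reg)
    have "kosz xv (\<lambda>F. kosz xv z F - f * v F) F \<in> N"
      by (rule kosz_mem_ideal[OF N]) (use v(2) in \<open>simp add: mult.commute\<close>)
    then have "- (f * kosz xv v F) \<in> N" by (simp add: kosz_diff kosz_scale kosz_kosz)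
    then show "f * kosz xv v F \<in> N"
      using is_ideal_diff[OF N, of 0 "- (f * kosz xv v F)"] N by (simp add: is_ideal_def)
  qed
  then obtain y where y: "y \<in> kchains (Suc j)" "\<And>F. v F - kosz xv y F \<in> N"
    using van(1) v(1) unfolding koszul_vanishes_def by blast
  let ?z = "\<lambda>F. z F - f * y F"
  have "kosz xv ?z F \<in> N" for F
  proof -
    have "(kosz xv z F - v F * f) + f * (v F - kosz xv y F) \<in> N"
      using v(2)[of F] y(2)[of F] N by (simp add: is_ideal_def)
    then show ?thesis by (simp add: kosz_diff kosz_scale algebra_simps)
  qed
  moreover have "?z \<in> kchains (Suc j)" by (intro kchains_diff kchains_scale z(1) y(1))
  ultimately obtain y' where y': "y' \<in> kchains (Suc (Suc j))" "\<And>F. ?z F - kosz xv y' F \<in> N"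
    using van(2) unfolding koszul_vanishes_def by blast
  have "z F - kosz xv y' F - y F * f \<in> N" for F
    using y'(2)[of F] by (simp add: algebra_simps)
  then show "\<exists>y\<in>kchains (Suc (Suc j)). \<forall>F. z F - kosz xv y F \<in> {g. \<exists>k. g - k * f \<in> N}"
    using y'(1) by blast
qed

lemma koszul_vanishes_large:
  fixes N :: "('n::finite, 'k::field) mpoly set"
  assumes "card (UNIV :: 'n set) < j" "is_ideal N"
  shows "koszul_vanishes j N"
  unfolding koszul_vanishes_def
proof (intro ballI impI)
  fix z :: "'n set \<Rightarrow> ('n, 'k) mpoly" assume z: "z \<in> kchains j"
  have "z F = 0" for F
  proof (rule ccontr)
    assume "z F \<noteq> 0"
    then have "card F = j" using z by (simp add: kchains_def)
    moreover have "card F \<le> card (UNIV :: 'n set)" by (rule card_mono) auto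
    ultimately show False using assms(1) by simp
  qed
  then show "\<exists>y\<in>kchains (Suc j). \<forall>F. z F - kosz xv y F \<in> N"
    using assms(2) by (intro bexI[of _ "\<lambda>F. 0"]) (auto simp: kchains_def is_ideal_def)
qed

section \<open>Regular sequences and depth\<close>

lemma set_take_Suc: "i < length fs \<Longrightarrow> set (take (Suc i) fs) = insert (fs ! i) (set (take i fs))"
  by (simp add: take_Suc_conv_app_nth)

text \<open>Each element of the sequence pushes nonvanishing homology up by one degree, and there is
  none above the number of variables.\<close>

lemma regular_length_le:
  fixes L :: "('n::finite, 'k::field) mpoly set"
  assumes L: "is_ideal L" and fs: "set fs \<subseteq> max_ideal" "regular_on_quotient L fs"
    and nv: "\<not> koszul_vanishes j L"
  shows "j + length fs \<le> card (UNIV :: 'n set)"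
proof -
  let ?N = "\<lambda>i. ideal_gen (L \<union> set (take i fs))"
  have "\<not> koszul_vanishes (j + i) (?N i)" if "i \<le> length fs" for i
    using that
  proof (induction i)
    case 0
    then show ?case using nv by (simp add: ideal_gen_ideal[OF L])
  next
    case (Suc i)
    then have i: "i < length fs" by simp
    have "?N (Suc i) = {g. \<exists>k. g - k * fs ! i \<in> ?N i}"
      unfolding set_take_Suc[OF i] Un_insert_right ideal_gen_insert ..
    moreover have "fs ! i \<in> max_ideal" using fs(1) i by auto
    moreover have "g \<in> ?N i" if "fs ! i * g \<in> ?N i" for g
      using fs(2) i that unfolding regular_on_quotient_def by blast
    ultimately show ?case
      using koszul_vanishes_of_quotient[OF is_ideal_ideal_gen, of "fs ! i" "L \<union> set (take i fs)" "j + i"] Suc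
      by auto
  qed
  from this[of "length fs"] have "\<not> koszul_vanishes (j + length fs) (ideal_gen (L \<union> set fs))" by simp
  then show ?thesis using koszul_vanishes_large[OF _ is_ideal_ideal_gen] by (meson linorder_not_le)
qed

text \<open>The top Koszul homology of \<open>S/N\<close> is its socle: \<open>g\<close> placed on
  the full cell is a cycle when the maximal ideal kills \<open>g\<close>, and there are no
  boundaries in top degree. A zero socle is what \<open>exists_nonzerodivisor\<close> asks
  for.\<close>

lemma nonzerodivisor_if_koszul_vanishes:
  fixes N :: "('n::finite, 'k::field) mpoly set"
  assumes N: "is_ideal N" and van: "koszul_vanishes (card (UNIV :: 'n set)) N"
  shows "\<exists>f\<in>max_ideal. \<forall>g. f * g \<in> N \<longrightarrow> g \<in> N"
proof (rule exists_nonzerodivisor[OF ascending_chain_condition N is_ideal_max_ideal])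
  fix g :: "('n, 'k) mpoly" assume g: "\<And>f. f \<in> max_ideal \<Longrightarrow> f * g \<in> N"
  define z :: "'n set \<Rightarrow> ('n, 'k) mpoly" where "z F = (if F = UNIV then g else 0)" for F
  have "z \<in> kchains (card (UNIV :: 'n set))" by (simp add: kchains_def z_def)
  moreover have "kosz xv z F \<in> N" for F
    unfolding kosz_def
  proof (rule is_ideal_sum[OF N])
    fix p
    have "xv p \<in> (max_ideal :: ('n, 'k) mpoly set)"
      unfolding max_ideal_def ideal_gen_def xv_def by (rule module.span_base[OF module_mult]) blast
    then have "xv p * z (insert p F) \<in> N" using g N by (simp add: z_def is_ideal_def)
    then show "sg p F * xv p * z (insert p F) \<in> N" using N by (simp add: is_ideal_def mult.assoc)
  qed
  ultimately obtain y where y: "y \<in> kchains (Suc (card (UNIV :: 'n set)))" "\<And>F. z F - kosz xv y F \<in> N"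
    using van unfolding koszul_vanishes_def by blast
  have "kosz xv y UNIV = 0" by (simp add: kosz_def)
  then show "g \<in> N" using y(2)[of UNIV] by (simp add: z_def)
qed

text \<open>While \<open>j1 + r\<close> is below the number of variables, the top Koszul homology
  modulo the sequence so far vanishes, which supplies the next element. By
  \<open>koszul_vanishes_quotient\<close> the range of vanishing then starts one degree
  later.\<close>

lemma exists_regular_sequence:
  fixes L :: "('n::finite, 'k::field) mpoly set"
  assumes L: "is_ideal L" "L \<subseteq> max_ideal" and van: "\<And>j. j1 < j \<Longrightarrow> koszul_vanishes j L"
    and r: "j1 + r \<le> card (UNIV :: 'n set)"
  shows "\<exists>fs. length fs = r \<and> set fs \<subseteq> max_ideal \<and> regular_on_quotient L fs \<and>
    (\<forall>j>j1 + r. koszul_vanishes j (ideal_gen (L \<union> set fs)))"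
  using r
proof (induction r)
  case 0
  have "L \<noteq> UNIV" using L(2) one_notin_max_ideal by auto
  then have "regular_on_quotient L []"
    by (simp add: regular_on_quotient_def ideal_gen_ideal[OF L(1)])
  then show ?case using van by (simp add: ideal_gen_ideal[OF L(1)])
next
  case (Suc r)
  then obtain fs where fs: "length fs = r" "set fs \<subseteq> max_ideal" "regular_on_quotient L fs"
    "\<And>j. j1 + r < j \<Longrightarrow> koszul_vanishes j (ideal_gen (L \<union> set fs))" by auto
  let ?N = "ideal_gen (L \<union> set fs)"
  obtain f where f: "f \<in> max_ideal" "\<And>g. f * g \<in> ?N \<Longrightarrow> g \<in> ?N"
    using nonzerodivisor_if_koszul_vanishes[OF is_ideal_ideal_gen, of "L \<union> set fs"] fs(4) Suc.prems by auto
  have N': "ideal_gen (L \<union> set (fs @ [f])) = {g. \<exists>k. g - k * f \<in> ?N}"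
    using ideal_gen_insert[of f "L \<union> set fs"] by simp
  have max: "set (fs @ [f]) \<subseteq> max_ideal" using fs(2) f(1) by simp
  have "regular_on_quotient L (fs @ [f])"
    unfolding regular_on_quotient_def
  proof (intro conjI allI impI)
    fix i g assume i: "i < length (fs @ [f])" and g: "(fs @ [f]) ! i * g \<in> ideal_gen (L \<union> set (take i (fs @ [f])))"
    show "g \<in> ideal_gen (L \<union> set (take i (fs @ [f])))"
    proof (cases "i < length fs")
      case True
      then show ?thesis using fs(3) g by (simp add: regular_on_quotient_def nth_append)
    next
      case False
      then have "i = length fs" using i by simp
      then show ?thesis using f(2) g by simp
    qed
  next
    have "ideal_gen (L \<union> set (fs @ [f])) \<subseteq> max_ideal"
      using module.span_mono[OF module_mult, of "L \<union> set (fs @ [f])" max_ideal] L(2) max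
        ideal_gen_ideal[OF is_ideal_max_ideal] unfolding ideal_gen_def by blast
    then show "ideal_gen (L \<union> set (fs @ [f])) \<noteq> UNIV" using one_notin_max_ideal by auto
  qed
  moreover have "koszul_vanishes j (ideal_gen (L \<union> set (fs @ [f])))" if j: "j1 + Suc r < j" for j
  proof -
    obtain j' where j': "j = Suc j'" "j1 + r < j'" using j by (cases j) auto
    show ?thesis unfolding N' j'(1)
      using koszul_vanishes_quotient[OF is_ideal_ideal_gen f(2) fs(4) fs(4)] j'(2) by simp
  qed
  ultimately show ?case using fs(1) max by (intro exI[of _ "fs @ [f]"]) simp
qed

text \<open>Both depths are compared with the number of variables minus \<open>j1\<close>: it bounds
  the length of regular sequences on \<open>S/L'\<close> and is attained on
  \<open>S/L\<close>.\<close>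

lemma depth_quotient_le:
  fixes L L' :: "('n::finite, 'k::field) mpoly set"
  assumes L: "is_ideal L" "L \<subseteq> max_ideal" and van: "\<And>j. j1 < j \<Longrightarrow> koszul_vanishes j L"
    and L': "is_ideal L'" "L' \<subseteq> max_ideal" and nv: "\<not> koszul_vanishes j1 L'"
  shows "depth_quotient L' \<le> depth_quotient L"
proof -
  have neq: "L \<noteq> UNIV" "L' \<noteq> UNIV" using L(2) L'(2) one_notin_max_ideal by auto
  then have "regular_on_quotient L' []"
    by (simp add: regular_on_quotient_def ideal_gen_ideal[OF L'(1)])
  from regular_length_le[OF L'(1) _ this nv] have j1: "j1 \<le> card (UNIV :: 'n set)" by simp
  have "depth_quotient L' \<le> enat (card (UNIV :: 'n set) - j1)"
    unfolding depth_quotient_def using neq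
    by (auto intro!: SUP_least dest!: regular_length_le[OF L'(1) _ _ nv])
  moreover obtain fs where fs: "length fs = card (UNIV :: 'n set) - j1" "set fs \<subseteq> max_ideal" "regular_on_quotient L fs"
    using exists_regular_sequence[OF L, of j1 "card (UNIV :: 'n set) - j1"] van j1 by auto
  then have "enat (card (UNIV :: 'n set) - j1) \<le> depth_quotient L"
    unfolding depth_quotient_def using neq by (auto intro!: SUP_upper2[of fs])
  ultimately show ?thesis by (rule order_trans)
qed

section \<open>Koszul homology of a quotient and of its ideal\<close>

lemma kexact_UNIV: "kexact (Suc j) (UNIV :: ('n::finite, 'k::field) mpoly set)"
proof -
  have "gexact TYPE('k) (Suc j) UNIV a" for a :: "'n mon"
  proof (cases "a = 0")
    case True
    show ?thesis unfolding gexact_def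
    proof (intro ballI impI)
      fix c :: "'n set \<Rightarrow> 'k" assume c: "c \<in> gchains UNIV a (Suc j)"
      have "c F = 0" for F
      proof (rule ccontr)
        assume "c F \<noteq> 0"
        then obtain t where "card F = Suc j" "0 = t + ind F" using c True by (auto simp: gchains_def)
        then have "0 = mdeg t + Suc j" by (metis mdeg_add mdeg_ind mdeg_zero)
        then show False by simp
      qed
      then have "c = (\<lambda>_. 0)" by blast
      then show "\<exists>y\<in>gchains UNIV a (Suc (Suc j)). kosz (\<lambda>_. 1) y = c"
        by (intro bexI[of _ "\<lambda>_. 0"]) simp_all
    qed
  qed (rule gexact_UNIV)
  then have "kexact (Suc j) (pidl UNIV :: ('n, 'k) mpoly set)" by (simp add: kexact_iff)
  then show ?thesis by (simp add: pidl_def)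
qed

text \<open>The Koszul complex of \<open>S\<close> is acyclic in positive homological degrees, so
  \<open>H_(j+1)(S/L)\<close> embeds into \<open>H_j(L)\<close> by the boundary map.\<close>

lemma koszul_vanishes_Suc:
  fixes L :: "('n::finite, 'k::field) mpoly set"
  assumes "kexact j L"
  shows "koszul_vanishes (Suc j) L"
  unfolding koszul_vanishes_def
proof (intro ballI impI)
  fix z :: "'n set \<Rightarrow> ('n, 'k) mpoly" assume z: "z \<in> kchains (Suc j)" "\<forall>F. kosz xv z F \<in> L"
  then obtain y where y: "y \<in> kchains (Suc j)" "\<And>F. y F \<in> L" "kosz xv y = kosz xv z"
    using assms kosz_kchains[OF z(1)] kosz_kosz unfolding kexact_def by metis
  have "kosz xv (\<lambda>F. z F - y F) = (\<lambda>_. 0)" by (simp add: kosz_diff y(3))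
  then obtain v where "v \<in> kchains (Suc (Suc j))" "kosz xv v = (\<lambda>F. z F - y F)"
    using kexact_UNIV kchains_diff[OF z(1) y(1)] unfolding kexact_def by blast
  then show "\<exists>y\<in>kchains (Suc (Suc j)). \<forall>F. z F - kosz xv y F \<in> L"
    using y(2) by (intro bexI[of _ v]) simp_all
qed

text \<open>The dimension shift in the other direction: over \<open>S\<close> the cycle
  \<open>c\<close> bounds some \<open>y\<close>, which is then a cycle modulo the ideal. In
  multidegree \<open>0\<close> the Koszul complex of \<open>S\<close> is not exact, but
  \<open>0 \<notin> M\<close> leaves no chains there.\<close>

lemma gexact_if_koszul_vanishes:
  assumes van: "koszul_vanishes (Suc j) (pidl M :: ('n::finite, 'k::field) mpoly set)" and M: "0 \<notin> M"
  shows "gexact TYPE('k) j M a"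
  unfolding gexact_def
proof (intro ballI impI)
  fix c :: "'n set \<Rightarrow> 'k" assume c: "c \<in> gchains M a j" "kosz (\<lambda>_. 1) c = (\<lambda>_. 0)"
  show "\<exists>y\<in>gchains M a (Suc j). kosz (\<lambda>_. 1) y = c"
  proof (cases "a = 0")
    case True
    have "c F = 0" for F
    proof (rule ccontr)
      assume "c F \<noteq> 0"
      then obtain t where t: "t \<in> M" "0 = t + ind F" using c True by (auto simp: gchains_def)
      then have "t = 0" by (simp add: mon_eq_iff lookup_add)
      with t M show False by simp
    qed
    then have "c = (\<lambda>_. 0)" by blast
    then show ?thesis by (intro bexI[of _ "\<lambda>_. 0"]) simp_all
  next
    case False
    obtain y where y: "y \<in> gchains UNIV a (Suc j)" "kosz (\<lambda>_. 1) y = c"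
      using gexact_UNIV[OF False, where 'k = 'k] gchains_mono[of M UNIV a j] c unfolding gexact_def by blast
    have "\<forall>F. kosz xv (klift a y) F \<in> pidl M" unfolding kosz_klift[OF y(1)] y(2) using klift_pidl[OF c(1)] by blast
    then obtain v :: "'n set \<Rightarrow> ('n, 'k) mpoly" where v: "v \<in> kchains (Suc (Suc j))"
      "\<And>F. klift a y F - kosz xv v F \<in> pidl M"
      using van klift_kchains[OF y(1)] unfolding koszul_vanishes_def by blast
    let ?y = "\<lambda>F. klift a y F - kosz xv v F"
    have "?y \<in> kchains (Suc j)" by (intro kchains_diff klift_kchains[OF y(1)] kosz_kchains v(1))
    then have "kcoeff a ?y \<in> gchains M a (Suc j)" using v(2) by (rule kcoeff_gchains)
    moreover have "kosz (\<lambda>_. 1) (kcoeff a ?y) = c"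
      by (simp add: kosz_kcoeff kosz_diff kosz_kosz kosz_klift[OF y(1)] y(2) kcoeff_klift[OF c(1)])
    ultimately show ?thesis by blast
  qed
qed

text \<open>\<open>H_0\<close> is \<open>S\<close> modulo the maximal ideal, so the class of
  \<open>1\<close> survives.\<close>

lemma not_koszul_vanishes_0:
  fixes L :: "('n::finite, 'k::field) mpoly set"
  assumes "L \<subseteq> max_ideal" "0 \<in> L"
  shows "\<not> koszul_vanishes 0 L"
proof
  assume van: "koszul_vanishes 0 L"
  define z :: "'n set \<Rightarrow> ('n, 'k) mpoly" where "z F = (if F = {} then 1 else 0)" for F
  have z: "z \<in> kchains 0" by (simp add: kchains_def z_def)
  then obtain y where y: "\<And>F. z F - kosz xv y F \<in> L"
    using van assms(2) kosz_kchains_0[OF z] unfolding koszul_vanishes_def by metis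
  have "kosz xv y {} \<in> max_ideal"
    unfolding kosz_def
  proof (rule is_ideal_sum[OF is_ideal_max_ideal])
    fix p
    have "xv p \<in> (max_ideal :: ('n, 'k) mpoly set)"
      unfolding max_ideal_def ideal_gen_def xv_def by (rule module.span_base[OF module_mult]) blast
    then have "(sg p {} * y (insert p {})) * xv p \<in> max_ideal"
      using is_ideal_max_ideal unfolding is_ideal_def by blast
    then show "sg p {} * xv p * y (insert p {}) \<in> max_ideal" by (simp add: ac_simps)
  qed
  moreover have "1 - kosz xv y {} \<in> max_ideal" using y[of "{}"] assms(1) by (auto simp: z_def)
  ultimately have "(1 - kosz xv y {}) + kosz xv y {} \<in> max_ideal"
    using is_ideal_max_ideal unfolding is_ideal_def by blast
  then show False by (simp add: one_notin_max_ideal)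
qed

section \<open>Polymatroidal ideals\<close>

definition em :: "'n mon \<Rightarrow> 'n \<Rightarrow> int" where
  "em u = (\<lambda>p. int (lookup u p))"

lemma em_add: "em (u + v) = (\<lambda>p. em u p + em v p)"
  by (simp add: em_def lookup_add)

lemma em_ind: "em (ind F) = (\<lambda>p. of_bool (p \<in> F))"
  by (simp add: em_def fun_eq_iff)

lemma sum_em: "sum (em u) UNIV = int (mdeg u)"
  by (simp add: em_def mdeg_def)

lemma move_em_iff: "move i j (em u) = em w \<longleftrightarrow> w + single i 1 = u + single j 1"
proof -
  have "w + single i 1 = u + single j 1 \<longleftrightarrow>
      (\<forall>p. em w p + of_bool (p = i) = em u p + of_bool (p = j))"
  proof -
    have "(int (lookup (w + single i 1) p) = int (lookup (u + single j 1) p))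
        \<longleftrightarrow> em w p + of_bool (p = i) = em u p + of_bool (p = j)" for p
      by (cases "p = i"; cases "p = j") (auto simp: em_def lookup_add lookup_single)
    then show ?thesis unfolding mon_eq_iff by (simp only: of_nat_eq_iff[symmetric, where 'a = int])
  qed
  moreover have "(b + s = c + t) \<longleftrightarrow> (c + t - s = b)" for b s c t :: int by auto
  ultimately show ?thesis by (simp add: move_def fun_eq_iff)
qed

text \<open>The empty set is allowed, since a homological shift ideal may be zero.\<close>

definition polymatroid_gens :: "nat \<Rightarrow> 'n::finite mon set \<Rightarrow> bool" where
  "polymatroid_gens d G \<longleftrightarrow> finite G \<and> (\<forall>u\<in>G. mdeg u = d) \<and> mconvex (em ` G)"

lemma mconvex_set_em: "polymatroid_gens d G \<Longrightarrow> G \<noteq> {} \<Longrightarrow> mconvex_set (em ` G) (int d)"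
  by standard (auto simp: polymatroid_gens_def sum_em)

definition shift_gens :: "'n::finite mon set \<Rightarrow> nat \<Rightarrow> 'n mon set" where
  "shift_gens G i = {u + ind F | u F. u \<in> G \<and> F \<subseteq> lset G u \<and> card F = i}"

lemma shift_gens_empty [simp]: "shift_gens {} i = {}"
  by (simp add: shift_gens_def)

lemma mdeg_shift_gens: "polymatroid_gens d G \<Longrightarrow> a \<in> shift_gens G i \<Longrightarrow> mdeg a = d + i"
  by (auto simp: polymatroid_gens_def shift_gens_def)

text \<open>The exchange needed for linear quotients prescribes the coordinate that gains a unit,
  whereas \<open>mconvex\<close> prescribes the one that loses it; \<open>exchange_dual\<close>
  bridges the two.\<close>

lemma gexact_polymatroid_iff:
  assumes G: "polymatroid_gens d G"
  shows "gexact TYPE('k::comm_ring_1) j (upset G) a \<longleftrightarrow> a \<notin> shift_gens G j"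
proof -
  have "gexact TYPE('k) j (upset G) a \<longleftrightarrow> \<not> (\<exists>u\<in>G. \<exists>F\<subseteq>lset G u. card F = j \<and> a = u + ind F)"
  proof (rule gexact_linear_quotients)
    fix u v i assume uv: "u \<in> G" "v \<in> G" "lookup u i < lookup v i"
    interpret mconvex_set "em ` G" "int d" by (rule mconvex_set_em[OF G]) (use uv in auto)
    have "em u \<in> em ` G" "em v \<in> em ` G" "em u i < em v i" using uv by (auto simp: em_def)
    then obtain j where j: "em v j < em u j" "move j i (em u) \<in> em ` G" by (rule exchange_dual)
    then obtain w where "w \<in> G" "move j i (em u) = em w" by auto
    then show "\<exists>j. lookup v j < lookup u j \<and>
        (\<exists>w\<in>G. w + single j 1 = u + single i 1)"
      using j(1) unfolding move_em_iff by (intro exI[of _ j]) (auto simp: em_def)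
  qed (use G in \<open>auto simp: polymatroid_gens_def\<close>)
  then show ?thesis by (auto simp: shift_gens_def)
qed

lemma HS_polymatroid:
  assumes "polymatroid_gens d G"
  shows "HS i (pidl (upset G) :: ('n::finite, 'k::field) mpoly set) = pidl (upset (shift_gens G i))"
  unfolding HS_pidl gexact_polymatroid_iff[OF assms] by simp

lemma em_shift_gens: "em ` shift_gens G i = shifts (em ` G) i"
proof (intro equalityI subsetI)
  fix a assume "a \<in> em ` shift_gens G i"
  then obtain u F where u: "a = em (u + ind F)" "u \<in> G" "F \<subseteq> lset G u" "card F = i"
    by (auto simp: shift_gens_def)
  have a: "(\<lambda>p. a p - of_bool (p \<in> F)) = em u" by (simp add: u(1) em_add em_ind)
  have "\<exists>q. to_nat f < to_nat q \<and> move q f (em u) \<in> em ` G" if "f \<in> F" for f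
  proof -
    obtain q v where q: "to_nat f < to_nat q" "v \<in> G" "v + single q 1 = u + single f 1"
      using u(3) \<open>f \<in> F\<close> by (auto simp: lset_def)
    then have "move q f (em u) = em v" by (simp only: move_em_iff)
    with q show ?thesis by blast
  qed
  then show "a \<in> shifts (em ` G) i" unfolding shifts_def using a u(2,4) by auto
next
  fix a assume "a \<in> shifts (em ` G) i"
  then obtain F where F: "card F = i" "(\<lambda>p. a p - of_bool (p \<in> F)) \<in> em ` G"
    "\<And>f. f \<in> F \<Longrightarrow> \<exists>q. to_nat f < to_nat q \<and> move q f (\<lambda>p. a p - of_bool (p \<in> F)) \<in> em ` G"
    by (auto simp: shifts_def)
  then obtain u where u: "u \<in> G" "(\<lambda>p. a p - of_bool (p \<in> F)) = em u" by blast
  have "f \<in> lset G u" if f: "f \<in> F" for f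
  proof -
    obtain q v where "to_nat f < to_nat q" "v \<in> G" "move q f (em u) = em v"
      using F(3)[OF f] unfolding u(2) by blast
    then show ?thesis unfolding move_em_iff lset_def by blast
  qed
  then have "u + ind F \<in> shift_gens G i" using F(1) u(1) by (auto simp: shift_gens_def)
  moreover have "a = em (u + ind F)"
    using u(2) by (simp add: em_add em_ind fun_eq_iff algebra_simps)
  ultimately show "a \<in> em ` shift_gens G i" by blast
qed

lemma polymatroid_shift_gens:
  assumes G: "polymatroid_gens d G"
  shows "polymatroid_gens (d + i) (shift_gens G i)"
proof (cases "G = {}")
  case True
  then show ?thesis by (simp add: polymatroid_gens_def mconvex_def)
next
  case False
  have "shift_gens G i \<subseteq> (\<lambda>(u, F). u + ind F) ` (G \<times> UNIV)" by (auto simp: shift_gens_def)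
  moreover have "finite (G \<times> (UNIV :: 'a set set))" using G by (simp add: polymatroid_gens_def)
  ultimately have "finite (shift_gens G i)" using finite_surj by blast
  then show ?thesis
    using mdeg_shift_gens[OF G] mconvex_set.mconvex_shifts[OF mconvex_set_em[OF G False], of i]
    by (simp add: polymatroid_gens_def em_shift_gens)
qed

text \<open>The witnesses for \<open>lset G u\<close> translate along with \<open>u\<close>, so no
  variable is lost from the set when \<open>w\<close> is added.\<close>

lemma shift_gens_translate:
  assumes w: "\<And>u. u \<in> G \<Longrightarrow> w + u \<in> G'" and a: "a \<in> shift_gens G i"
  shows "w + a \<in> shift_gens G' i"
proof -
  obtain u F where u: "a = u + ind F" "u \<in> G" "F \<subseteq> lset G u" "card F = i"
    using a by (auto simp: shift_gens_def)
  have "f \<in> lset G' (w + u)" if "f \<in> lset G u" for f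
  proof -
    obtain q v where q: "to_nat f < to_nat q" "v \<in> G" "v + single q 1 = u + single f 1"
      using \<open>f \<in> lset G u\<close> by (auto simp: lset_def)
    then have "(w + v) + single q 1 = (w + u) + single f 1" by (simp add: add.assoc)
    with q(1) w[OF q(2)] show ?thesis unfolding lset_def by blast
  qed
  then have "F \<subseteq> lset G' (w + u)" using u(3) by blast
  then have "(w + u) + ind F \<in> shift_gens G' i" using w[OF u(2)] u(4) unfolding shift_gens_def by blast
  then show ?thesis by (simp add: u(1) add.assoc)
qed

section \<open>Generators of products and powers\<close>

definition gen_sum :: "'n mon set \<Rightarrow> 'n mon set \<Rightarrow> 'n mon set" where
  "gen_sum A B = {u + v | u v. u \<in> A \<and> v \<in> B}"

primrec gen_power :: "'n mon set \<Rightarrow> nat \<Rightarrow> 'n mon set" where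
  "gen_power G 0 = {0}"
| "gen_power G (Suc k) = gen_sum G (gen_power G k)"

lemma polymatroid_gen_sum:
  assumes A: "polymatroid_gens d A" and B: "polymatroid_gens e B"
  shows "polymatroid_gens (d + e) (gen_sum A B)"
proof -
  have "gen_sum A B = (\<lambda>(u, v). u + v) ` (A \<times> B)" by (auto simp: gen_sum_def)
  then have "finite (gen_sum A B)" using A B by (simp add: polymatroid_gens_def)
  moreover have "em ` gen_sum A B = msum (em ` A) (em ` B)"
  proof (intro equalityI subsetI)
    fix x assume "x \<in> em ` gen_sum A B"
    then obtain u v where "x = em (u + v)" "u \<in> A" "v \<in> B" by (auto simp: gen_sum_def)
    then show "x \<in> msum (em ` A) (em ` B)" unfolding msum_def em_add by blast
  next
    fix x assume "x \<in> msum (em ` A) (em ` B)"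
    then obtain u v where "x = em (u + v)" "u \<in> A" "v \<in> B" unfolding msum_def by (auto simp: em_add)
    then show "x \<in> em ` gen_sum A B" unfolding gen_sum_def by blast
  qed
  ultimately show ?thesis
    using A B mconvex_msum[of "em ` A" "em ` B"] by (auto simp: polymatroid_gens_def gen_sum_def)
qed

lemma polymatroid_gen_power:
  assumes "polymatroid_gens d G"
  shows "polymatroid_gens (k * d) (gen_power G k)"
proof (induction k)
  case 0
  show ?case by (simp add: polymatroid_gens_def mconvex_def)
next
  case (Suc k)
  show ?case using polymatroid_gen_sum[OF assms Suc] by simp
qed

lemma ideal_prod_pidl:
  "ideal_prod (pidl (upset A)) (pidl (upset B)) = (pidl (upset (gen_sum A B)) :: ('n, 'k::field) mpoly set)"
proof
  let ?J = "pidl (upset (gen_sum A B)) :: ('n, 'k) mpoly set"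
  let ?P = "{f * g | f g. f \<in> pidl (upset A) \<and> g \<in> pidl (upset B)} :: ('n, 'k) mpoly set"
  have "?P \<subseteq> ?J"
  proof
    fix h :: "('n, 'k) mpoly" assume "h \<in> ?P"
    then obtain f g :: "('n, 'k) mpoly" where h: "h = f * g" "f \<in> pidl (upset A)" "g \<in> pidl (upset B)" by auto
    show "h \<in> ?J"
      unfolding pidl_def
    proof (intro CollectI subsetI)
      fix t assume "t \<in> keys h"
      then have "t \<in> {x + y | x y. x \<in> keys f \<and> y \<in> keys g}"
        unfolding h(1) using keys_mult by fast
      then obtain x y where xy: "t = x + y" "x \<in> upset A" "y \<in> upset B" using h(2,3) by (auto simp: pidl_def)
      then obtain u r v s where "x = u + r" "u \<in> A" "y = v + s" "v \<in> B" by (auto simp: upset_def)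
      then have "t = (u + v) + (r + s)" "u + v \<in> gen_sum A B" using xy(1) by (auto simp: gen_sum_def ac_simps)
      then show "t \<in> upset (gen_sum A B)" unfolding upset_def by blast
    qed
  qed
  then have "ideal_gen ?P \<subseteq> ideal_gen ?J"
    unfolding ideal_gen_def by (rule module.span_mono[OF module_mult])
  then show "ideal_prod (pidl (upset A)) (pidl (upset B)) \<subseteq> ?J"
    unfolding ideal_prod_def ideal_gen_ideal[OF is_ideal_pidl] .
  have "monom ` gen_sum A B \<subseteq> ?P"
  proof
    fix h :: "('n, 'k) mpoly" assume "h \<in> monom ` gen_sum A B"
    then obtain u v where "h = monom u * monom v" "u \<in> A" "v \<in> B" by (auto simp: gen_sum_def monom_add)
    then show "h \<in> ?P" using monom_mem_pidl upset_superset by blast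
  qed
  then show "?J \<subseteq> ideal_prod (pidl (upset A)) (pidl (upset B))"
    unfolding ideal_prod_def ideal_gen_monom[symmetric]
    unfolding ideal_gen_def by (rule module.span_mono[OF module_mult])
qed

lemma ideal_power_pidl:
  "ideal_power (pidl (upset G)) k = (pidl (upset (gen_power G k)) :: ('n, 'k::field) mpoly set)"
proof (induction k)
  case 0
  have "upset {0 :: 'n mon} = UNIV" by (auto simp: upset_def)
  then show ?case by (simp add: pidl_def)
qed (simp add: ideal_prod_pidl)

lemma finite_mdeg: "finite {u :: 'n::finite mon. mdeg u = d}"
proof (rule finite_imageD)
  have "finite {f :: 'n \<Rightarrow> nat. \<forall>x. (x \<in> UNIV \<longrightarrow> f x \<in> {..d}) \<and> (x \<notin> UNIV \<longrightarrow> f x = 0)}"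
    by (rule finite_set_of_finite_funs) auto
  then show "finite (lookup ` {u :: 'n mon. mdeg u = d})"
  proof (rule rev_finite_subset)
    have "lookup u x \<le> mdeg u" for u :: "'n mon" and x
      unfolding mdeg_def by (rule member_le_sum) auto
    then show "lookup ` {u :: 'n mon. mdeg u = d} \<subseteq>
        {f. \<forall>x. (x \<in> UNIV \<longrightarrow> f x \<in> {..d}) \<and> (x \<notin> UNIV \<longrightarrow> f x = 0)}" by auto
  qed
  show "inj_on lookup {u :: 'n mon. mdeg u = d}"
    by (simp add: inj_on_def poly_mapping.lookup_inject)
qed

lemma polymatroidal_gens:
  fixes I :: "('n::finite, 'k::field) mpoly set"
  assumes "polymatroidal I"
  obtains d where "polymatroid_gens d (min_gens I)" "min_gens I \<noteq> {}" "I = pidl (upset (min_gens I))"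
proof -
  let ?G = "min_gens I"
  have I: "I = pidl (upset ?G)"
    using ideal_gen_min_gens[of I] assms by (simp add: polymatroidal_def ideal_gen_monom)
  have "?G \<noteq> {}"
  proof
    assume "?G = {}"
    then have "I = {0}" using I by (simp add: upset_def pidl_def)
    with assms show False by (simp add: polymatroidal_def)
  qed
  then obtain u0 where u0: "u0 \<in> ?G" by blast
  have deg: "mdeg u = mdeg u0" if "u \<in> ?G" for u
    using assms u0 that unfolding polymatroidal_def mdeg_def by blast
  have "finite ?G" by (rule finite_subset[OF _ finite_mdeg[of "mdeg u0"]]) (use deg in auto)
  moreover have "mconvex (em ` ?G)"
    unfolding mconvex_def
  proof (intro ballI allI impI)
    fix x y i assume x: "x \<in> em ` ?G" and y: "y \<in> em ` ?G" and i: "y i < x i"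
    obtain u v where u: "x = em u" "u \<in> ?G" and v: "y = em v" "v \<in> ?G" using x y by auto
    have ui: "lookup v i < lookup u i" using i u v by (simp add: em_def)
    then obtain j where j: "lookup u j < lookup v j"
      "single j 1 + (u - single i 1) \<in> ?G"
      using assms u(2) v(2) unfolding polymatroidal_def by blast
    have "move i j (em u) = em (single j 1 + (u - single i 1))"
      unfolding move_em_iff
    proof -
      obtain m where m: "u = single i 1 + m"
        using mon_split_single[of u i] ui by (metis less_nat_zero_code)
      show "single j 1 + (u - single i 1) + single i 1 = u + single j 1"
        unfolding m by (simp add: ac_simps)
    qed
    with j u v show "\<exists>j. x j < y j \<and> move i j x \<in> em ` ?G"
      by (intro exI[of _ j]) (auto simp: em_def)
  qed
  ultimately have "polymatroid_gens (mdeg u0) ?G" using deg by (auto simp: polymatroid_gens_def)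
  then show ?thesis using \<open>?G \<noteq> {}\<close> I by (rule that)
qed

text \<open>Translation by \<open>w\<close> turns the highest nonzero Tor of \<open>L\<close> into a
  nonzero Tor of \<open>L'\<close> in the same homological degree, which is the situation of
  \<open>depth_quotient_le\<close>. Since \<open>0\<close> lies in neither \<open>upset\<close>,
  both ideals are proper.\<close>

lemma depth_polymatroid_le:
  fixes A A' :: "'n::finite mon set"
  defines "L \<equiv> (pidl (upset A) :: ('n, 'k::field) mpoly set)" and "L' \<equiv> (pidl (upset A') :: ('n, 'k) mpoly set)"
  assumes A: "polymatroid_gens d A" and A': "polymatroid_gens d' A'"
    and w: "\<And>u. u \<in> A \<Longrightarrow> w + u \<in> A'" and A0: "0 \<notin> upset A" "0 \<notin> upset A'"
  shows "depth_quotient L' \<le> depth_quotient L"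
proof -
  have sub: "L \<subseteq> max_ideal" "L' \<subseteq> max_ideal"
    using A0 unfolding L_def L'_def max_ideal_pidl by (auto simp: pidl_def)
  define X where "X = {j. shift_gens A j \<noteq> {}}"
  \<comment> \<open>The highest degree of nonzero Koszul homology of \<open>S/L\<close>: one more
    than that of \<open>L\<close> because of the dimension shift, and \<open>0\<close> for the zero
    ideal, where the quotient is \<open>S\<close> itself.\<close>
  define j1 where "j1 = (if A = {} then 0 else Suc (Max X))"
  have "finite X"
  proof (rule finite_subset)
    show "X \<subseteq> {..card (UNIV :: 'n set)}"
      by (auto simp: X_def shift_gens_def intro: card_mono)
  qed simp
  have X: "Max X \<in> X" if "A \<noteq> {}"
  proof -
    have "0 \<in> X" using that by (auto simp: X_def shift_gens_def)
    then show ?thesis using \<open>finite X\<close> by (intro Max_in) auto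
  qed
  show ?thesis
  proof (rule depth_quotient_le[where ?j1.0 = j1])
    show "is_ideal L" "is_ideal L'" unfolding L_def L'_def by (rule is_ideal_pidl)+
    show "koszul_vanishes j L" if j: "j1 < j" for j
    proof -
      obtain j' where j': "j = Suc j'" "j1 \<le> j'" using j by (cases j) auto
      have "shift_gens A j' = {}"
      proof (rule ccontr)
        assume "shift_gens A j' \<noteq> {}"
        then have "A \<noteq> {}" "j' \<in> X" by (auto simp: X_def)
        then show False using Max_ge[OF \<open>finite X\<close>, of j'] j'(2) by (simp add: j1_def)
      qed
      then have "gexact TYPE('k) j' (upset A) a" for a by (simp add: gexact_polymatroid_iff[OF A])
      then have "kexact j' L" unfolding L_def kexact_iff by blast
      then show ?thesis unfolding j'(1) by (rule koszul_vanishes_Suc)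
    qed
    show "\<not> koszul_vanishes j1 L'"
    proof (cases "A = {}")
      case True
      then show ?thesis using not_koszul_vanishes_0[OF sub(2)] by (simp add: j1_def L'_def pidl_def)
    next
      case False
      then obtain a where "a \<in> shift_gens A (Max X)" using X by (auto simp: X_def)
      then have "w + a \<in> shift_gens A' (Max X)" using w by (rule shift_gens_translate[rotated])
      then have "\<not> gexact TYPE('k) (Max X) (upset A') (w + a)" by (simp add: gexact_polymatroid_iff[OF A'])
      then have "\<not> koszul_vanishes (Suc (Max X)) L'"
        using gexact_if_koszul_vanishes A0(2) unfolding L'_def by blast
      then show ?thesis using False by (simp add: j1_def)
    qed
  qed (rule sub)+
qed

theorem theorem6p2:
  fixes I :: "('n::finite, 'k::field) mpoly set"
  assumes "polymatroidal I"
  shows "(\<forall>i j k. k \<ge> 1 \<longrightarrow>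
            betti j (HS i (ideal_power I k)) \<le> betti j (HS i (ideal_power I (k + 1)))) \<and>
         (\<forall>i k. k \<ge> 1 \<longrightarrow>
            depth_quotient (HS i (ideal_power I k)) \<ge> depth_quotient (HS i (ideal_power I (k + 1))))"
proof -
  obtain d where G: "polymatroid_gens d (min_gens I)" "min_gens I \<noteq> {}" "I = pidl (upset (min_gens I))"
    using assms by (rule polymatroidal_gens)
  define G where "G = min_gens I"
  note G = G[folded G_def]
  obtain w where w: "w \<in> G" using G(2) by blast
  define A where "A i k = shift_gens (gen_power G k) i" for i k
  have HS: "HS i (ideal_power I k) = pidl (upset (A i k))" for i k
    using HS_polymatroid[OF polymatroid_gen_power[OF G(1)]]
    by (subst G(3)) (simp add: ideal_power_pidl A_def)
  have A: "polymatroid_gens (k * d + i) (A i k)" for i k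
    unfolding A_def by (rule polymatroid_shift_gens[OF polymatroid_gen_power[OF G(1)]])
  have wG: "w + u \<in> gen_power G (Suc k)" if "u \<in> gen_power G k" for u k
    using w that by (auto simp: gen_sum_def)
  have wA: "w + a \<in> A i (Suc k)" if "a \<in> A i k" for a i k
    using shift_gens_translate[OF wG] that unfolding A_def by blast
  have mw: "mdeg w = d" using G(1) w by (simp add: polymatroid_gens_def)
  have "betti j (HS i (ideal_power I k)) \<le> betti j (HS i (ideal_power I (k + 1)))" for i j k
    unfolding HS Suc_eq_plus1[symmetric]
  proof (rule betti_mono[OF _ wA])
    show "mdeg v = (k * d + i) + mdeg w" if "v \<in> A i (Suc k)" for v
      using A[of "Suc k" i] that mw by (simp add: polymatroid_gens_def)
    show "gexact TYPE('k) j (upset (A i k)) a" if "mdeg a \<noteq> (k * d + i) + j" for a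
      unfolding gexact_polymatroid_iff[OF A] using mdeg_shift_gens[OF A] that by blast
  qed
  moreover have "depth_quotient (HS i (ideal_power I (k + 1))) \<le> depth_quotient (HS i (ideal_power I k))" for i k
    unfolding HS Suc_eq_plus1[symmetric]
  proof (cases "0 \<in> upset (A i k)")
    \<comment> \<open>The smaller power gives the unit ideal, whose quotient is zero and has depth
      \<open>\<infinity>\<close>.\<close>
    case True
    then have "upset (A i k) = UNIV" using upset_closed[OF True] by auto
    then have "(pidl (upset (A i k)) :: ('n, 'k) mpoly set) = UNIV" by (simp add: pidl_def)
    then show "depth_quotient (pidl (upset (A i (Suc k))) :: ('n, 'k) mpoly set) \<le>
        depth_quotient (pidl (upset (A i k)) :: ('n, 'k) mpoly set)"
      by (simp add: depth_quotient_def)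
  next
    case False
    have add_0: "u = 0 \<and> v = 0" if "0 = u + v" for u v :: "'n mon"
      using that by (auto simp: mon_eq_iff lookup_add)
    \<comment> \<open>A constant generator for the power \<open>k + 1\<close> forces
      \<open>i = 0\<close> and a constant among the generators of the power \<open>k\<close>, which
      returns to the excluded case.\<close>
    have "0 \<notin> upset (A i (Suc k))"
    proof
      assume "0 \<in> upset (A i (Suc k))"
      then have "0 \<in> A i (Suc k)" using add_0 unfolding upset_def by blast
      then obtain u F where u: "0 = u + ind F" "u \<in> gen_power G (Suc k)" "card F = i"
        unfolding A_def shift_gens_def by blast
      then have "u = 0" "ind F = 0" using add_0 by blast+
      then have "F = {}" using mdeg_ind[of F] by simp
      then have "i = 0" using u(3) by simp
      obtain u' v where v: "u = u' + v" "v \<in> gen_power G k"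
        using u(2) unfolding gen_power.simps gen_sum_def by blast
      then have "v = 0" using add_0[of u' v] \<open>u = 0\<close> by simp
      then have "0 \<in> gen_power G k" using v(2) by simp
      then have "0 + ind {} \<in> A i k" unfolding A_def shift_gens_def using \<open>i = 0\<close> by force
      then show False using False upset_superset[of 0 "A i k"] by simp
    qed
    then show "depth_quotient (pidl (upset (A i (Suc k))) :: ('n, 'k) mpoly set) \<le>
        depth_quotient (pidl (upset (A i k)) :: ('n, 'k) mpoly set)"
      using depth_polymatroid_le[OF A A wA False] by blast
  qed
  ultimately show ?thesis by blast
qed

end
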